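(* Let $\mathfrak p(dx)=e^{-U_{\mathfrak p}(x)}dx$ and $\mathfrak q(dx)=e^{-U_{\mathfrak q}(x)}dx$ be probability measures on $\mathbb R^d$ with $U_{\mathfrak p},U_{\mathfrak q}\in C^1(\mathbb R^d)$. Assume (1) there exist $\gamma_{\mathfrak q}>0$ and $R_{\mathfrak q}\ge0$ with $-\frac12\langle\nabla U_{\mathfrak q}(x),x\rangle\le-\gamma_{\mathfrak q}|x|^2$ for all $|x|\ge R_{\mathfrak q}$; and (2) there exist $\alpha_{\mathfrak p}>0$ and $\tilde g_{\mathfrak p}\in\tilde{\mathcal G}$ with $\kappa_{U_{\mathfrak p}}(r)\ge\alpha_{\mathfrak p}-r^{-1}\tilde g_{\mathfrak p}(r)$ for all $r>0$. Then $$\mathbf W_1(\mathfrak p,\mathfrak q)\le\Big(\frac{\tilde g_{\mathfrak p}'(0)}{\tilde g_{\mathfrak p}'(R)}\Big)^2\frac{1}{\alpha_{\mathfrak p}+\tilde g_{\mathfrak p}'(0)}\int|\nabla U_{\mathfrak p}-\nabla U_{\mathfrak q}|\,d\mathfrak q=\Big(\frac{\tilde g_{\mathfrak p}'(0)}{\tilde g_{\mathfrak p}'(R)}\Big)^2\frac{1}{\alpha_{\mathfrak p}+\tilde g_{\mathfrak p}'(0)}\int\Big|\nabla\log\frac{d\mathfrak p}{d\mathfrak q}\Big|\,d\mathfrak q,$$ where $R:=\|\tilde g_{\mathfrak p}\|_\infty\big(\tilde g_{\mathfrak p}'(0)^{-1}+2/\alpha_{\mathfrak p}\big)$.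
   Context: For differentiable $U:\mathbb R^d\to\mathbb R$ and $r>0$, $\kappa_U(r):=\inf\{\langle\nabla U(x)-\nabla U(y),x-y\rangle/|x-y|^2: x,y\in\mathbb R^d,\ |x-y|=r\}$. $\mathcal G$ is the set of $g\in C^2((0,\infty),[0,\infty))$ such that $r\mapsto r^{1/2}g(r^{1/2})$ is non-decreasing and concave and $\lim_{r\downarrow0}rg(r)=0$; $\tilde{\mathcal G}$ is the set of bounded $g\in\mathcal G$ with $\lim_{r\downarrow0}g(r)=0$, $g'\ge0$ and $2g''+gg'\le0$. For $g\in\tilde{\mathcal G}$, $g'(0):=\lim_{r\downarrow0}g'(r)$ and $\|g\|_\infty:=\sup_{r>0}|g(r)|$. $\mathbf W_1$ is the order-one Wasserstein distance for the Euclidean norm. *)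

theory Defs
  imports "HOL-Probability.Probability"
begin

definition C1_grad :: "('a::euclidean_space \<Rightarrow> real) \<Rightarrow> ('a \<Rightarrow> 'a) \<Rightarrow> bool" where
  "C1_grad U G \<longleftrightarrow> (\<forall>x. (U has_derivative (\<lambda>h. inner (G x) h)) (at x)) \<and> continuous_on UNIV G"

text \<open>kappa_U(r), as an extended real infimum, for U with gradient G.\<close>
definition kappa :: "('a::euclidean_space \<Rightarrow> 'a) \<Rightarrow> real \<Rightarrow> ereal" where
  "kappa G r = (INF xy \<in> {(x, y). norm (x - y) = r}.
      ereal (inner (G (fst xy) - G (snd xy)) (fst xy - snd xy) / (norm (fst xy - snd xy))\<^sup>2))"

definition C2_pos :: "(real \<Rightarrow> real) \<Rightarrow> bool" where
  "C2_pos g \<longleftrightarrow> (\<forall>r>0. g differentiable (at r) \<and> deriv g differentiable (at r))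
      \<and> continuous_on {0<..} (deriv (deriv g))"

definition calG :: "(real \<Rightarrow> real) \<Rightarrow> bool" where
  "calG g \<longleftrightarrow> C2_pos g \<and> (\<forall>r>0. g r \<ge> 0)
     \<and> mono_on {0<..} (\<lambda>r. sqrt r * g (sqrt r))
     \<and> concave_on {0<..} (\<lambda>r. sqrt r * g (sqrt r))
     \<and> ((\<lambda>r. r * g r) \<longlongrightarrow> 0) (at_right 0)"

definition calG_tilde :: "(real \<Rightarrow> real) \<Rightarrow> bool" where
  "calG_tilde g \<longleftrightarrow> calG g \<and> bounded (g ` {0<..}) \<and> (g \<longlongrightarrow> 0) (at_right 0)
     \<and> (\<forall>r>0. deriv g r \<ge> 0)
     \<and> (\<forall>r>0. 2 * deriv (deriv g) r + g r * deriv g r \<le> 0)"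

definition sup_norm_pos :: "(real \<Rightarrow> real) \<Rightarrow> real" where
  "sup_norm_pos g = (SUP r \<in> {0<..}. \<bar>g r\<bar>)"

definition coupling :: "'a::euclidean_space measure \<Rightarrow> 'a measure \<Rightarrow> ('a \<times> 'a) measure \<Rightarrow> bool" where
  "coupling M N \<pi> \<longleftrightarrow> sets \<pi> = sets (borel \<Otimes>\<^sub>M borel)
     \<and> distr \<pi> borel fst = M \<and> distr \<pi> borel snd = N"

definition W1 :: "'a::euclidean_space measure \<Rightarrow> 'a measure \<Rightarrow> ennreal" where
  "W1 M N = (INF \<pi> \<in> {\<pi>. coupling M N \<pi>}. \<integral>\<^sup>+ z. ennreal (norm (fst z - snd z)) \<partial>\<pi>)"

end

theory Submission
  imports Defs
begin

text \<open>
  The reflection coupling argument, without stochastic differential equations. A density \<open>exp (- V)\<close> is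
  preserved by small symmetric jumps that are accepted with a reversible probability. Two such jumps, one for
  each measure, are coupled by mirroring the jump vector and sharing the acceptance variable; this turns any
  coupling \<open>\<pi>\<close> of \<open>p\<close> and \<open>q\<close> into another one. For a concave function \<open>f\<close> of the distance, one step satisfies
  \<open>\<integral> f d\<pi>' \<le> (1 - \<tau> \<lambda>) \<integral> f d\<pi> + \<tau> (C \<integral> |\<nabla>U\<^sub>p - \<nabla>U\<^sub>q| dq + error)\<close>, so taking the infimum over all couplings on
  both sides bounds the transport cost of \<open>f\<close> by \<open>(C / \<lambda>) \<integral> |\<nabla>U\<^sub>p - \<nabla>U\<^sub>q| dq\<close>, up to the error. The function \<open>f\<close> is
  \<open>g\<close> on \<open>[0, R]\<close>, continued linearly: there \<open>2 g'' + g g' \<le> 0\<close> compensates the lack of convexity, and beyond \<open>R\<close>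
  the convexity at infinity suffices. Cutting off the jumps outside a large ball makes all expansions uniform;
  what is lost there is controlled by the integrability of \<open>|x|\<close> and \<open>|\<nabla>U\<^sub>p|\<close> under \<open>p\<close>, of \<open>|x|\<close> under \<open>q\<close>, and
  of \<open>|\<nabla>U\<^sub>p - \<nabla>U\<^sub>q|\<close> under \<open>q\<close>. The gradient \<open>\<nabla>U\<^sub>q (y)\<close>, which may fail to be integrable, is compared with
  \<open>\<nabla>U\<^sub>p (y)\<close> and then, by approximate monotonicity, with \<open>\<nabla>U\<^sub>p (x)\<close>.
\<close>

text \<open>The diffusion imitated by the jumps has generator (\<Delta> - \<nabla>U \<bullet>
  \<nabla>) / 4, the origin of every factor 1/4 below. Where the cutoff is near 1, a jump
  \<open>t *\<^sub>R \<xi>\<close> is accepted with probability about 1/2 - t (\<xi> \<bullet>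
  \<nabla>U) / 4, and time is counted in units \<tau>, which is \<open>t\<^sup>2\<close> times the
  variance of one coordinate of \<xi>. A mirrored pair changes its distance by 2 t times the radial
  part of \<xi>, again with probability about 1/2, so its second-order term is exactly \<tau> f''.

  The tilt of the acceptance is multiplied by a jump of length t, so an error o(t) in it is
  negligible at the order \<open>t\<^sup>2\<close> of the drift. This is why potentials of class C1
  can be treated, and why the acceptance is an exponential, differentiable in the endpoint: the rule
  min(1, ratio) would have a kink.

  Comparing infima avoids optimal couplings and limits in time: a single step with fixed t gives an
  inequality from which \<tau> cancels, provided that some coupling has finite cost. Hence the first
  moments.\<close>

section \<open>Reflections\<close>

text \<open>Division by zero makes this the identity at \<open>e = 0\<close>, so shared noise is the
  special case of a zero mirror vector.\<close>

definition reflect :: "'a::euclidean_space \<Rightarrow> 'a \<Rightarrow> 'a" where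
  "reflect e x = x - (2 * (e \<bullet> x) / (e \<bullet> e)) *\<^sub>R e"

lemma reflect_0 [simp]: "reflect 0 x = x"
  by (simp add: reflect_def)

lemma reflect_add: "reflect e (x + y) = reflect e x + reflect e y"
  by (simp add: reflect_def inner_add_right add_divide_distrib scaleR_add_left distrib_left)

lemma inner_reflect_self: "e \<bullet> reflect e x = - (e \<bullet> x)"
  by (cases "e = 0") (simp_all add: reflect_def inner_diff_right)

lemma reflect_reflect [simp]: "reflect e (reflect e x) = x"
  by (simp add: inner_reflect_self reflect_def [of e "reflect e x"]) (simp add: reflect_def)

lemma inner_reflect: "reflect e x \<bullet> y = x \<bullet> reflect e y"
  by (simp add: reflect_def inner_diff_right inner_diff_left inner_commute)

lemma norm_reflect [simp]: "norm (reflect e x) = norm x"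
  by (simp add: norm_eq_sqrt_inner inner_reflect)

lemma borel_measurable_reflect [measurable (raw)]:
  assumes [measurable]: "f \<in> borel_measurable M" "h \<in> borel_measurable M"
  shows "(\<lambda>x. reflect (f x) (h x)) \<in> borel_measurable M"
  unfolding reflect_def by measurable

lemma emeasure_unit_ball:
  "emeasure lborel (ball (0::'a::euclidean_space) 1) \<noteq> 0"
  "emeasure lborel (ball (0::'a::euclidean_space) 1) \<noteq> \<infinity>"
  by (auto simp: emeasure_lborel_ball_finite less_top[symmetric] emeasure_ball content_ball_pos
        order_less_imp_not_eq2 unit_ball_vol_pos)

text \<open>An isometric image of Lebesgue measure is translation invariant; comparing it with Lebesgue
  measure itself in a double integral shows that the two are proportional.\<close>
lemma distr_lborel_reflect: "distr lborel borel (reflect e) = (lborel :: 'a::euclidean_space measure)"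
proof -
  define \<mu> where "\<mu> = distr lborel borel (reflect e)"
  have [measurable_cong, simp]: "sets \<mu> = sets borel" by (simp add: \<mu>_def)
  have [simp]: "space \<mu> = UNIV" by (simp add: \<mu>_def)
  have vim: "reflect e -` ball 0 1 = ball 0 1"
    by auto
  have ball_eq: "emeasure \<mu> (ball 0 1) = emeasure lborel (ball (0::'a) 1)"
    by (simp add: \<mu>_def emeasure_distr vim)
  have trans_l: "(\<integral>\<^sup>+x. h (x + y) \<partial>lborel) = (\<integral>\<^sup>+x. h x \<partial>lborel)"
    if [measurable]: "h \<in> borel_measurable borel" for h :: "'a \<Rightarrow> ennreal" and y
    by (subst lborel_distr_plus[of y, symmetric], subst nn_integral_distr) (simp_all add: add.commute)
  have trans_m: "(\<integral>\<^sup>+x. h (x + y) \<partial>\<mu>) = (\<integral>\<^sup>+x. h x \<partial>\<mu>)"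
    if [measurable]: "h \<in> borel_measurable borel" for h :: "'a \<Rightarrow> ennreal" and y
  proof -
    have "(\<integral>\<^sup>+x. h (x + y) \<partial>\<mu>) = (\<integral>\<^sup>+x. h (reflect e (x + reflect e y)) \<partial>lborel)"
      by (simp add: \<mu>_def nn_integral_distr reflect_add)
    also have "\<dots> = (\<integral>\<^sup>+x. h (reflect e x) \<partial>lborel)"
      by (rule trans_l[of "\<lambda>x. h (reflect e x)"]) measurable
    also have "\<dots> = (\<integral>\<^sup>+x. h x \<partial>\<mu>)"
      by (simp add: \<mu>_def nn_integral_distr)
    finally show ?thesis .
  qed
  interpret m: sigma_finite_measure \<mu>
  proof (rule sigma_finite_measure_distr)
    have "distr \<mu> borel (reflect e) = lborel"
      unfolding \<mu>_def by (subst distr_distr) (simp_all add: comp_def distr_id2)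
    then show "sigma_finite_measure (distr \<mu> borel (reflect e))"
      by (simp add: sigma_finite_lborel)
  qed measurable
  interpret pair_sigma_finite \<mu> "lborel :: 'a measure" ..
  \<comment> \<open>Shift \<open>y\<close> by \<open>x\<close>, then \<open>x\<close> by
    \<open>y\<close>; each shift preserves its own measure. With the unit ball as \<open>B\<close>,
    which reflections preserve, the factor of proportionality is 1.\<close>
  have swap: "emeasure \<mu> A * emeasure lborel B = emeasure \<mu> B * emeasure lborel (uminus -` A)"
    if [measurable]: "A \<in> sets borel" "B \<in> sets borel" for A B :: "'a set"
  proof -
    have [measurable]: "uminus -` A \<in> sets borel"
      using measurable_sets[of "uminus :: 'a \<Rightarrow> 'a" borel borel A] by simp
    have "emeasure \<mu> A * emeasure lborel B
        = (\<integral>\<^sup>+x. indicator A x * (\<integral>\<^sup>+y. indicator B y \<partial>lborel) \<partial>\<mu>)"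
      by (simp add: nn_integral_multc)
    also have "\<dots> = (\<integral>\<^sup>+x. (\<integral>\<^sup>+y. indicator A x * indicator B (y + x) \<partial>lborel) \<partial>\<mu>)"
      by (intro nn_integral_cong) (simp add: nn_integral_cmult trans_l[of "indicator B"] del: nn_integral_indicator)
    also have "\<dots> = (\<integral>\<^sup>+y. (\<integral>\<^sup>+x. indicator A x * indicator B (y + x) \<partial>\<mu>) \<partial>lborel)"
      by (rule Fubini'[symmetric]) measurable
    also have "\<dots> = (\<integral>\<^sup>+y. (\<integral>\<^sup>+x. indicator A (x - y) * indicator B x \<partial>\<mu>) \<partial>lborel)"
    proof (rule nn_integral_cong)
      fix y :: 'a
      show "(\<integral>\<^sup>+x. indicator A x * indicator B (y + x) \<partial>\<mu>) = (\<integral>\<^sup>+x. indicator A (x - y) * indicator B x \<partial>\<mu>)"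
        using trans_m[of "\<lambda>x. indicator A (x - y) * indicator B x" y] by (simp add: add.commute)
    qed
    also have "\<dots> = (\<integral>\<^sup>+x. (\<integral>\<^sup>+y. indicator A (x - y) * indicator B x \<partial>lborel) \<partial>\<mu>)"
      by (rule Fubini') measurable
    also have "\<dots> = (\<integral>\<^sup>+x. indicator B x * (\<integral>\<^sup>+y. indicator (uminus -` A) (y + (- x)) \<partial>lborel) \<partial>\<mu>)"
      by (intro nn_integral_cong, subst nn_integral_cmult[symmetric])
         (auto simp: indicator_def intro!: nn_integral_cong)
    also have "\<dots> = (\<integral>\<^sup>+x. indicator B x * (\<integral>\<^sup>+y. indicator (uminus -` A) y \<partial>lborel) \<partial>\<mu>)"
      by (subst trans_l) auto
    also have "\<dots> = emeasure \<mu> B * emeasure lborel (uminus -` A)"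
      by (subst nn_integral_indicator) (simp_all add: nn_integral_multc)
    finally show ?thesis .
  qed
  have neg: "emeasure lborel (uminus -` A) = emeasure lborel A" if [measurable]: "A \<in> sets borel" for A :: "'a set"
  proof -
    have "emeasure lborel A = emeasure (distr lborel borel uminus) A"
      using lborel_affine[of "-1" "0::'a"] by (simp add: density_1 uminus_add_conv_diff[symmetric])
    then show ?thesis by (simp add: emeasure_distr)
  qed
  show ?thesis
    unfolding \<mu>_def[symmetric]
  proof (rule measure_eqI)
    fix A assume "A \<in> sets \<mu>"
    then have A: "A \<in> sets borel" by simp
    have "emeasure \<mu> A * emeasure lborel (ball (0::'a) 1) = emeasure lborel A * emeasure lborel (ball (0::'a) 1)"
      using swap[OF A, of "ball 0 1"] by (simp add: neg[OF A] ball_eq mult.commute)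
    then show "emeasure \<mu> A = emeasure lborel A"
      using emeasure_unit_ball[where 'a='a] by (simp add: mult.commute[of _ "emeasure lborel (ball 0 1)"] ennreal_mult_cancel_left)
  qed simp
qed

section \<open>Isotropic noise\<close>

text \<open>A ball instead of a Gaussian: the jumps are bounded, so all expansions can be made
  uniform, while the invariance under reflections and under the change of sign is kept.\<close>

definition ball_law :: "'a::euclidean_space measure" where
  "ball_law = uniform_measure lborel (ball 0 1)"

definition noise :: "('a::euclidean_space \<times> real) measure" where
  "noise = ball_law \<Otimes>\<^sub>M uniform_measure lborel {0..1}"

lemma sets_ball_law [simp, measurable_cong]: "sets ball_law = sets borel"
  by (simp add: ball_law_def)

lemma space_ball_law [simp]: "space ball_law = UNIV"
  by (simp add: ball_law_def)

lemma sets_noise [simp, measurable_cong]: "sets noise = sets (borel \<Otimes>\<^sub>M borel)"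
  unfolding noise_def by (rule sets_pair_measure_cong) simp_all

lemma prob_space_ball_law: "prob_space (ball_law :: 'a::euclidean_space measure)"
  unfolding ball_law_def by (rule prob_space_uniform_measure[OF emeasure_unit_ball])

interpretation ubm: prob_space "ball_law :: 'a::euclidean_space measure"
  by (rule prob_space_ball_law)

lemma prob_space_uniform_01: "prob_space (uniform_measure lborel {0..1::real})"
  by (rule prob_space_uniform_measure) auto

interpretation noise: pair_prob_space "ball_law :: 'a::euclidean_space measure"
    "uniform_measure lborel {0..1::real}"
  by (intro pair_prob_space.intro pair_sigma_finite.intro prob_space_imp_sigma_finite
       prob_space_ball_law prob_space_uniform_01)

lemma prob_space_noise: "prob_space (noise :: ('a::euclidean_space \<times> real) measure)"
  unfolding noise_def by (rule noise.prob_space_axioms)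

lemma AE_ball_law: "AE \<xi> in ball_law. norm \<xi> < 1"
  unfolding ball_law_def by (rule AE_uniform_measureI) auto

lemma AE_noise: "AE w in noise. norm (fst w :: 'a::euclidean_space) < 1"
proof -
  have "AE w in ball_law \<Otimes>\<^sub>M uniform_measure lborel {0..1::real}. norm (fst w :: 'a) < 1"
  proof (rule noise.AE_pair_measure)
    show "{w \<in> space (ball_law \<Otimes>\<^sub>M uniform_measure lborel {0..1::real}). norm (fst w :: 'a) < 1}
        \<in> sets (ball_law \<Otimes>\<^sub>M uniform_measure lborel {0..1::real})"
      by measurable
  qed (use AE_ball_law in simp)
  then show ?thesis unfolding noise_def .
qed

lemma nn_integral_ball_law_reflect:
  fixes e :: "'a::euclidean_space"
  assumes [measurable]: "h \<in> borel_measurable borel"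
  shows "(\<integral>\<^sup>+\<xi>. h (reflect e \<xi>) \<partial>ball_law) = (\<integral>\<^sup>+\<xi>. h \<xi> \<partial>ball_law)"
proof -
  have ind: "indicator (ball 0 1) (reflect e x) = (indicator (ball 0 1) x :: ennreal)" for x
    by (simp add: indicator_def)
  have m: "(\<lambda>\<xi>. h \<xi> * indicator (ball 0 1) \<xi>) \<in> borel_measurable borel"
    by (intro borel_measurable_times_ennreal borel_measurable_indicator) simp_all
  have "(\<integral>\<^sup>+\<xi>. h \<xi> * indicator (ball 0 1) \<xi> \<partial>lborel)
      = (\<integral>\<^sup>+\<xi>. h (reflect e \<xi>) * indicator (ball 0 1) (reflect e \<xi>) \<partial>lborel)"
    by (subst distr_lborel_reflect[of e, symmetric], rule nn_integral_distr) (use m in simp_all)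
  then show ?thesis
    by (simp add: ball_law_def nn_integral_uniform_measure ind)
qed

lemma distr_ball_law_reflect:
  "distr ball_law borel (reflect e) = (ball_law :: 'a::euclidean_space measure)"
proof (rule measure_eqI)
  fix A assume "A \<in> sets (distr ball_law borel (reflect e))"
  then have [measurable]: "A \<in> sets borel" by simp
  have "emeasure (distr ball_law borel (reflect e)) A
      = (\<integral>\<^sup>+\<xi>. indicator A (reflect e \<xi>) \<partial>ball_law)"
    by (subst nn_integral_indicator[symmetric], simp) (simp add: nn_integral_distr del: nn_integral_indicator)
  also have "\<dots> = emeasure ball_law A"
    by (simp add: nn_integral_ball_law_reflect)
  finally show "emeasure (distr ball_law borel (reflect e)) A = emeasure ball_law A" .
qed simp

lemma integral_ball_law_reflect:
  fixes h :: "'a::euclidean_space \<Rightarrow> real"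
  assumes [measurable]: "h \<in> borel_measurable borel"
  shows "(\<integral>\<xi>. h (reflect e \<xi>) \<partial>ball_law) = (\<integral>\<xi>. h \<xi> \<partial>ball_law)"
  by (subst (2) distr_ball_law_reflect[of e, symmetric]) (simp add: integral_distr)

lemma nn_integral_ball_law_uminus:
  fixes h :: "'a::euclidean_space \<Rightarrow> ennreal"
  assumes [measurable]: "h \<in> borel_measurable borel"
  shows "(\<integral>\<^sup>+\<xi>. h (- \<xi>) \<partial>ball_law) = (\<integral>\<^sup>+\<xi>. h \<xi> \<partial>ball_law)"
proof -
  have ind: "indicator (ball 0 1) (- x) = (indicator (ball 0 1) x :: ennreal)" for x :: 'a
    by (simp add: indicator_def)
  have neg: "distr lborel borel uminus = (lborel :: 'a measure)"
    using lborel_affine[of "-1" "0::'a"] by (simp add: density_1 uminus_add_conv_diff[symmetric])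
  have m: "(\<lambda>\<xi>. h \<xi> * indicator (ball 0 1) \<xi>) \<in> borel_measurable borel"
    by (intro borel_measurable_times_ennreal borel_measurable_indicator) simp_all
  have "(\<integral>\<^sup>+\<xi>. h \<xi> * indicator (ball 0 1) \<xi> \<partial>lborel)
      = (\<integral>\<^sup>+\<xi>. h (- \<xi>) * indicator (ball 0 1) (- \<xi>) \<partial>lborel)"
    by (subst neg[symmetric], rule nn_integral_distr) (use m in simp_all)
  then show ?thesis
    by (simp add: ball_law_def nn_integral_uniform_measure ind)
qed

lemma integrable_ball_law:
  fixes h :: "'a::euclidean_space \<Rightarrow> real"
  assumes "h \<in> borel_measurable borel" "\<And>\<xi>. norm \<xi> < 1 \<Longrightarrow> \<bar>h \<xi>\<bar> \<le> B"
  shows "integrable ball_law h"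
proof (rule ubm.integrable_const_bound)
  show "AE \<xi> in ball_law. norm (h \<xi>) \<le> B"
    using AE_ball_law by eventually_elim (use assms in auto)
qed (use assms in simp)

lemma integrable_ball_law_mult:
  fixes h h' :: "'a::euclidean_space \<Rightarrow> real"
  assumes [measurable]: "h \<in> borel_measurable borel" "h' \<in> borel_measurable borel"
    and "\<And>\<xi>. norm \<xi> < 1 \<Longrightarrow> \<bar>h \<xi>\<bar> \<le> B" "\<And>\<xi>. norm \<xi> < 1 \<Longrightarrow> \<bar>h' \<xi>\<bar> \<le> B'"
  shows "integrable ball_law (\<lambda>\<xi>. h \<xi> * h' \<xi>)"
proof (rule integrable_ball_law)
  show "\<bar>h \<xi> * h' \<xi>\<bar> \<le> B * B'" if "norm \<xi> < 1" for \<xi>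
    unfolding abs_mult using assms(3,4)[OF that] by (intro mult_mono) auto
qed measurable

lemma abs_inner_le: "norm \<xi> < 1 \<Longrightarrow> \<bar>\<xi> \<bullet> v\<bar> \<le> norm v"
  using Cauchy_Schwarz_ineq2[of \<xi> v] by (smt (verit, best) mult_left_le_one_le norm_ge_zero)

lemma integral_ball_law_inner: "(\<integral>\<xi>. \<xi> \<bullet> v \<partial>ball_law) = 0"
proof -
  have "(\<integral>\<xi>. \<xi> \<bullet> v \<partial>ball_law) = (\<integral>\<xi>. reflect v \<xi> \<bullet> v \<partial>ball_law)"
    by (rule integral_ball_law_reflect[symmetric]) measurable
  also have "\<dots> = - (\<integral>\<xi>. \<xi> \<bullet> v \<partial>ball_law)"
    by (simp add: inner_commute[of _ v] inner_reflect_self)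
  finally show ?thesis by simp
qed

text \<open>By symmetry any unit vector gives this value, which is \<open>1 / (DIM('a) + 2)\<close>.
  It sets the time unit of one jump; the estimates use that it lies in (0, 1].\<close>

definition ball_variance :: "'a::euclidean_space itself \<Rightarrow> real" where
  "ball_variance _ = (\<integral>\<xi>. (\<xi> \<bullet> (SOME i. i \<in> Basis))\<^sup>2 \<partial>(ball_law :: 'a measure))"

text \<open>The reflection along \<open>e - u\<close> exchanges two vectors of equal length, and the
  law is invariant under it.\<close>

lemma integral_ball_law_inner_sq_eq:
  fixes e u :: "'a::euclidean_space"
  assumes "norm e = norm u"
  shows "(\<integral>\<xi>. (\<xi> \<bullet> e)\<^sup>2 \<partial>ball_law) = (\<integral>\<xi>. (\<xi> \<bullet> u)\<^sup>2 \<partial>ball_law)"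
proof -
  have ee: "e \<bullet> e = u \<bullet> u" using assms by (simp add: norm_eq)
  have "reflect (e - u) e = u"
  proof (cases "e = u")
    case False
    have 1: "(e - u) \<bullet> (e - u) = 2 * ((e - u) \<bullet> e)"
      by (simp add: inner_diff_left inner_diff_right ee inner_commute)
    moreover have "(e - u) \<bullet> (e - u) \<noteq> 0" using False by (simp del: inner_diff_left)
    ultimately have "2 * ((e - u) \<bullet> e) / ((e - u) \<bullet> (e - u)) = 1" by (metis divide_self)
    then show ?thesis unfolding reflect_def by (simp only:) simp
  qed simp
  then have "(\<integral>\<xi>. (\<xi> \<bullet> u)\<^sup>2 \<partial>ball_law) = (\<integral>\<xi>. (reflect (e - u) \<xi> \<bullet> e)\<^sup>2 \<partial>ball_law)"
    by (simp add: inner_reflect)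
  also have "\<dots> = (\<integral>\<xi>. (\<xi> \<bullet> e)\<^sup>2 \<partial>ball_law)"
    by (rule integral_ball_law_reflect) measurable
  finally show ?thesis ..
qed

lemma integral_ball_law_inner_sq:
  fixes v :: "'a::euclidean_space"
  shows "(\<integral>\<xi>. (\<xi> \<bullet> v)\<^sup>2 \<partial>ball_law) = ball_variance TYPE('a) * (norm v)\<^sup>2"
proof -
  define b where "b = (SOME i::'a. i \<in> Basis)"
  have "b \<in> Basis" unfolding b_def by (rule someI_ex) (use nonempty_Basis in blast)
  then have "norm v = norm (norm v *\<^sub>R b)" by simp
  then have "(\<integral>\<xi>. (\<xi> \<bullet> v)\<^sup>2 \<partial>ball_law) = (\<integral>\<xi>. (\<xi> \<bullet> (norm v *\<^sub>R b))\<^sup>2 \<partial>ball_law)"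
    by (rule integral_ball_law_inner_sq_eq)
  then show ?thesis
    by (simp add: ball_variance_def b_def[symmetric] power_mult_distrib)
qed

lemma integral_ball_law_inner_inner:
  fixes v w :: "'a::euclidean_space"
  shows "(\<integral>\<xi>. (\<xi> \<bullet> v) * (\<xi> \<bullet> w) \<partial>ball_law) = ball_variance TYPE('a) * (v \<bullet> w)"
proof -
  have int: "integrable ball_law (\<lambda>\<xi>. (\<xi> \<bullet> u)\<^sup>2)" for u :: 'a
    by (rule integrable_ball_law[where B="(norm u)\<^sup>2"])
       (auto simp: abs_le_square_iff[symmetric] abs_inner_le)
  have pol: "(\<lambda>\<xi>. (\<xi> \<bullet> v) * (\<xi> \<bullet> w)) = (\<lambda>\<xi>. ((\<xi> \<bullet> (v + w))\<^sup>2 - (\<xi> \<bullet> v)\<^sup>2 - (\<xi> \<bullet> w)\<^sup>2) / 2)"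
    by (simp add: inner_add_right power2_sum)
  have "(\<integral>\<xi>. (\<xi> \<bullet> v) * (\<xi> \<bullet> w) \<partial>ball_law)
      = ball_variance TYPE('a) * (((norm (v + w))\<^sup>2 - (norm v)\<^sup>2 - (norm w)\<^sup>2) / 2)"
    unfolding pol using int
    by (subst integral_divide_zero, subst Bochner_Integration.integral_diff, simp, simp,
        subst Bochner_Integration.integral_diff)
       (simp_all add: integral_ball_law_inner_sq right_diff_distrib)
  then show ?thesis
    by (simp add: power2_norm_eq_inner inner_add_left inner_add_right inner_commute)
qed

text \<open>Otherwise almost all of the unit ball would lie in a hyperplane.\<close>

lemma ball_variance_pos: "ball_variance TYPE('a::euclidean_space) > 0"
proof (rule ccontr)
  obtain b :: 'a where b: "b \<in> Basis" using nonempty_Basis by blast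
  assume "\<not> ball_variance TYPE('a) > 0"
  moreover have "0 \<le> (\<integral>\<xi>. (\<xi> \<bullet> b)\<^sup>2 \<partial>(ball_law :: 'a measure))"
    by (rule Bochner_Integration.integral_nonneg) simp
  ultimately have z: "(\<integral>\<xi>. (\<xi> \<bullet> b)\<^sup>2 \<partial>ball_law) = 0"
    using b by (simp add: integral_ball_law_inner_sq)
  have int: "integrable ball_law (\<lambda>\<xi>. (\<xi> \<bullet> b)\<^sup>2)"
    by (rule integrable_ball_law[where B="(norm b)\<^sup>2"])
       (auto simp: abs_le_square_iff[symmetric] abs_inner_le)
  have "AE \<xi> in ball_law. (\<xi> \<bullet> b)\<^sup>2 = 0"
    using z integral_nonneg_eq_0_iff_AE[OF int] by simp
  then have "AE \<xi> in lborel. \<xi> \<in> ball 0 1 \<longrightarrow> \<xi> \<bullet> b = 0"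
    unfolding ball_law_def
    by (subst (asm) AE_uniform_measure) (use emeasure_unit_ball in \<open>auto simp: less_top\<close>)
  moreover have "AE \<xi> in lborel. \<xi> \<bullet> b \<noteq> 0"
  proof -
    have "negligible {x. b \<bullet> x = 0}" using b by (intro negligible_hyperplane) auto
    then have "{x. b \<bullet> x = 0} \<in> null_sets lborel"
      by (simp add: negligible_iff_null_sets null_sets_completion_iff)
    from AE_not_in[OF this] show ?thesis by (simp add: inner_commute)
  qed
  ultimately have "AE \<xi> in lborel. \<xi> \<notin> ball (0::'a) 1" by eventually_elim auto
  then have "emeasure lborel (ball (0::'a) 1) = 0"
    by (subst (asm) AE_iff_measurable[where N="ball 0 1"]) auto
  then show False using emeasure_unit_ball by blast
qed

lemma ball_variance_le_1: "ball_variance TYPE('a::euclidean_space) \<le> 1"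
proof -
  obtain b :: 'a where b: "b \<in> Basis" using nonempty_Basis by blast
  have int: "integrable ball_law (\<lambda>\<xi>. (\<xi> \<bullet> b)\<^sup>2)"
    by (rule integrable_ball_law[where B="(norm b)\<^sup>2"])
       (auto simp: abs_le_square_iff[symmetric] abs_inner_le)
  have "(\<integral>\<xi>. (\<xi> \<bullet> b)\<^sup>2 \<partial>ball_law) \<le> 1"
    using AE_ball_law b
    by (intro ubm.integral_le_const[OF int])
       (auto elim!: eventually_mono simp: abs_square_le_1 intro!: order_trans[OF abs_inner_le])
  then show ?thesis using b by (simp add: integral_ball_law_inner_sq)
qed

section \<open>Integrating out the uniform variable that decides acceptance\<close>

lemma emeasure_uniform_01:
  assumes "0 \<le> c" "c \<le> 1"
  shows "emeasure (uniform_measure lborel {0..1::real}) {u. u < c} = ennreal c"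
proof -
  have "{0..1} \<inter> {u. u < c} = {0..<c}" using assms by auto
  then show ?thesis
    using assms by (subst emeasure_uniform_measure) (auto simp: divide_ennreal_def)
qed

lemma nn_integral_uniform_01_if:
  assumes "0 \<le> c" "c \<le> 1"
  shows "(\<integral>\<^sup>+u. (if u < c then p else q) \<partial>uniform_measure lborel {0..1::real})
      = ennreal c * p + ennreal (1 - c) * q"
proof -
  interpret U: prob_space "uniform_measure lborel {0..1::real}" by (rule prob_space_uniform_01)
  have "emeasure (uniform_measure lborel {0..1::real}) {u. \<not> u < c} = ennreal (1 - c)"
  proof -
    have "{0..1} \<inter> {u. \<not> u < c} = {c..1}" using assms by auto
    then show ?thesis
      using assms by (subst emeasure_uniform_measure) (auto simp: divide_ennreal_def)
  qed
  moreover have "(\<integral>\<^sup>+u. (if u < c then p else q) \<partial>uniform_measure lborel {0..1::real})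
      = (\<integral>\<^sup>+u. p * indicator {u. u < c} u + q * indicator {u. \<not> u < c} u \<partial>uniform_measure lborel {0..1::real})"
    by (intro nn_integral_cong) auto
  moreover have "\<dots> = p * emeasure (uniform_measure lborel {0..1::real}) {u. u < c}
       + q * emeasure (uniform_measure lborel {0..1::real}) {u. \<not> u < c}"
    by (subst nn_integral_add) (simp_all add: nn_integral_cmult_indicator)
  ultimately show ?thesis
    by (simp add: emeasure_uniform_01[OF assms] mult.commute del: emeasure_uniform_measure)
qed

text \<open>Averaging over the acceptance variable replaces the event of acceptance by its
  probability. Bounds are asked for on the open unit ball only, where the noise lives almost
  surely.\<close>

lemma integral_noise_if:
  fixes h :: "'a::euclidean_space \<Rightarrow> real"
  assumes [measurable]: "a \<in> borel_measurable borel" "h \<in> borel_measurable borel"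
    and a: "\<And>\<xi>. norm \<xi> < 1 \<Longrightarrow> 0 \<le> a \<xi> \<and> a \<xi> \<le> 1"
    and h: "\<And>\<xi>. norm \<xi> < 1 \<Longrightarrow> \<bar>h \<xi>\<bar> \<le> B"
  shows "integrable noise (\<lambda>w. if snd w < a (fst w) then h (fst w) else 0)" (is "integrable _ ?k")
    and "(\<integral>w. (if snd w < a (fst w) then h (fst w) else 0) \<partial>noise) = (\<integral>\<xi>. a \<xi> * h \<xi> \<partial>ball_law)"
proof -
  interpret N: prob_space "noise :: ('a \<times> real) measure" by (rule prob_space_noise)
  interpret U: prob_space "uniform_measure lborel {0..1::real}" by (rule prob_space_uniform_01)
  have B: "0 \<le> B" using h[of 0] by simp
  show int: "integrable noise ?k"
  proof (rule N.integrable_const_bound)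
    show "AE w in noise. norm (?k w) \<le> B"
      using AE_noise by eventually_elim (use h B in auto)
    show "?k \<in> borel_measurable noise" by measurable
  qed
  have "(\<integral>w. ?k w \<partial>noise)
      = (\<integral>\<xi>. (\<integral>u. (if u < a \<xi> then h \<xi> else 0) \<partial>uniform_measure lborel {0..1::real}) \<partial>ball_law)"
    using noise.integral_fst'[OF int[unfolded noise_def]] by (simp add: noise_def cong: if_cong)
  also have "\<dots> = (\<integral>\<xi>. a \<xi> * h \<xi> \<partial>ball_law)"
  proof (rule integral_cong_AE)
    show "AE \<xi> in ball_law. (\<integral>u. (if u < a \<xi> then h \<xi> else 0) \<partial>uniform_measure lborel {0..1::real}) = a \<xi> * h \<xi>"
      using AE_ball_law
    proof eventually_elim
      case (elim \<xi>)
      have "(\<integral>u. (if u < a \<xi> then h \<xi> else 0) \<partial>uniform_measure lborel {0..1::real})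
          = (\<integral>u. indicator {u. u < a \<xi>} u * h \<xi> \<partial>uniform_measure lborel {0..1::real})"
        by (intro Bochner_Integration.integral_cong) auto
      also have "\<dots> = measure (uniform_measure lborel {0..1::real}) {u. u < a \<xi>} * h \<xi>"
        by simp
      also have "measure (uniform_measure lborel {0..1::real}) {u. u < a \<xi>} = a \<xi>"
        using a[OF elim] emeasure_uniform_01[of "a \<xi>"] by (simp add: measure_def)
      finally show ?case .
    qed
  qed measurable
  finally show "(\<integral>w. ?k w \<partial>noise) = (\<integral>\<xi>. a \<xi> * h \<xi> \<partial>ball_law)" .
qed

section \<open>A reversible jump and its mirror coupling\<close>

abbreviation (input) gibbs :: "('a::euclidean_space \<Rightarrow> real) \<Rightarrow> 'a measure" where
  "gibbs V \<equiv> density lborel (\<lambda>x. ennreal (exp (- V x)))"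

text \<open>Multiplied by \<open>exp (- V x)\<close> this is symmetric in \<open>x\<close> and \<open>x + t \<xi>\<close>: detailed balance.\<close>
definition accept :: "('a::euclidean_space \<Rightarrow> real) \<Rightarrow> ('a \<Rightarrow> real) \<Rightarrow> real \<Rightarrow> 'a \<Rightarrow> 'a \<Rightarrow> real" where
  "accept \<psi> V t x \<xi> = \<psi> x * \<psi> (x + t *\<^sub>R \<xi>) * exp ((V x - V (x + t *\<^sub>R \<xi>)) / 2) / 2"

definition move :: "('a::euclidean_space \<Rightarrow> real) \<Rightarrow> ('a \<Rightarrow> real) \<Rightarrow> real \<Rightarrow> 'a \<Rightarrow> 'a \<times> real \<Rightarrow> 'a" where
  "move \<psi> V t x w = (if snd w < accept \<psi> V t x (fst w) then x + t *\<^sub>R fst w else x)"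

text \<open>Close to the diagonal, mirroring would increase the smoothed distance, so the noise is shared there.\<close>
definition coupled_noise :: "real \<Rightarrow> 'a::euclidean_space \<Rightarrow> 'a \<times> real \<Rightarrow> 'a \<times> real" where
  "coupled_noise d z w = (reflect (if norm z \<ge> 2 * d then z else 0) (fst w), snd w)"

definition coupled_move :: "('a::euclidean_space \<Rightarrow> real) \<Rightarrow> ('a \<Rightarrow> real) \<Rightarrow> ('a \<Rightarrow> real) \<Rightarrow> real \<Rightarrow> real
    \<Rightarrow> 'a \<times> 'a \<Rightarrow> 'a \<times> real \<Rightarrow> 'a \<times> 'a" where
  "coupled_move \<psi> V V' t d z w =
    (move \<psi> V t (fst z) w, move \<psi> V' t (snd z) (coupled_noise d (fst z - snd z) w))"

lemma borel_measurable_accept [measurable (raw)]: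
  assumes [measurable]: "\<psi> \<in> borel_measurable borel" "V \<in> borel_measurable borel"
    "f \<in> borel_measurable M" "h \<in> borel_measurable M"
  shows "(\<lambda>x. accept \<psi> V t (f x) (h x)) \<in> borel_measurable M"
  unfolding accept_def by measurable

lemma borel_measurable_move [measurable (raw)]:
  assumes [measurable]: "\<psi> \<in> borel_measurable borel" "V \<in> borel_measurable borel"
    "f \<in> borel_measurable M" "h \<in> measurable M (borel \<Otimes>\<^sub>M borel)"
  shows "(\<lambda>x. move \<psi> V t (f x) (h x)) \<in> borel_measurable M"
  unfolding move_def by measurable

lemma measurable_coupled_noise [measurable (raw)]:
  assumes [measurable]: "f \<in> borel_measurable M" "h \<in> measurable M (borel \<Otimes>\<^sub>M borel)"
  shows "(\<lambda>x. coupled_noise d (f x) (h x)) \<in> measurable M (borel \<Otimes>\<^sub>M borel)"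
  unfolding coupled_noise_def by measurable

lemma measurable_coupled_move [measurable (raw)]:
  fixes f :: "'b \<Rightarrow> 'a::euclidean_space \<times> 'a"
  assumes [measurable]: "\<psi> \<in> borel_measurable borel" "V \<in> borel_measurable borel" "V' \<in> borel_measurable borel"
    "f \<in> measurable M (borel \<Otimes>\<^sub>M borel)" "h \<in> measurable M (borel \<Otimes>\<^sub>M borel)"
  shows "(\<lambda>x. coupled_move \<psi> V V' t d (f x) (h x)) \<in> measurable M (borel \<Otimes>\<^sub>M borel)"
  unfolding coupled_move_def by measurable

lemma nn_integral_noise:
  assumes [measurable]: "k \<in> borel_measurable (borel \<Otimes>\<^sub>M borel)"
  shows "(\<integral>\<^sup>+w. k w \<partial>(noise :: ('a::euclidean_space \<times> real) measure))
    = (\<integral>\<^sup>+\<xi>. (\<integral>\<^sup>+u. k (\<xi>, u) \<partial>uniform_measure lborel {0..1}) \<partial>ball_law)"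
  unfolding noise_def by (rule noise.M2.nn_integral_fst[symmetric]) measurable

text \<open>The mirror vector depends on the current positions but not on the noise, so for fixed
  \<open>z\<close> the mirrored noise has the law of the noise. This is why the second point still
  moves by its own reversible jump.\<close>

lemma nn_integral_coupled_noise:
  assumes [measurable]: "k \<in> borel_measurable (borel \<Otimes>\<^sub>M borel)"
  shows "(\<integral>\<^sup>+w. k (coupled_noise d z w) \<partial>(noise :: ('a::euclidean_space \<times> real) measure)) = (\<integral>\<^sup>+w. k w \<partial>noise)"
  using nn_integral_ball_law_reflect[of "\<lambda>\<xi>. \<integral>\<^sup>+u. k (\<xi>, u) \<partial>uniform_measure lborel {0..1}"
      "if norm z \<ge> 2 * d then z else 0"]
  by (simp add: nn_integral_noise coupled_noise_def)

lemma nn_integral_move_invariant: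
  fixes V :: "'a::euclidean_space \<Rightarrow> real" and k :: "'a \<Rightarrow> ennreal"
  assumes [measurable]: "\<psi> \<in> borel_measurable borel" "V \<in> borel_measurable borel" "k \<in> borel_measurable borel"
    and \<psi>: "\<And>x. 0 \<le> \<psi> x" and acc: "\<And>x \<xi>. norm \<xi> < 1 \<Longrightarrow> accept \<psi> V t x \<xi> \<le> 1"
  defines "P \<equiv> gibbs V"
  shows "(\<integral>\<^sup>+x. (\<integral>\<^sup>+w. k (move \<psi> V t x w) \<partial>noise) \<partial>P) = (\<integral>\<^sup>+x. k x \<partial>P)"
proof -
  define A where "A p = ennreal (accept \<psi> V t (fst p) (snd p))" for p
  \<comment> \<open>Density, with respect to Lebesgue measure times \<open>ball_law\<close>, of an
    accepted jump from the first argument to the second. Its symmetry is detailed balance.\<close>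
  define S where "S p = ennreal (\<psi> (fst p) * \<psi> (snd p) * exp (- (V (fst p) + V (snd p)) / 2) / 2)" for p
  have [measurable]: "A \<in> borel_measurable (borel \<Otimes>\<^sub>M borel)"
    unfolding A_def by measurable
  have [measurable]: "S \<in> borel_measurable (borel \<Otimes>\<^sub>M borel)"
    unfolding S_def by measurable
  have [measurable_cong]: "sets P = sets borel" by (simp add: P_def)
  have acc0: "0 \<le> accept \<psi> V t x \<xi>" for x \<xi> using \<psi> by (simp add: accept_def)
  have S: "ennreal (exp (- V x)) * A (x, \<xi>) = S (x, x + t *\<^sub>R \<xi>)" for x \<xi>
    unfolding S_def A_def accept_def
    by (subst ennreal_mult'[symmetric], simp, rule arg_cong[where f=ennreal])
       (simp add: exp_add[symmetric] field_simps flip: exp_add)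
  have S_comm: "S (x, y) = S (y, x)" for x y by (simp add: S_def ac_simps)
  interpret P: sigma_finite_measure P
    unfolding P_def by (subst sigma_finite_measure.sigma_finite_iff_density_finite[OF sigma_finite_lborel]) auto
  interpret lu: pair_sigma_finite lborel "ball_law :: 'a measure" ..
  have shift: "(\<integral>\<^sup>+x. h (x + y) \<partial>lborel) = (\<integral>\<^sup>+x. h x \<partial>lborel)"
    if [measurable]: "h \<in> borel_measurable borel" for h :: "'a \<Rightarrow> ennreal" and y
    by (subst lborel_distr_plus[of y, symmetric], subst nn_integral_distr) (simp_all add: add.commute)
  have PA: "(\<integral>\<^sup>+x. (\<integral>\<^sup>+\<xi>. A (x, \<xi>) * h (x, x + t *\<^sub>R \<xi>) \<partial>ball_law) \<partial>P)
      = (\<integral>\<^sup>+\<xi>. (\<integral>\<^sup>+x. S (x, x + t *\<^sub>R \<xi>) * h (x, x + t *\<^sub>R \<xi>) \<partial>lborel) \<partial>ball_law)"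
    if [measurable]: "h \<in> borel_measurable (borel \<Otimes>\<^sub>M borel)" for h :: "'a \<times> 'a \<Rightarrow> ennreal"
  proof -
    have "(\<integral>\<^sup>+x. (\<integral>\<^sup>+\<xi>. A (x, \<xi>) * h (x, x + t *\<^sub>R \<xi>) \<partial>ball_law) \<partial>P)
        = (\<integral>\<^sup>+x. ennreal (exp (- V x)) * (\<integral>\<^sup>+\<xi>. A (x, \<xi>) * h (x, x + t *\<^sub>R \<xi>) \<partial>ball_law) \<partial>lborel)"
      unfolding P_def by (rule nn_integral_density) measurable
    also have "\<dots> = (\<integral>\<^sup>+x. (\<integral>\<^sup>+\<xi>. S (x, x + t *\<^sub>R \<xi>) * h (x, x + t *\<^sub>R \<xi>) \<partial>ball_law) \<partial>lborel)"
      by (intro nn_integral_cong) (simp add: nn_integral_cmult[symmetric] S[symmetric] mult.assoc)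
    also have "\<dots> = (\<integral>\<^sup>+\<xi>. (\<integral>\<^sup>+x. S (x, x + t *\<^sub>R \<xi>) * h (x, x + t *\<^sub>R \<xi>) \<partial>lborel) \<partial>ball_law)"
      by (rule lu.Fubini'[symmetric]) measurable
    finally show ?thesis .
  qed
  have "(\<integral>\<^sup>+x. (\<integral>\<^sup>+\<xi>. A (x, \<xi>) * k (x + t *\<^sub>R \<xi>) \<partial>ball_law) \<partial>P)
      = (\<integral>\<^sup>+\<xi>. (\<integral>\<^sup>+x. S (x + t *\<^sub>R \<xi>, x) * k (x + t *\<^sub>R \<xi>) \<partial>lborel) \<partial>ball_law)"
    by (subst PA[of "\<lambda>p. k (snd p)", simplified]) (simp add: S_comm)
  \<comment> \<open>The endpoint becomes the starting point, so the jump turns into the opposite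
    one, from which the ball law does not distinguish it.\<close>
  also have "\<dots> = (\<integral>\<^sup>+\<xi>. (\<integral>\<^sup>+x. S (x, x + t *\<^sub>R (- \<xi>)) * k x \<partial>lborel) \<partial>ball_law)"
  proof (rule nn_integral_cong)
    fix \<xi> :: 'a
    show "(\<integral>\<^sup>+x. S (x + t *\<^sub>R \<xi>, x) * k (x + t *\<^sub>R \<xi>) \<partial>lborel) = (\<integral>\<^sup>+x. S (x, x + t *\<^sub>R (- \<xi>)) * k x \<partial>lborel)"
      using shift[of "\<lambda>x. S (x, x - t *\<^sub>R \<xi>) * k x" "t *\<^sub>R \<xi>"] by simp
  qed
  also have "\<dots> = (\<integral>\<^sup>+\<xi>. (\<integral>\<^sup>+x. S (x, x + t *\<^sub>R \<xi>) * k x \<partial>lborel) \<partial>ball_law)"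
    by (rule nn_integral_ball_law_uminus[of "\<lambda>\<xi>. \<integral>\<^sup>+x. S (x, x + t *\<^sub>R \<xi>) * k x \<partial>lborel"]) measurable
  also have "\<dots> = (\<integral>\<^sup>+x. (\<integral>\<^sup>+\<xi>. A (x, \<xi>) * k x \<partial>ball_law) \<partial>P)"
    by (subst PA[of "\<lambda>p. k (fst p)", simplified]) simp
  finally have balance: "(\<integral>\<^sup>+x. (\<integral>\<^sup>+\<xi>. A (x, \<xi>) * k (x + t *\<^sub>R \<xi>) \<partial>ball_law) \<partial>P)
      = (\<integral>\<^sup>+x. (\<integral>\<^sup>+\<xi>. A (x, \<xi>) * k x \<partial>ball_law) \<partial>P)" .
  \<comment> \<open>Rejection probability: that mass stays at \<open>x\<close>, and together with
    the balanced mass it restores \<open>k x\<close>.\<close>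
  define B where "B p = ennreal (1 - accept \<psi> V t (fst p) (snd p))" for p
  have [measurable]: "B \<in> borel_measurable (borel \<Otimes>\<^sub>M borel)"
    unfolding B_def by measurable
  have AB: "A (x, \<xi>) + B (x, \<xi>) = 1" if "norm \<xi> < 1" for x \<xi>
    using acc[OF that, of x] acc0[of x \<xi>] unfolding A_def B_def
    by (subst ennreal_plus[symmetric]) simp_all
  have "(\<integral>\<^sup>+x. (\<integral>\<^sup>+w. k (move \<psi> V t x w) \<partial>noise) \<partial>P)
      = (\<integral>\<^sup>+x. (\<integral>\<^sup>+\<xi>. A (x, \<xi>) * k (x + t *\<^sub>R \<xi>) + B (x, \<xi>) * k x \<partial>ball_law) \<partial>P)"
  proof (rule nn_integral_cong)
    fix x
    have "(\<integral>\<^sup>+w. k (move \<psi> V t x w) \<partial>noise) = (\<integral>\<^sup>+\<xi>. (\<integral>\<^sup>+u. k (move \<psi> V t x (\<xi>, u)) \<partial>uniform_measure lborel {0..1}) \<partial>ball_law)"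
      by (rule nn_integral_noise) measurable
    also have "\<dots> = (\<integral>\<^sup>+\<xi>. A (x, \<xi>) * k (x + t *\<^sub>R \<xi>) + B (x, \<xi>) * k x \<partial>ball_law)"
    proof (rule nn_integral_cong_AE, use AE_ball_law in eventually_elim)
      fix \<xi> :: 'a assume "norm \<xi> < 1"
      then show "(\<integral>\<^sup>+u. k (move \<psi> V t x (\<xi>, u)) \<partial>uniform_measure lborel {0..1}) = A (x, \<xi>) * k (x + t *\<^sub>R \<xi>) + B (x, \<xi>) * k x"
        unfolding A_def B_def
        by (subst nn_integral_uniform_01_if[OF acc0 acc, symmetric])
           (auto simp: move_def intro!: nn_integral_cong)
    qed
    finally show "(\<integral>\<^sup>+w. k (move \<psi> V t x w) \<partial>noise) = (\<integral>\<^sup>+\<xi>. A (x, \<xi>) * k (x + t *\<^sub>R \<xi>) + B (x, \<xi>) * k x \<partial>ball_law)" .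
  qed
  also have "\<dots> = (\<integral>\<^sup>+x. (\<integral>\<^sup>+\<xi>. A (x, \<xi>) * k x + B (x, \<xi>) * k x \<partial>ball_law) \<partial>P)"
    by (simp add: nn_integral_add balance)
  also have "\<dots> = (\<integral>\<^sup>+x. (\<integral>\<^sup>+\<xi>. k x \<partial>(ball_law :: 'a measure)) \<partial>P)"
  proof (rule nn_integral_cong)
    fix x
    have "AE \<xi> in ball_law. A (x, \<xi>) * k x + B (x, \<xi>) * k x = k x"
      using AE_ball_law by eventually_elim (simp add: AB distrib_right[symmetric])
    then show "(\<integral>\<^sup>+\<xi>. A (x, \<xi>) * k x + B (x, \<xi>) * k x \<partial>ball_law) = (\<integral>\<^sup>+\<xi>. k x \<partial>(ball_law :: 'a measure))"
      by (rule nn_integral_cong_AE)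
  qed
  also have "\<dots> = (\<integral>\<^sup>+x. k x \<partial>P)"
    using ubm.emeasure_space_1[where 'a='a] by simp
  finally show ?thesis .
qed

lemma coupling_sets [measurable_cong]: "coupling M N \<pi> \<Longrightarrow> sets \<pi> = sets (borel \<Otimes>\<^sub>M borel)"
  by (simp add: coupling_def)

lemma coupling_nn_integral:
  assumes "coupling M N \<pi>" and [measurable]: "k \<in> borel_measurable borel"
  shows coupling_nn_integral_fst: "(\<integral>\<^sup>+z. k (fst z) \<partial>\<pi>) = (\<integral>\<^sup>+x. k x \<partial>M)"
    and coupling_nn_integral_snd: "(\<integral>\<^sup>+z. k (snd z) \<partial>\<pi>) = (\<integral>\<^sup>+x. k x \<partial>N)"
proof -
  from assms(1) have [measurable_cong]: "sets \<pi> = sets (borel \<Otimes>\<^sub>M borel)"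
    and M: "distr \<pi> borel fst = M" and N: "distr \<pi> borel snd = N"
    by (auto simp: coupling_def)
  have [measurable]: "fst \<in> borel_measurable \<pi>" "snd \<in> borel_measurable \<pi>"
    using assms(1) by (simp_all add: coupling_def cong: measurable_cong_sets)
  show "(\<integral>\<^sup>+z. k (fst z) \<partial>\<pi>) = (\<integral>\<^sup>+x. k x \<partial>M)"
    unfolding M[symmetric] by (rule nn_integral_distr[symmetric]) simp_all
  show "(\<integral>\<^sup>+z. k (snd z) \<partial>\<pi>) = (\<integral>\<^sup>+x. k x \<partial>N)"
    unfolding N[symmetric] by (rule nn_integral_distr[symmetric]) simp_all
qed

lemma couplingI:
  assumes "sets \<pi> = sets (borel \<Otimes>\<^sub>M borel)" "sets M = sets borel" "sets N = sets borel"
    and "\<And>A. A \<in> sets borel \<Longrightarrow> (\<integral>\<^sup>+z. indicator A (fst z) \<partial>\<pi>) = (\<integral>\<^sup>+x. indicator A x \<partial>M)"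
    and "\<And>A. A \<in> sets borel \<Longrightarrow> (\<integral>\<^sup>+z. indicator A (snd z) \<partial>\<pi>) = (\<integral>\<^sup>+x. indicator A x \<partial>N)"
  shows "coupling M N \<pi>"
  unfolding coupling_def
proof (intro conjI measure_eqI)
  have [measurable]: "fst \<in> borel_measurable \<pi>" "snd \<in> borel_measurable \<pi>"
    using assms(1) by (simp_all cong: measurable_cong_sets)
  fix A
  { assume "A \<in> sets (distr \<pi> borel fst)"
    then have [measurable]: "A \<in> sets borel" by simp
    have "emeasure (distr \<pi> borel fst) A = (\<integral>\<^sup>+z. indicator A (fst z) \<partial>\<pi>)"
      by (subst nn_integral_indicator[symmetric], simp, subst nn_integral_distr) (simp_all del: nn_integral_indicator)
    then show "emeasure (distr \<pi> borel fst) A = emeasure M A"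
      by (simp add: assms) }
  { assume "A \<in> sets (distr \<pi> borel snd)"
    then have [measurable]: "A \<in> sets borel" by simp
    have "emeasure (distr \<pi> borel snd) A = (\<integral>\<^sup>+z. indicator A (snd z) \<partial>\<pi>)"
      by (subst nn_integral_indicator[symmetric], simp, subst nn_integral_distr) (simp_all del: nn_integral_indicator)
    then show "emeasure (distr \<pi> borel snd) A = emeasure N A"
      by (simp add: assms) }
qed (use assms in simp_all)

lemma
  fixes V V' :: "'a::euclidean_space \<Rightarrow> real" and d :: real
  assumes [measurable]: "\<psi> \<in> borel_measurable borel" "V \<in> borel_measurable borel" "V' \<in> borel_measurable borel"
    and \<psi>: "\<And>x. 0 \<le> \<psi> x"
    and acc: "\<And>x \<xi>. norm \<xi> < 1 \<Longrightarrow> accept \<psi> V t x \<xi> \<le> 1"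
    and acc': "\<And>x \<xi>. norm \<xi> < 1 \<Longrightarrow> accept \<psi> V' t x \<xi> \<le> 1"
    and \<pi>: "coupling (gibbs V) (gibbs V') \<pi>"
  defines "\<pi>' \<equiv> distr (\<pi> \<Otimes>\<^sub>M noise) (borel \<Otimes>\<^sub>M borel) (\<lambda>p. coupled_move \<psi> V V' t d (fst p) (snd p))"
  shows coupling_coupled_move:
      "coupling (gibbs V) (gibbs V') \<pi>'"
    and nn_integral_coupled_move: "k \<in> borel_measurable (borel \<Otimes>\<^sub>M borel) \<Longrightarrow>
      (\<integral>\<^sup>+z. k z \<partial>\<pi>') = (\<integral>\<^sup>+z. (\<integral>\<^sup>+w. k (coupled_move \<psi> V V' t d z w) \<partial>noise) \<partial>\<pi>)"
proof -
  interpret N: prob_space "noise :: ('a \<times> real) measure" by (rule prob_space_noise)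
  have [measurable_cong]: "sets \<pi> = sets (borel \<Otimes>\<^sub>M borel)" using \<pi> by (simp add: coupling_def)
  have cong: "sets (\<pi> \<Otimes>\<^sub>M noise) = sets ((borel \<Otimes>\<^sub>M borel) \<Otimes>\<^sub>M ((borel :: 'a measure) \<Otimes>\<^sub>M (borel :: real measure)))"
    using \<pi> by (intro sets_pair_measure_cong) (simp_all add: coupling_def)
  have [measurable]: "(\<lambda>p. coupled_move \<psi> V V' t d (fst p) (snd p)) \<in> (\<pi> \<Otimes>\<^sub>M noise) \<rightarrow>\<^sub>M (borel \<Otimes>\<^sub>M borel)"
    by (subst measurable_cong_sets[OF cong refl]) measurable
  have int: "(\<integral>\<^sup>+z. k z \<partial>\<pi>') = (\<integral>\<^sup>+z. (\<integral>\<^sup>+w. k (coupled_move \<psi> V V' t d z w) \<partial>noise) \<partial>\<pi>)"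
    if [measurable]: "k \<in> borel_measurable (borel \<Otimes>\<^sub>M borel)" for k
  proof -
    have "(\<integral>\<^sup>+z. k z \<partial>\<pi>') = (\<integral>\<^sup>+p. k (coupled_move \<psi> V V' t d (fst p) (snd p)) \<partial>(\<pi> \<Otimes>\<^sub>M noise))"
      unfolding \<pi>'_def by (rule nn_integral_distr) simp_all
    also have "\<dots> = (\<integral>\<^sup>+z. (\<integral>\<^sup>+w. k (coupled_move \<psi> V V' t d z w) \<partial>noise) \<partial>\<pi>)"
      by (subst N.nn_integral_fst[symmetric]) simp_all
    finally show ?thesis .
  qed
  then show "k \<in> borel_measurable (borel \<Otimes>\<^sub>M borel) \<Longrightarrow>
      (\<integral>\<^sup>+z. k z \<partial>\<pi>') = (\<integral>\<^sup>+z. (\<integral>\<^sup>+w. k (coupled_move \<psi> V V' t d z w) \<partial>noise) \<partial>\<pi>)" .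
  show "coupling (gibbs V) (gibbs V') \<pi>'"
  proof (rule couplingI)
    fix A :: "'a set" assume [measurable]: "A \<in> sets borel"
    have "(\<integral>\<^sup>+z. indicator A (fst z) \<partial>\<pi>') = (\<integral>\<^sup>+z. (\<integral>\<^sup>+w. indicator A (move \<psi> V t (fst z) w) \<partial>noise) \<partial>\<pi>)"
      by (subst int) (simp_all add: coupled_move_def)
    also have "\<dots> = (\<integral>\<^sup>+x. (\<integral>\<^sup>+w. indicator A (move \<psi> V t x w) \<partial>noise) \<partial>gibbs V)"
      by (rule coupling_nn_integral_fst[OF \<pi>]) measurable
    also have "\<dots> = (\<integral>\<^sup>+x. indicator A x \<partial>gibbs V)"
      by (rule nn_integral_move_invariant[OF _ _ _ \<psi> acc]) measurable
    finally show "(\<integral>\<^sup>+z. indicator A (fst z) \<partial>\<pi>') = (\<integral>\<^sup>+x. indicator A x \<partial>gibbs V)" .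
    have "(\<integral>\<^sup>+z. indicator A (snd z) \<partial>\<pi>')
        = (\<integral>\<^sup>+z. (\<integral>\<^sup>+w. indicator A (move \<psi> V' t (snd z) (coupled_noise d (fst z - snd z) w)) \<partial>noise) \<partial>\<pi>)"
      by (subst int) (simp_all add: coupled_move_def)
    also have "\<dots> = (\<integral>\<^sup>+z. (\<integral>\<^sup>+w. indicator A (move \<psi> V' t (snd z) w) \<partial>noise) \<partial>\<pi>)"
    proof (rule nn_integral_cong)
      fix z :: "'a \<times> 'a"
      show "(\<integral>\<^sup>+w. indicator A (move \<psi> V' t (snd z) (coupled_noise d (fst z - snd z) w)) \<partial>noise)
        = (\<integral>\<^sup>+w. indicator A (move \<psi> V' t (snd z) w) \<partial>noise)"
        by (rule nn_integral_coupled_noise[of "\<lambda>w. indicator A (move \<psi> V' t (snd z) w)"]) measurable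
    qed
    also have "\<dots> = (\<integral>\<^sup>+x. (\<integral>\<^sup>+w. indicator A (move \<psi> V' t x w) \<partial>noise) \<partial>gibbs V')"
      by (rule coupling_nn_integral_snd[OF \<pi>]) measurable
    also have "\<dots> = (\<integral>\<^sup>+x. indicator A x \<partial>gibbs V')"
      by (rule nn_integral_move_invariant[OF _ _ _ \<psi> acc']) measurable
    finally show "(\<integral>\<^sup>+z. indicator A (snd z) \<partial>\<pi>') = (\<integral>\<^sup>+x. indicator A x \<partial>gibbs V')" .
  qed (simp_all add: \<pi>'_def)
qed

section \<open>Expansion of the acceptance probability\<close>

lemma C1_grad_continuous: "C1_grad V G \<Longrightarrow> continuous_on S V"
  unfolding C1_grad_def
  by (meson continuous_at_imp_continuous_on has_derivative_continuous)

lemma C1_grad_borel: "C1_grad V G \<Longrightarrow> V \<in> borel_measurable borel"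
  by (intro borel_measurable_continuous_onI C1_grad_continuous)

lemma C1_grad_borel_grad: "C1_grad V G \<Longrightarrow> G \<in> borel_measurable borel"
  by (intro borel_measurable_continuous_onI) (simp add: C1_grad_def)

text \<open>The coefficient of \<open>t\<close> in \<open>accept \<psi> V t x \<xi> = (\<psi> x)\<^sup>2 / 2 + t (\<xi> \<bullet> half_drift \<psi> D\<psi> G x) + o(t)\<close>.\<close>
definition half_drift :: "('a::euclidean_space \<Rightarrow> real) \<Rightarrow> ('a \<Rightarrow> 'a) \<Rightarrow> ('a \<Rightarrow> 'a) \<Rightarrow> 'a \<Rightarrow> 'a" where
  "half_drift \<psi> D\<psi> G x = (\<psi> x / 2) *\<^sub>R D\<psi> x - ((\<psi> x)\<^sup>2 / 4) *\<^sub>R G x"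

lemma C1_grad_mvt:
  assumes "C1_grad \<phi> D"
  obtains s where "0 < s" "s < 1" "\<phi> (x + v) - \<phi> x = D (x + s *\<^sub>R v) \<bullet> v"
proof -
  have der: "((\<lambda>s. \<phi> (x + s *\<^sub>R v)) has_derivative (\<lambda>h. D (x + s *\<^sub>R v) \<bullet> (h *\<^sub>R v))) (at s)" for s
  proof (rule has_derivative_compose[of "\<lambda>s. x + s *\<^sub>R v" "\<lambda>h. h *\<^sub>R v" s UNIV \<phi> "\<lambda>h. D (x + s *\<^sub>R v) \<bullet> h"])
    show "((\<lambda>s. x + s *\<^sub>R v) has_derivative (\<lambda>h. h *\<^sub>R v)) (at s)"
      by (intro has_derivative_eq_rhs[OF has_derivative_add[OF has_derivative_const has_derivative_scaleR_left[OF has_derivative_ident]]]) simp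
    show "(\<phi> has_derivative (\<lambda>h. D (x + s *\<^sub>R v) \<bullet> h)) (at (x + s *\<^sub>R v))"
      using assms by (simp add: C1_grad_def)
  qed
  have "\<exists>s\<in>{0<..<1}. \<phi> (x + 1 *\<^sub>R v) - \<phi> (x + 0 *\<^sub>R v) = D (x + s *\<^sub>R v) \<bullet> ((1 - 0) *\<^sub>R v)"
  proof (rule mvt[of 0 1 "\<lambda>s. \<phi> (x + s *\<^sub>R v)" "\<lambda>s h. D (x + s *\<^sub>R v) \<bullet> (h *\<^sub>R v)"])
    show "continuous_on {0..1} (\<lambda>s. \<phi> (x + s *\<^sub>R v))"
      by (rule continuous_at_imp_continuous_on) (blast intro: has_derivative_continuous[OF der])
  qed (use der in simp_all, use greaterThanLessThan_iff in blast)
  then show thesis using that by auto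
qed

text \<open>The endpoint of a jump enters \<open>accept\<close> only through this function, the
  cutoff times the square root of the density; its gradient therefore gives the first-order
  term.\<close>

lemma C1_grad_weighted:
  assumes \<psi>: "C1_grad \<psi> D\<psi>" and V: "C1_grad V G"
  shows "C1_grad (\<lambda>x. \<psi> x * exp (- V x / 2)) (\<lambda>x. exp (- V x / 2) *\<^sub>R (D\<psi> x - (\<psi> x / 2) *\<^sub>R G x))"
  unfolding C1_grad_def
proof (intro conjI allI)
  fix x
  have \<psi>': "(\<psi> has_derivative (\<lambda>h. D\<psi> x \<bullet> h)) (at x)" and V': "(V has_derivative (\<lambda>h. G x \<bullet> h)) (at x)"
    using assms by (auto simp: C1_grad_def)
  have "((\<lambda>x. - V x / 2) has_derivative (\<lambda>h. - (G x \<bullet> h) / 2)) (at x)"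
    using has_derivative_mult_right[OF V', of "- 1 / 2"] by simp
  from has_derivative_mult[OF \<psi>' has_derivative_exp[OF this]]
  show "((\<lambda>x. \<psi> x * exp (- V x / 2)) has_derivative
      (\<bullet>) (exp (- V x / 2) *\<^sub>R (D\<psi> x - (\<psi> x / 2) *\<^sub>R G x))) (at x)"
    by (rule has_derivative_eq_rhs) (simp add: fun_eq_iff inner_diff_left algebra_simps)
next
  show "continuous_on UNIV (\<lambda>x. exp (- V x / 2) *\<^sub>R (D\<psi> x - (\<psi> x / 2) *\<^sub>R G x))"
    using assms C1_grad_continuous[OF \<psi>] C1_grad_continuous[OF V]
    by (auto intro!: continuous_intros simp: C1_grad_def)
qed

text \<open>Uniform in \<open>x\<close> because the cutoff confines the starting point to a compact
  ball, near which the gradient of the weighted function is uniformly continuous. For a potential of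
  class C1 the remainder is o(t) and no better.\<close>

lemma accept_expansion:
  fixes V :: "'a::euclidean_space \<Rightarrow> real"
  assumes \<psi>: "C1_grad \<psi> D\<psi>" and V: "C1_grad V G"
    and supp: "\<And>x. norm x \<ge> K \<Longrightarrow> \<psi> x = 0" and "\<epsilon> > 0"
  obtains t0 where "t0 > 0" "\<And>t x \<xi>. 0 < t \<Longrightarrow> t < t0 \<Longrightarrow> norm \<xi> < 1 \<Longrightarrow>
    \<bar>accept \<psi> V t x \<xi> - (\<psi> x)\<^sup>2 / 2 - t * (\<xi> \<bullet> half_drift \<psi> D\<psi> G x)\<bar> \<le> \<epsilon> * t"
proof -
  define \<phi> where "\<phi> x = \<psi> x * exp (- V x / 2)" for x
  define D where "D x = exp (- V x / 2) *\<^sub>R (D\<psi> x - (\<psi> x / 2) *\<^sub>R G x)" for x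
  \<comment> \<open>The factor of \<open>accept\<close> that depends on the starting point
    only.\<close>
  define m where "m x = \<psi> x * exp (V x / 2) / 2" for x
  have \<phi>: "C1_grad \<phi> D" unfolding \<phi>_def[abs_def] D_def[abs_def] by (rule C1_grad_weighted[OF \<psi> V])
  have "continuous_on (cball 0 K) m"
    unfolding m_def by (intro continuous_intros C1_grad_continuous[OF \<psi>] C1_grad_continuous[OF V]) auto
  then have "bounded (m ` cball 0 K)"
    by (intro compact_imp_bounded compact_continuous_image) auto
  then obtain M where M: "M > 0" "\<And>x. norm x \<le> K \<Longrightarrow> \<bar>m x\<bar> \<le> M"
    by (auto simp: bounded_pos)
  \<comment> \<open>The radius exceeds \<open>K\<close> by 1 since a jump of length below 1 may
    leave the ball of radius \<open>K\<close>.\<close>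
  have "uniformly_continuous_on (cball 0 (K + 1)) D"
    using \<phi> by (intro compact_uniformly_continuous) (auto simp: C1_grad_def intro: continuous_on_subset)
  moreover have "\<epsilon> / M > 0" using \<open>\<epsilon> > 0\<close> M by simp
  ultimately obtain \<delta> where \<delta>: "\<delta> > 0"
    "\<And>x x'. x \<in> cball 0 (K + 1) \<Longrightarrow> x' \<in> cball 0 (K + 1) \<Longrightarrow> dist x' x < \<delta> \<Longrightarrow> dist (D x') (D x) < \<epsilon> / M"
    unfolding uniformly_continuous_on_def by metis
  show thesis
  proof (rule that[of "min 1 \<delta>"])
    show "min 1 \<delta> > 0" using \<delta> by simp
    fix t :: real and x \<xi> :: 'a
    assume t: "0 < t" "t < min 1 \<delta>" and \<xi>: "norm \<xi> < 1"
    show "\<bar>accept \<psi> V t x \<xi> - (\<psi> x)\<^sup>2 / 2 - t * (\<xi> \<bullet> half_drift \<psi> D\<psi> G x)\<bar> \<le> \<epsilon> * t"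
    proof (cases "norm x \<le> K")
      case False
      then have "\<psi> x = 0" using supp by simp
      then show ?thesis using t \<open>\<epsilon> > 0\<close> by (simp add: accept_def half_drift_def)
    next
      case True
      define v where "v = t *\<^sub>R \<xi>"
      have nv: "norm v \<le> t" using t \<xi> by (simp add: v_def mult_left_le)
      obtain s where s: "0 < s" "s < 1" "\<phi> (x + v) - \<phi> x = D (x + s *\<^sub>R v) \<bullet> v"
        by (rule C1_grad_mvt[OF \<phi>])
      have nsv: "norm (s *\<^sub>R v) \<le> t"
        using s nv by (simp add: mult_le_one) (smt (verit) mult_left_le_one_le norm_ge_zero)
      have "dist (D (x + s *\<^sub>R v)) (D x) < \<epsilon> / M"
      proof (rule \<delta>)
        show "x + s *\<^sub>R v \<in> cball 0 (K + 1)"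
          using True nsv t norm_triangle_ineq[of x "s *\<^sub>R v"] by simp
        show "dist (x + s *\<^sub>R v) x < \<delta>" using nsv t by (simp add: dist_norm)
      qed (use True in simp)
      then have "\<bar>(D (x + s *\<^sub>R v) - D x) \<bullet> v\<bar> \<le> \<epsilon> / M * t"
        using Cauchy_Schwarz_ineq2[of "D (x + s *\<^sub>R v) - D x" v] nv
        by (smt (verit, best) dist_norm mult_mono norm_ge_zero)
      then have "\<bar>m x\<bar> * \<bar>\<phi> (x + v) - \<phi> x - D x \<bullet> v\<bar> \<le> M * (\<epsilon> / M * t)"
        using M True unfolding s(3) by (intro mult_mono) (auto simp: inner_diff_left)
      moreover have "accept \<psi> V t x \<xi> = m x * \<phi> (x + v)"
      proof -
        have "exp ((V x - V (x + v)) / 2) = exp (V x / 2) * exp (- V (x + v) / 2)"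
          by (simp add: exp_add[symmetric] diff_divide_distrib)
        then show ?thesis by (simp only: accept_def m_def \<phi>_def v_def[symmetric]) simp
      qed
      moreover have "(\<psi> x)\<^sup>2 / 2 = m x * \<phi> x"
      proof -
        have "m x * \<phi> x = (exp (V x / 2) * exp (- V x / 2)) * ((\<psi> x)\<^sup>2 / 2)"
          unfolding m_def \<phi>_def power2_eq_square by (simp only: mult_ac times_divide_eq_right times_divide_eq_left)
        then show ?thesis by (simp add: exp_add[symmetric])
      qed
      moreover have "t * (\<xi> \<bullet> half_drift \<psi> D\<psi> G x) = m x * (D x \<bullet> v)"
      proof -
        have "m x * (D x \<bullet> v) = (exp (V x / 2) * exp (- V x / 2)) * (\<psi> x / 2 * (D\<psi> x \<bullet> v) - (\<psi> x)\<^sup>2 / 4 * (G x \<bullet> v))"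
          unfolding m_def D_def power2_eq_square by (simp add: inner_diff_left) argo
        also have "exp (V x / 2) * exp (- V x / 2) = 1" by (simp add: exp_add[symmetric])
        finally show ?thesis
          by (simp add: half_drift_def v_def inner_diff_right inner_commute) argo
      qed
      ultimately show ?thesis
        using M by (simp add: abs_mult[symmetric] right_diff_distrib)
    qed
  qed
qed

lemma half_drift_bounded:
  assumes \<psi>: "C1_grad \<psi> D\<psi>" and V: "C1_grad V G"
    and supp: "\<And>x. norm x \<ge> K \<Longrightarrow> \<psi> x = 0"
  obtains C where "C > 0" "\<And>x. norm (half_drift \<psi> D\<psi> G x) \<le> C"
proof -
  have "continuous_on (cball 0 K) (half_drift \<psi> D\<psi> G)"
    unfolding half_drift_def[abs_def] using \<psi> V
    by (intro continuous_intros C1_grad_continuous[OF \<psi>])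
       (auto simp: C1_grad_def intro: continuous_on_subset)
  then have "bounded (half_drift \<psi> D\<psi> G ` cball 0 K)"
    by (intro compact_imp_bounded compact_continuous_image) auto
  then obtain C where C: "C > 0" "\<And>x. norm x \<le> K \<Longrightarrow> norm (half_drift \<psi> D\<psi> G x) \<le> C"
    by (auto simp: bounded_pos)
  show thesis
  proof (rule that[OF C(1)])
    fix x show "norm (half_drift \<psi> D\<psi> G x) \<le> C"
      using C supp[of x] by (cases "norm x \<le> K") (auto simp: half_drift_def)
  qed
qed

section \<open>The effect of one jump on a concave function of the distance\<close>

text \<open>The norm is smoothed near 0, where its second-order increments are not of the order of the squared
  jump; at distance at least \<open>d\<close> it is unchanged.\<close>
definition huber :: "real \<Rightarrow> 'a::real_normed_vector \<Rightarrow> real" where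
  "huber d z = (if norm z \<ge> d then norm z else ((norm z)\<^sup>2 + d\<^sup>2) / (2 * d))"

lemma huber_eq: "d > 0 \<Longrightarrow> huber d z = ((norm z)\<^sup>2 + (max d (norm z))\<^sup>2) / (2 * max d (norm z))"
  by (auto simp: huber_def max_def power2_eq_square field_simps)

text \<open>\<open>huber\<close> is the lower envelope of these parabolas over
  \<open>c \<ge> d\<close>, attained at \<open>c = max d (norm z)\<close>. The gap is a multiple of
  a square if the norm is at least \<open>d\<close>, and of
  \<open>(c - d) * (c * d - (norm z)\<^sup>2)\<close> otherwise.\<close>

lemma huber_le:
  assumes "d > 0" "c \<ge> d"
  shows "huber d z \<le> ((norm z)\<^sup>2 + c\<^sup>2) / (2 * c)"
proof (cases "norm z \<ge> d")
  case True
  have "0 \<le> (norm z - c)\<^sup>2" by simp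
  then show ?thesis using True assms by (simp add: huber_def field_simps power2_eq_square)
next
  case False
  have "0 \<le> (c - d) * (c * d - (norm z)\<^sup>2)"
  proof (rule mult_nonneg_nonneg)
    have "(norm z)\<^sup>2 \<le> d * d" using False using assms by (auto simp: power2_eq_square intro!: mult_mono)
    also have "\<dots> \<le> c * d" using assms by (intro mult_right_mono) auto
    finally show "0 \<le> c * d - (norm z)\<^sup>2" by simp
  qed (use assms in simp)
  then show ?thesis using False assms by (simp add: huber_def field_simps power2_eq_square)
qed

text \<open>Freezing the parabola that is optimal at \<open>z\<close> bounds the increment by a
  quadratic polynomial, without second derivatives of the norm.\<close>

lemma huber_add_le:
  fixes z \<Delta> :: "'a::real_inner"
  assumes "d > 0"
  shows "huber d (z + \<Delta>) \<le> huber d z + (2 * (z \<bullet> \<Delta>) + (norm \<Delta>)\<^sup>2) / (2 * max d (norm z))"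
proof -
  have "huber d (z + \<Delta>) \<le> ((norm (z + \<Delta>))\<^sup>2 + (max d (norm z))\<^sup>2) / (2 * max d (norm z))"
    by (rule huber_le) (use assms in auto)
  also have "(norm (z + \<Delta>))\<^sup>2 = (norm z)\<^sup>2 + (2 * (z \<bullet> \<Delta>) + (norm \<Delta>)\<^sup>2)"
    by (simp add: power2_norm_eq_inner inner_add_left inner_add_right inner_commute)
  finally show ?thesis
    using assms by (simp add: huber_eq add_divide_distrib)
qed

lemma huber_ge_norm: "d > 0 \<Longrightarrow> norm z \<le> huber d z"
  using sum_squares_bound[of "norm z" d] by (auto simp: huber_def field_simps power2_eq_square)

lemma huber_pos: "d > 0 \<Longrightarrow> 0 < huber d z"
  unfolding huber_def by (cases "norm z \<ge> d") (simp_all add: add_nonneg_pos del: zero_less_norm_iff)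

lemma huber_le_max:
  assumes "d > 0"
  shows "huber d z \<le> max d (norm z)"
proof (cases "norm z \<ge> d")
  case False
  then have "(norm z)\<^sup>2 \<le> d\<^sup>2" by (intro power_mono) auto
  then show ?thesis using False assms by (simp add: huber_def power2_eq_square field_simps)
qed (simp add: huber_def)

lemma borel_measurable_huber [measurable (raw)]:
  fixes f :: "'b \<Rightarrow> 'a::euclidean_space"
  assumes [measurable]: "f \<in> borel_measurable M"
  shows "(\<lambda>x. huber d (f x)) \<in> borel_measurable M"
  unfolding huber_def by measurable

text \<open>The difference of two mirrored jumps is parallel to \<open>z\<close>, so the distance
  changes by an exactly linear amount. The margin between \<open>2 * d\<close> and \<open>d\<close>,
  together with \<open>2 * t \<le> d\<close>, keeps it in the range where \<open>huber\<close> is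
  the norm.\<close>

lemma huber_mirror:
  fixes z \<xi> :: "'a::euclidean_space"
  assumes "d > 0" "norm z \<ge> 2 * d" "0 < t" "2 * t \<le> d" "norm \<xi> < 1"
  shows "huber d (z + t *\<^sub>R (\<xi> - reflect z \<xi>)) = norm z + 2 * t * (\<xi> \<bullet> z) / norm z"
proof -
  define r where "r = norm z"
  have r: "r > 0" "r \<ge> 2 * d" using assms by (auto simp: r_def)
  have zz: "z \<bullet> z = r * r" by (simp add: r_def power2_norm_eq_inner[symmetric] power2_eq_square)
  define s where "s = 2 * t * (\<xi> \<bullet> z) / r"
  have "\<bar>\<xi> \<bullet> z\<bar> \<le> r" unfolding r_def by (rule abs_inner_le) fact
  then have "\<bar>s\<bar> \<le> 2 * t"
    using assms(3) r by (simp add: s_def abs_mult field_simps)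
  then have s: "r + s \<ge> d" using assms r by linarith
  have "z + t *\<^sub>R (\<xi> - reflect z \<xi>) = (1 + s / r) *\<^sub>R z"
    using r by (simp add: reflect_def zz s_def scaleR_add_left inner_commute)
  then have "norm (z + t *\<^sub>R (\<xi> - reflect z \<xi>)) = \<bar>1 + s / r\<bar> * r" by (simp add: r_def)
  also have "\<dots> = \<bar>r + s\<bar>" using r by (simp add: abs_mult_pos' [symmetric] field_simps)
  finally have "norm (z + t *\<^sub>R (\<xi> - reflect z \<xi>)) = r + s" using s assms by simp
  then show ?thesis using s by (simp add: huber_def r_def s_def)
qed

text \<open>A function with these properties plays the part of the concave profile of the metric;
  \<open>k\<close> stands for its second derivative wherever that is usable, and for 0 elsewhere.\<close>
locale profile =
  fixes f f1 k :: "real \<Rightarrow> real" and L K d \<omega> s0 :: real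
  assumes d: "d > 0" and \<omega>: "\<omega> > 0"
    and tangent: "\<And>\<rho> \<rho>'. 0 < \<rho> \<Longrightarrow> 0 < \<rho>' \<Longrightarrow> f \<rho>' \<le> f \<rho> + f1 \<rho> * (\<rho>' - \<rho>)"
    and f1: "\<And>\<rho>. 0 < \<rho> \<Longrightarrow> 0 \<le> f1 \<rho>" "\<And>\<rho>. 0 < \<rho> \<Longrightarrow> f1 \<rho> \<le> L"
    and k: "\<And>r. 2 * d \<le> r \<Longrightarrow> - K \<le> k r" "\<And>r. 2 * d \<le> r \<Longrightarrow> k r \<le> 0"
    and f_nonneg: "\<And>\<rho>. 0 < \<rho> \<Longrightarrow> 0 \<le> f \<rho>"
    and second_order: "\<And>r s. 2 * d \<le> r \<Longrightarrow> \<bar>s\<bar> \<le> s0 \<Longrightarrow> f (r + s) \<le> f r + f1 r * s + k r * s\<^sup>2 / 2 + \<omega> * s\<^sup>2"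
begin

lemma L_nonneg: "0 \<le> L"
  using f1[of 1] by simp

lemma K_nonneg: "0 \<le> K"
  using k[of "2 * d"] by simp

lemma f_huber_jump:
  fixes z \<Delta> :: "'a::euclidean_space"
  assumes "norm \<Delta> \<le> t"
  shows "f (huber d (z + \<Delta>)) \<le> f (huber d z) + f1 (huber d z) / max d (norm z) * (z \<bullet> \<Delta>) + L * t\<^sup>2 / (2 * d)"
proof -
  define c where "c = max d (norm z)"
  have c: "c \<ge> d" "c > 0" using d by (auto simp: c_def)
  have h: "huber d z > 0" by (rule huber_pos[OF d])
  have "f (huber d (z + \<Delta>)) \<le> f (huber d z) + f1 (huber d z) * (huber d (z + \<Delta>) - huber d z)"
    by (rule tangent) (simp_all add: huber_pos[OF d])
  also have "f1 (huber d z) * (huber d (z + \<Delta>) - huber d z) \<le> f1 (huber d z) * ((2 * (z \<bullet> \<Delta>) + (norm \<Delta>)\<^sup>2) / (2 * c))"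
    using huber_add_le[OF d, of z \<Delta>] by (intro mult_left_mono f1 h) (simp add: c_def)
  also have "\<dots> = f1 (huber d z) / c * (z \<bullet> \<Delta>) + f1 (huber d z) * ((norm \<Delta>)\<^sup>2 / (2 * c))"
    using c by (simp add: field_simps)
  also have "f1 (huber d z) * ((norm \<Delta>)\<^sup>2 / (2 * c)) \<le> L * (t\<^sup>2 / (2 * d))"
    using c d assms L_nonneg by (intro mult_mono f1 h frac_le power_mono) auto
  finally show ?thesis by (simp add: c_def)
qed

text \<open>The linear term has one form in all cases and splits into the contributions of the two
  acceptance events. Averaging it then involves each acceptance probability on its own, whatever
  their joint law. Only the second-order term \<open>q\<close> depends on both jumps together, and
  the last term on exactly one of them.\<close>

lemma f_huber_step:
  fixes z \<xi> :: "'a::euclidean_space"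
  assumes "0 < t" "2 * t \<le> d" "2 * t \<le> s0" "norm \<xi> < 1"
  defines "\<xi>' \<equiv> reflect (if norm z \<ge> 2 * d then z else 0) \<xi>"
    and "q \<equiv> (if norm z \<ge> 2 * d then (k (norm z) / 2 + \<omega>) * (4 * t\<^sup>2 * (\<xi> \<bullet> z)\<^sup>2 / (norm z)\<^sup>2) else 0)"
  shows "f (huber d (z + ((if a then t *\<^sub>R \<xi> else 0) - (if b then t *\<^sub>R \<xi>' else 0))))
    \<le> f (huber d z)
      + f1 (huber d z) / max d (norm z) * (t * ((if a then \<xi> \<bullet> z else 0) - (if b then \<xi>' \<bullet> z else 0)))
      + (if a \<and> b then q else 0) + (if a = b then 0 else L * t\<^sup>2 / (2 * d))"
proof -
  have n': "norm \<xi>' < 1" using assms by (simp add: \<xi>'_def)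
  have jump: "a \<noteq> b \<Longrightarrow> ?thesis"
    using f_huber_jump[of "t *\<^sub>R \<xi>" t z] f_huber_jump[of "- t *\<^sub>R \<xi>'" t z] assms(1,4) n'
    by (cases a) (simp_all add: mult_left_le inner_commute mult.assoc)
  consider "a \<noteq> b" | "\<not> a" "\<not> b" | "a" "b" "norm z < 2 * d" | "a" "b" "norm z \<ge> 2 * d" by linarith
  then show ?thesis
  proof cases
    case 4
    define r where "r = norm z"
    have r: "r > 0" "2 * d \<le> r" "d \<le> r" using 4 d by (auto simp: r_def)
    define s where "s = 2 * t * (\<xi> \<bullet> z) / r"
    have "\<bar>\<xi> \<bullet> z\<bar> \<le> r" unfolding r_def by (rule abs_inner_le) fact
    then have "\<bar>s\<bar> \<le> 2 * t"
      using assms(1) r by (simp add: s_def abs_mult field_simps)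
    then have s0: "\<bar>s\<bar> \<le> s0" using assms by linarith
    have \<xi>': "\<xi>' = reflect z \<xi>" using 4 by (simp add: \<xi>'_def)
    have hz: "huber d z = r" using r by (simp add: huber_def r_def)
    have "z + (t *\<^sub>R \<xi> - t *\<^sub>R \<xi>') = z + t *\<^sub>R (\<xi> - reflect z \<xi>)"
      by (simp add: \<xi>' scaleR_diff_right)
    then have "huber d (z + (t *\<^sub>R \<xi> - t *\<^sub>R \<xi>')) = r + s"
      using huber_mirror[OF d 4(3) assms(1,2,4)] by (simp add: r_def s_def)
    \<comment> \<open>Mirroring flips the component along \<open>z\<close>, so the two contributions
      add up instead of cancelling.\<close>
    moreover have "f1 r * s = f1 r / r * (t * (\<xi> \<bullet> z - \<xi>' \<bullet> z))"
      by (simp add: s_def \<xi>' inner_commute[of _ z] inner_reflect_self)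
    moreover have "k r * s\<^sup>2 / 2 + \<omega> * s\<^sup>2 = q"
      using 4 by (simp add: q_def s_def r_def power_mult_distrib power_divide distrib_right add_divide_distrib)
    moreover have "max d (norm z) = r" using r by (simp add: r_def)
    ultimately show ?thesis
      using second_order[OF r(2) s0] 4 by (simp add: hz)
  qed (use jump d in \<open>auto simp: \<xi>'_def q_def\<close>)
qed

text \<open>For a mirrored pair the squared displacement has mean
  \<open>4 * t\<^sup>2 * \<sigma>\<close>; one factor 1/2 from \<open>k / 2\<close> and one from the
  acceptance leave \<open>t\<^sup>2 * \<sigma> * k\<close>. \<open>\<kappa>a\<close> and
  \<open>\<kappa>b\<close> measure how far the acceptances are from 1/2. They are not assumed small,
  because far out the cutoff suppresses the jumps.\<close>

lemma nn_integral_f_huber_step: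
  fixes z A B :: "'a::euclidean_space" and a b :: "'a \<Rightarrow> real"
  defines "\<sigma> \<equiv> ball_variance TYPE('a)"
  assumes t: "0 < t" "2 * t \<le> d" "2 * t \<le> s0"
    and [measurable]: "a \<in> borel_measurable borel" "b \<in> borel_measurable borel"
    and a: "\<And>\<xi>. norm \<xi> < 1 \<Longrightarrow> 0 \<le> a \<xi> \<and> a \<xi> \<le> 1" and b: "\<And>\<xi>. norm \<xi> < 1 \<Longrightarrow> 0 \<le> b \<xi> \<and> b \<xi> \<le> 1"
    and a_exp: "\<And>\<xi>. norm \<xi> < 1 \<Longrightarrow> \<bar>a \<xi> - a0 - t * (\<xi> \<bullet> A)\<bar> \<le> \<epsilon> * t"
    and b_exp: "\<And>\<xi>. norm \<xi> < 1 \<Longrightarrow> \<bar>b \<xi> - b0 - t * (\<xi> \<bullet> B)\<bar> \<le> \<epsilon> * t"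
    and a_half: "\<And>\<xi>. norm \<xi> < 1 \<Longrightarrow> \<bar>a \<xi> - 1/2\<bar> \<le> \<kappa>a" and b_half: "\<And>\<xi>. norm \<xi> < 1 \<Longrightarrow> \<bar>b \<xi> - 1/2\<bar> \<le> \<kappa>b"
    and \<epsilon>: "\<epsilon> \<ge> 0"
  shows "(\<integral>\<^sup>+w. ennreal (f (huber d (z + ((if snd w < a (fst w) then t *\<^sub>R fst w else 0)
              - (if snd w < b (fst (coupled_noise d z w)) then t *\<^sub>R fst (coupled_noise d z w) else 0))))) \<partial>noise)
    \<le> ennreal (f (huber d z)
        + t\<^sup>2 * \<sigma> * (f1 (huber d z) / max d (norm z) * ((A - B) \<bullet> z) + (if norm z \<ge> 2 * d then k (norm z) else 0))
        + t\<^sup>2 * (2 * \<epsilon> * L + 4 * \<omega> + (\<kappa>a + \<kappa>b) * (2 * K + L / (2 * d))))"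
    (is "(\<integral>\<^sup>+w. ennreal (?F w) \<partial>noise) \<le> _")
proof -
  interpret N: prob_space "noise :: ('a \<times> real) measure" by (rule prob_space_noise)
  define v where "v = (if norm z \<ge> 2 * d then z else 0)"
  define b' where "b' \<xi> = b (reflect v \<xi>)" for \<xi>
  \<comment> \<open>Sharing the uniform variable makes this the probability that both jumps are
    accepted.\<close>
  define mm where "mm \<xi> = min (a \<xi>) (b' \<xi>)" for \<xi>
  define q where "q \<xi> = (if norm z \<ge> 2 * d then (k (norm z) / 2 + \<omega>) * (4 * t\<^sup>2 * (\<xi> \<bullet> z)\<^sup>2 / (norm z)\<^sup>2) else 0)" for \<xi>
  define C where "C = L * t\<^sup>2 / (2 * d)"
  define D where "D = f1 (huber d z) / max d (norm z)"
  define F where "F = f (huber d z)"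
  have \<kappa>: "0 \<le> \<kappa>a" "0 \<le> \<kappa>b" using a_half[of 0] b_half[of 0] by auto
  have b_half': "\<bar>b' \<xi> - 1/2\<bar> \<le> \<kappa>b" if "norm \<xi> < 1" for \<xi>
    using b_half that by (simp add: b'_def)
  have D0: "D \<ge> 0" using f1 huber_pos[OF d, of z] d by (simp add: D_def le_max_iff_disj)
  have C0: "C \<ge> 0" using L_nonneg d by (simp add: C_def)
  have \<sigma>: "0 < \<sigma>" "\<sigma> \<le> 1" unfolding \<sigma>_def by (rule ball_variance_pos, rule ball_variance_le_1)
  have b': "\<And>\<xi>. norm \<xi> < 1 \<Longrightarrow> 0 \<le> b' \<xi> \<and> b' \<xi> \<le> 1" using b by (simp add: b'_def)
  have [measurable]: "b' \<in> borel_measurable borel" "mm \<in> borel_measurable borel" "q \<in> borel_measurable borel"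
    unfolding b'_def mm_def q_def by measurable
  have mm: "\<And>\<xi>. norm \<xi> < 1 \<Longrightarrow> 0 \<le> mm \<xi> \<and> mm \<xi> \<le> 1" using a b' by (simp add: mm_def min_le_iff_disj)
  have q_bd: "\<bar>q \<xi>\<bar> \<le> (\<bar>k (norm z) / 2\<bar> + \<omega>) * (4 * t\<^sup>2)" if "norm \<xi> < 1" for \<xi>
  proof (cases "norm z \<ge> 2 * d")
    case True
    then have "norm z > 0" using d by linarith
    moreover have "(\<xi> \<bullet> z)\<^sup>2 \<le> (norm z)\<^sup>2" using abs_inner_le[OF that, of z] by (simp add: abs_le_square_iff[symmetric])
    ultimately have "(\<xi> \<bullet> z)\<^sup>2 / (norm z)\<^sup>2 \<le> 1" by simp
    then have "4 * t\<^sup>2 * ((\<xi> \<bullet> z)\<^sup>2 / (norm z)\<^sup>2) \<le> 4 * t\<^sup>2" by (intro mult_left_le) auto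
    then show ?thesis using True \<omega>
      unfolding q_def by (simp only: abs_mult if_True) (intro mult_mono, auto)
  qed (use \<omega> in \<open>simp add: q_def\<close>)
  define g1 where "g1 w = (if snd w < a (fst w) then fst w \<bullet> z else 0)" for w :: "'a \<times> real"
  define g2 where "g2 w = (if snd w < b' (fst w) then reflect v (fst w) \<bullet> z else 0)" for w :: "'a \<times> real"
  define g3 where "g3 w = (if snd w < mm (fst w) then q (fst w) else 0)" for w :: "'a \<times> real"
  define g4 where "g4 c w = (if snd w < c (fst w) then C else 0)" for c and w :: "'a \<times> real"
  have i1: "integrable noise g1" "integral\<^sup>L noise g1 = (\<integral>\<xi>. a \<xi> * (\<xi> \<bullet> z) \<partial>ball_law)"
    unfolding g1_def by (rule integral_noise_if[where B="norm z"]; simp add: a abs_inner_le)+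
  have i2: "integrable noise g2" "integral\<^sup>L noise g2 = (\<integral>\<xi>. b' \<xi> * (reflect v \<xi> \<bullet> z) \<partial>ball_law)"
    unfolding g2_def by (rule integral_noise_if[where B="norm z"]; simp add: b' abs_inner_le)+
  have i3: "integrable noise g3" "integral\<^sup>L noise g3 = (\<integral>\<xi>. mm \<xi> * q \<xi> \<partial>ball_law)"
    unfolding g3_def using integral_noise_if[of mm q, OF _ _ mm q_bd] by simp_all
  have i4: "integrable noise (g4 c)" "integral\<^sup>L noise (g4 c) = (\<integral>\<xi>. c \<xi> * C \<partial>ball_law)"
    if "c \<in> borel_measurable borel" "\<And>\<xi>. norm \<xi> < 1 \<Longrightarrow> 0 \<le> c \<xi> \<and> c \<xi> \<le> 1" for c
    unfolding g4_def by (rule integral_noise_if[where B=C and h="\<lambda>_. C"]; use that C0 in simp)+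
  note i4a = i4[OF \<open>a \<in> borel_measurable borel\<close> a]
    and i4b = i4[OF \<open>b' \<in> borel_measurable borel\<close> b']
    and i4m = i4[OF \<open>mm \<in> borel_measurable borel\<close> mm]
  let ?S = "(\<integral>\<xi>. a \<xi> * (\<xi> \<bullet> z) \<partial>ball_law) - (\<integral>\<xi>. b' \<xi> * (reflect v \<xi> \<bullet> z) \<partial>ball_law)"
  let ?T = "(\<integral>\<xi>. a \<xi> * C \<partial>ball_law) + (\<integral>\<xi>. b' \<xi> * C \<partial>ball_law) - 2 * (\<integral>\<xi>. mm \<xi> * C \<partial>ball_law)"
  \<comment> \<open>The last bracket equals \<open>C\<close> if exactly one jump is accepted and 0
    otherwise.\<close>
  define \<Phi> where "\<Phi> w = F + D * (t * (g1 w - g2 w)) + g3 w + (g4 a w + g4 b' w - 2 * g4 mm w)" for w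
  have int\<Phi>: "integrable noise \<Phi>"
    unfolding \<Phi>_def using i1(1) i2(1) i3(1) i4a(1) i4b(1) i4m(1) by simp
  have bound: "?F w \<le> \<Phi> w"
    if "norm (fst w) < 1" for w
    using f_huber_step[OF t that, of z "snd w < a (fst w)" "snd w < b' (fst w)"]
    unfolding \<Phi>_def F_def D_def g1_def g2_def g3_def g4_def q_def C_def mm_def coupled_noise_def fst_conv v_def b'_def
    by (auto split: if_splits simp: field_simps)
  have "(\<integral>\<^sup>+w. ennreal (?F w) \<partial>noise)
     \<le> (\<integral>\<^sup>+w. ennreal (\<Phi> w) \<partial>noise)"
    by (rule nn_integral_mono_AE, rule eventually_mono[OF AE_noise], rule ennreal_leI, rule bound)
  also have "\<dots> = ennreal (\<integral>w. \<Phi> w \<partial>noise)"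
  proof (rule nn_integral_eq_integral[OF int\<Phi>])
    show "AE w in noise. 0 \<le> \<Phi> w"
      using AE_noise
    proof eventually_elim
      case (elim w)
      from bound[OF elim] show ?case
        by (rule order_trans[rotated]) (rule f_nonneg, rule huber_pos[OF d])
    qed
  qed
  also have "(\<integral>w. \<Phi> w \<partial>noise) = F + D * (t * ?S)
      + (\<integral>\<xi>. mm \<xi> * q \<xi> \<partial>ball_law)
      + ?T"
    unfolding \<Phi>_def by (simp add: i1 i2 i3 i4a i4b i4m N.prob_space)
  also have "\<dots> \<le> F + (t\<^sup>2 * \<sigma> * (D * ((A - B) \<bullet> z)) + t\<^sup>2 * (2 * \<epsilon> * L))
      + (t\<^sup>2 * \<sigma> * (if norm z \<ge> 2 * d then k (norm z) else 0) + t\<^sup>2 * (4 * \<omega> + (\<kappa>a + \<kappa>b) * (2 * K)))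
      + t\<^sup>2 * ((\<kappa>a + \<kappa>b) * (L / (2 * d)))"
  proof (intro add_mono order_refl)
    \<comment> \<open>The constant part \<open>c0\<close> averages to 0 by symmetry; the tilt along
      \<open>E\<close> yields the drift through the covariance of the ball law.\<close>
    have est: "\<bar>(\<integral>\<xi>. c \<xi> * (\<xi> \<bullet> z) \<partial>ball_law) - t * \<sigma> * (E \<bullet> z)\<bar> \<le> \<epsilon> * t * norm z"
      if [measurable]: "c \<in> borel_measurable borel" and c: "\<And>\<xi>. norm \<xi> < 1 \<Longrightarrow> \<bar>c \<xi> - c0 - t * (\<xi> \<bullet> E)\<bar> \<le> \<epsilon> * t"
        and c1: "\<And>\<xi>. norm \<xi> < 1 \<Longrightarrow> 0 \<le> c \<xi> \<and> c \<xi> \<le> 1"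
      for c c0 E
    proof -
      let ?h = "\<lambda>\<xi>. c \<xi> * (\<xi> \<bullet> z) - c0 * (\<xi> \<bullet> z) - t * ((\<xi> \<bullet> E) * (\<xi> \<bullet> z))"
      have I1: "integrable ball_law (\<lambda>\<xi>. c \<xi> * (\<xi> \<bullet> z))"
        using c1 by (intro integrable_ball_law_mult[where B=1]) (auto intro!: abs_inner_le)
      have I2: "integrable ball_law (\<lambda>\<xi>. \<xi> \<bullet> z)"
        by (intro integrable_ball_law[where B="norm z"]) (auto intro!: abs_inner_le)
      have I3: "integrable ball_law (\<lambda>\<xi>. (\<xi> \<bullet> E) * (\<xi> \<bullet> z))"
        by (intro integrable_ball_law_mult) (auto intro!: abs_inner_le)
      have eq: "(\<integral>\<xi>. c \<xi> * (\<xi> \<bullet> z) \<partial>ball_law) - t * \<sigma> * (E \<bullet> z)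
          = (\<integral>\<xi>. ?h \<xi> \<partial>ball_law)"
        using I1 I2 I3 by (simp add: integral_ball_law_inner integral_ball_law_inner_inner \<sigma>_def)
      have I: "integrable ball_law (\<lambda>\<xi>. ?h \<xi>)"
        using I1 I2 I3 by simp
      have bd: "AE \<xi> in ball_law. \<bar>?h \<xi>\<bar> \<le> \<epsilon> * t * norm z"
        using AE_ball_law
      proof eventually_elim
        case (elim \<xi>)
        have "\<bar>?h \<xi>\<bar> = \<bar>c \<xi> - c0 - t * (\<xi> \<bullet> E)\<bar> * \<bar>\<xi> \<bullet> z\<bar>"
          by (simp add: abs_mult[symmetric] algebra_simps)
        also have "\<dots> \<le> \<epsilon> * t * norm z"
          using \<epsilon> t by (intro mult_mono c abs_inner_le elim) auto
        finally show ?case .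
      qed
      have "(\<integral>\<xi>. ?h \<xi> \<partial>ball_law) \<le> \<epsilon> * t * norm z"
        using bd by (intro ubm.integral_le_const[OF I]) (auto elim!: eventually_mono)
      moreover have "- (\<epsilon> * t * norm z) \<le> (\<integral>\<xi>. ?h \<xi> \<partial>ball_law)"
        using bd by (intro ubm.integral_ge_const[OF I]) (auto elim!: eventually_mono)
      ultimately show ?thesis unfolding eq by linarith
    qed
    show "D * (t * ?S)
      \<le> t\<^sup>2 * \<sigma> * (D * ((A - B) \<bullet> z)) + t\<^sup>2 * (2 * \<epsilon> * L)"
    proof -
      have "(\<integral>\<xi>. b' \<xi> * (reflect v \<xi> \<bullet> z) \<partial>ball_law) = (\<integral>\<xi>. b \<xi> * (\<xi> \<bullet> z) \<partial>ball_law)"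
        unfolding b'_def by (rule integral_ball_law_reflect[of "\<lambda>\<xi>. b \<xi> * (\<xi> \<bullet> z)"]) measurable
      with est[OF _ a_exp a] est[OF _ b_exp b]
      have "?S
          \<le> t * \<sigma> * ((A - B) \<bullet> z) + 2 * (\<epsilon> * t * norm z)"
        by (simp add: inner_diff_left right_diff_distrib abs_le_iff)
      then have "D * (t * ?S)
          \<le> D * (t * (t * \<sigma> * ((A - B) \<bullet> z) + 2 * (\<epsilon> * t * norm z)))"
        using D0 t by (intro mult_left_mono) auto
      also have "\<dots> = t\<^sup>2 * \<sigma> * (D * ((A - B) \<bullet> z)) + t\<^sup>2 * (2 * \<epsilon> * (D * norm z))"
        by (simp add: power2_eq_square algebra_simps)
      also have "D * norm z \<le> L"
      proof -
        have "D * norm z = f1 (huber d z) * (norm z / max d (norm z))" by (simp add: D_def)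
        also have "\<dots> \<le> L * 1"
          using d f1 huber_pos[OF d, of z] L_nonneg
          by (intro mult_mono) (auto simp: divide_le_eq_1 less_max_iff_disj)
        finally show ?thesis by simp
      qed
      finally show ?thesis using \<epsilon> by (simp add: mult_left_mono)
    qed
    show "(\<integral>\<xi>. mm \<xi> * q \<xi> \<partial>ball_law)
      \<le> t\<^sup>2 * \<sigma> * (if norm z \<ge> 2 * d then k (norm z) else 0) + t\<^sup>2 * (4 * \<omega> + (\<kappa>a + \<kappa>b) * (2 * K))"
    proof (cases "norm z \<ge> 2 * d")
      case False
      then show ?thesis using \<omega> K_nonneg \<kappa> by (simp add: q_def)
    next
      case True
      define u where "u \<xi> = 4 * t\<^sup>2 * (\<xi> \<bullet> z)\<^sup>2 / (norm z)\<^sup>2" for \<xi>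
      define kz where "kz = k (norm z)"
      have kz: "- K \<le> kz" "kz \<le> 0" using k[OF True] by (auto simp: kz_def)
      have z0: "norm z > 0" using True d by linarith
      have intsq: "integrable ball_law (\<lambda>\<xi>. (\<xi> \<bullet> z)\<^sup>2)"
        by (rule integrable_ball_law[where B="(norm z)\<^sup>2"])
           (auto simp: abs_le_square_iff[symmetric] abs_inner_le)
      then have intu: "integrable ball_law u" unfolding u_def by simp
      have Eu: "(\<integral>\<xi>. u \<xi> \<partial>ball_law) = 4 * t\<^sup>2 * \<sigma>"
        unfolding u_def using z0 by (simp add: integral_ball_law_inner_sq \<sigma>_def)
      have "(\<integral>\<xi>. mm \<xi> * q \<xi> \<partial>ball_law)
          \<le> (\<integral>\<xi>. (kz / 2 * (1 / 2 - (\<kappa>a + \<kappa>b)) + \<omega>) * u \<xi> \<partial>ball_law)"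
      proof (rule integral_mono_AE)
        show "integrable ball_law (\<lambda>\<xi>. mm \<xi> * q \<xi>)"
          using mm by (intro integrable_ball_law_mult[where B=1, OF _ _ _ q_bd]) auto
        show "integrable ball_law (\<lambda>\<xi>. (kz / 2 * (1 / 2 - (\<kappa>a + \<kappa>b)) + \<omega>) * u \<xi>)"
          using intu by simp
        show "AE \<xi> in ball_law. mm \<xi> * q \<xi> \<le> (kz / 2 * (1 / 2 - (\<kappa>a + \<kappa>b)) + \<omega>) * u \<xi>"
          using AE_ball_law
        proof eventually_elim
          case (elim \<xi>)
          have u0: "u \<xi> \<ge> 0" by (simp add: u_def)
          \<comment> \<open>Since \<open>kz \<le> 0\<close>, a lower bound on the joint acceptance
            is what secures the second-order gain.\<close>
          have "1 / 2 - (\<kappa>a + \<kappa>b) \<le> mm \<xi>"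
            using a_half[OF elim] b_half'[OF elim] \<kappa> unfolding mm_def by (auto simp: min_def abs_le_iff)
          then have "mm \<xi> * kz \<le> (1 / 2 - (\<kappa>a + \<kappa>b)) * kz" using kz(2) by (rule mult_right_mono_neg)
          moreover have "mm \<xi> * \<omega> \<le> \<omega>" using mm[OF elim] \<omega> by (simp add: mult_left_le_one_le)
          ultimately have "mm \<xi> * (kz / 2 + \<omega>) \<le> kz / 2 * (1 / 2 - (\<kappa>a + \<kappa>b)) + \<omega>"
            by (simp add: distrib_left mult.commute)
          then have "mm \<xi> * (kz / 2 + \<omega>) * u \<xi> \<le> (kz / 2 * (1 / 2 - (\<kappa>a + \<kappa>b)) + \<omega>) * u \<xi>"
            using u0 by (rule mult_right_mono)
          then show ?case by (simp only: q_def u_def kz_def True if_True mult.assoc)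
        qed
      qed
      also have "\<dots> = (kz / 2 * (1 / 2 - (\<kappa>a + \<kappa>b)) + \<omega>) * (4 * t\<^sup>2 * \<sigma>)"
        by (simp add: Eu)
      also have "\<dots> = t\<^sup>2 * \<sigma> * kz + t\<^sup>2 * (4 * (\<omega> * \<sigma>) + (\<kappa>a + \<kappa>b) * (2 * (- kz * \<sigma>)))"
        by (simp add: algebra_simps)
      also have "\<dots> \<le> t\<^sup>2 * \<sigma> * kz + t\<^sup>2 * (4 * \<omega> + (\<kappa>a + \<kappa>b) * (2 * K))"
      proof (intro add_left_mono mult_left_mono add_mono)
        show "\<omega> * \<sigma> \<le> \<omega>" using \<omega> \<sigma> by (simp add: mult_left_le)
        have "- kz * \<sigma> \<le> K * 1" using kz \<sigma> by (intro mult_mono) auto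
        then show "- kz * \<sigma> \<le> K" by simp
      qed (use \<kappa> in auto)
      finally show ?thesis using True by (simp add: kz_def)
    qed
    show "?T
      \<le> t\<^sup>2 * ((\<kappa>a + \<kappa>b) * (L / (2 * d)))"
    proof -
      have I: "integrable ball_law c" if "c \<in> borel_measurable borel" "\<And>\<xi>. norm \<xi> < 1 \<Longrightarrow> 0 \<le> c \<xi> \<and> c \<xi> \<le> 1"
        for c :: "'a \<Rightarrow> real"
        using that by (intro integrable_ball_law[where B=1]) (auto simp: abs_le_iff intro: order_trans)
      have Ia: "integrable ball_law a" and Ib: "integrable ball_law b'" and Im: "integrable ball_law mm"
        using a b' mm by (auto intro!: I)
      \<comment> \<open>The integrand is the absolute difference of the two acceptances.\<close>
      have "(\<integral>\<xi>. a \<xi> + b' \<xi> - 2 * mm \<xi> \<partial>ball_law) \<le> \<kappa>a + \<kappa>b"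
      proof (rule ubm.integral_le_const)
        show "AE \<xi> in ball_law. a \<xi> + b' \<xi> - 2 * mm \<xi> \<le> \<kappa>a + \<kappa>b"
          using AE_ball_law
        proof eventually_elim
          case (elim \<xi>)
          show ?case using a_half[OF elim] b_half'[OF elim] unfolding mm_def by (auto simp: min_def abs_le_iff)
        qed
      qed (use Ia Ib Im in simp)
      then have "C * (\<integral>\<xi>. a \<xi> + b' \<xi> - 2 * mm \<xi> \<partial>ball_law) \<le> C * (\<kappa>a + \<kappa>b)"
        using C0 by (rule mult_left_mono)
      moreover have "?T
          = C * (\<integral>\<xi>. a \<xi> + b' \<xi> - 2 * mm \<xi> \<partial>ball_law)"
        using Ia Ib Im by (simp add: algebra_simps)
      moreover have "C * (\<kappa>a + \<kappa>b) = t\<^sup>2 * ((\<kappa>a + \<kappa>b) * (L / (2 * d)))"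
        by (simp add: C_def)
      ultimately show ?thesis by (simp only:)
    qed
  qed
  finally have "(\<integral>\<^sup>+w. ennreal (?F w) \<partial>noise)
    \<le> ennreal (F + (t\<^sup>2 * \<sigma> * (D * ((A - B) \<bullet> z)) + t\<^sup>2 * (2 * \<epsilon> * L))
      + (t\<^sup>2 * \<sigma> * (if norm z \<ge> 2 * d then k (norm z) else 0) + t\<^sup>2 * (4 * \<omega> + (\<kappa>a + \<kappa>b) * (2 * K)))
      + t\<^sup>2 * ((\<kappa>a + \<kappa>b) * (L / (2 * d))))"
    by this (rule ennreal_leI)
  also have "\<dots> = ennreal (f (huber d z)
        + t\<^sup>2 * \<sigma> * (f1 (huber d z) / max d (norm z) * ((A - B) \<bullet> z) + (if norm z \<ge> 2 * d then k (norm z) else 0))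
        + t\<^sup>2 * (2 * \<epsilon> * L + 4 * \<omega> + (\<kappa>a + \<kappa>b) * (2 * K + L / (2 * d))))"
    by (simp only: F_def D_def distrib_left distrib_right add_ac mult_ac)
  finally show ?thesis .
qed

end

section \<open>The concave profile\<close>

locale tilde_g =
  fixes g :: "real \<Rightarrow> real" and g0' \<alpha> :: real
  assumes g_in: "calG_tilde g" and g'0: "(deriv g \<longlongrightarrow> g0') (at_right 0)" and g0'_pos: "g0' > 0" and \<alpha>_pos: "\<alpha> > 0"
begin

definition N where "N = sup_norm_pos g"
text \<open>The value of \<open>R\<close> is the smallest one for which the bound \<open>g \<le> N\<close> gives the drift inequality beyond \<open>R\<close>.\<close>
definition R where "R = N * (1 / g0' + 2 / \<alpha>)"
definition f where "f r = (if r \<le> R then g r else g R + deriv g R * (r - R))"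
definition f1 where "f1 r = deriv g (min r R)"
text \<open>Contraction rate per unit of \<tau>. Replacing \<open>deriv g r\<close> by
  \<open>deriv g R\<close> and \<open>r\<close> by \<open>g r / g0'\<close> turns
  \<open>deriv g r * (g r + \<alpha> * r) / 4\<close> into this multiple of
  \<open>g r\<close>.\<close>

definition \<Lambda> where "\<Lambda> = deriv g R / g0' * (\<alpha> + g0') / 4"

lemma DERIV_g: "r > 0 \<Longrightarrow> DERIV g r :> deriv g r"
  and DERIV_g': "r > 0 \<Longrightarrow> DERIV (deriv g) r :> deriv (deriv g) r"
  using g_in by (auto simp: calG_tilde_def calG_def C2_pos_def DERIV_deriv_iff_real_differentiable)

lemma g_nonneg: "r > 0 \<Longrightarrow> 0 \<le> g r" and g'_nonneg: "r > 0 \<Longrightarrow> 0 \<le> deriv g r"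
  and g_ode: "r > 0 \<Longrightarrow> 2 * deriv (deriv g) r + g r * deriv g r \<le> 0"
  and g_lim: "(g \<longlongrightarrow> 0) (at_right 0)"
  using g_in by (auto simp: calG_tilde_def calG_def)

lemma g''_nonpos: "r > 0 \<Longrightarrow> deriv (deriv g) r \<le> 0"
  using g_ode[of r] mult_nonneg_nonneg[OF g_nonneg[of r] g'_nonneg[of r]] by simp

lemma g'_antimono: "0 < r \<Longrightarrow> r \<le> s \<Longrightarrow> deriv g s \<le> deriv g r"
  by (rule DERIV_nonpos_imp_nonincreasing[of r s "deriv g"])
     (auto intro!: exI DERIV_g' g''_nonpos)

lemma g'_le: "r > 0 \<Longrightarrow> deriv g r \<le> g0'"
  by (rule tendsto_lowerbound[OF g'0])
     (auto simp: eventually_at_right_field intro!: exI[of _ r] g'_antimono)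

lemma continuous_g: "r > 0 \<Longrightarrow> isCont g r" "r > 0 \<Longrightarrow> isCont (deriv g) r"
  using DERIV_g DERIV_g' by (blast intro: DERIV_isCont)+

lemma g_mvt:
  assumes "0 < r" "r < s"
  obtains u where "r < u" "u < s" "g s - g r = (s - r) * deriv g u"
  using MVT2[OF assms(2), of g "deriv g"] DERIV_g assms by (metis less_trans order_less_le_trans)

lemma g_tangent:
  assumes "0 < \<rho>" "0 < \<rho>'"
  shows "g \<rho>' \<le> g \<rho> + deriv g \<rho> * (\<rho>' - \<rho>)"
proof (cases \<rho> \<rho>' rule: linorder_cases)
  case less
  obtain u where u: "\<rho> < u" "u < \<rho>'" "g \<rho>' - g \<rho> = (\<rho>' - \<rho>) * deriv g u"
    using g_mvt[OF assms(1) less] by metis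
  have "(\<rho>' - \<rho>) * deriv g u \<le> (\<rho>' - \<rho>) * deriv g \<rho>"
    using u assms by (intro mult_left_mono g'_antimono) auto
  then show ?thesis using u(3) by (simp add: algebra_simps)
next
  case greater
  obtain u where u: "\<rho>' < u" "u < \<rho>" "g \<rho> - g \<rho>' = (\<rho> - \<rho>') * deriv g u"
    using g_mvt[OF assms(2) greater] by metis
  have "(\<rho> - \<rho>') * deriv g \<rho> \<le> (\<rho> - \<rho>') * deriv g u"
    using u assms by (intro mult_left_mono g'_antimono) auto
  then show ?thesis using u(3) by (simp add: algebra_simps)
qed simp

text \<open>Let the point of tangency tend to 0, where \<open>g\<close> tends to 0 and its slope to
  \<open>g0'\<close>. In \<open>g_ge\<close> it is the other point that tends to 0.\<close>

lemma g_le: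
  assumes "r > 0" shows "g r \<le> g0' * r"
proof (rule tendsto_lowerbound)
  show "((\<lambda>s. g s + g0' * (r - s)) \<longlongrightarrow> g0' * r) (at_right 0)"
    by (rule tendsto_eq_intros g_lim refl | simp)+
  show "\<forall>\<^sub>F s in at_right 0. g r \<le> g s + g0' * (r - s)"
    unfolding eventually_at_right_field
  proof (intro exI conjI allI impI)
    fix s assume "0 < s" "s < r"
    then have "g r \<le> g s + deriv g s * (r - s)" by (intro g_tangent) auto
    also have "\<dots> \<le> g s + g0' * (r - s)"
      using \<open>0 < s\<close> \<open>s < r\<close> by (intro add_left_mono mult_right_mono g'_le) auto
    finally show "g r \<le> g s + g0' * (r - s)" .
  qed (fact assms)
qed simp

lemma g_ge:
  assumes "r > 0" shows "deriv g r * r \<le> g r"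
proof (rule tendsto_lowerbound)
  show "((\<lambda>s. g r - g s + deriv g r * s) \<longlongrightarrow> g r) (at_right 0)"
    by (rule tendsto_eq_intros g_lim refl | simp)+
  show "\<forall>\<^sub>F s in at_right 0. deriv g r * r \<le> g r - g s + deriv g r * s"
    unfolding eventually_at_right_field
    using g_tangent[OF assms] by (intro exI[of _ 1]) (simp add: algebra_simps)
qed simp

lemma g_le_N: "r > 0 \<Longrightarrow> g r \<le> N"
proof -
  assume r: "r > 0"
  have "bounded ((\<lambda>r. \<bar>g r\<bar>) ` {0<..})"
    using g_in by (auto simp: calG_tilde_def bounded_iff)
  then have "\<bar>g r\<bar> \<le> N"
    unfolding N_def sup_norm_pos_def using r by (intro cSUP_upper) (auto intro: bounded_imp_bdd_above)
  then show ?thesis by simp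
qed

lemma N_pos: "N > 0"
proof -
  have "\<forall>\<^sub>F r in at_right 0. deriv g r > 0"
    using order_tendstoD(1)[OF g'0 g0'_pos] .
  then obtain b where "b > 0" "\<And>y. 0 < y \<Longrightarrow> y < b \<Longrightarrow> deriv g y > 0"
    by (auto simp: eventually_at_right_field)
  then have "deriv g (b / 2) > 0" "b / 2 > 0" by auto
  then have "0 < deriv g (b / 2) * (b / 2)" by simp
  also have "\<dots> \<le> g (b / 2)" using \<open>b / 2 > 0\<close> by (rule g_ge)
  also have "\<dots> \<le> N" using \<open>b / 2 > 0\<close> by (rule g_le_N)
  finally show ?thesis .
qed

lemma R_pos: "R > 0"
  unfolding R_def using N_pos g0'_pos \<alpha>_pos by (intro mult_pos_pos add_pos_pos) auto

lemma \<Lambda>_nonneg: "\<Lambda> \<ge> 0"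
  unfolding \<Lambda>_def using g'_nonneg[OF R_pos] g0'_pos \<alpha>_pos by simp

lemma f_tangent:
  assumes "0 < \<rho>" "0 < \<rho>'"
  shows "f \<rho>' \<le> f \<rho> + f1 \<rho> * (\<rho>' - \<rho>)"
proof -
  consider "\<rho> \<le> R" "\<rho>' \<le> R" | "\<rho> \<le> R" "R < \<rho>'" | "R < \<rho>" "\<rho>' \<le> R" | "R < \<rho>" "R < \<rho>'" by linarith
  then show ?thesis
  proof cases
    case 1 then show ?thesis using g_tangent[OF assms] by (simp add: f_def f1_def)
  next
    case 2
    have "g R \<le> g \<rho> + deriv g \<rho> * (R - \<rho>)" using assms R_pos by (intro g_tangent)
    moreover have "deriv g R * (\<rho>' - R) \<le> deriv g \<rho> * (\<rho>' - R)"
      using 2 assms by (intro mult_right_mono g'_antimono) auto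
    ultimately show ?thesis using 2 by (simp add: f_def f1_def algebra_simps)
  next
    case 3
    then show ?thesis using g_tangent[OF R_pos assms(2)] by (simp add: f_def f1_def algebra_simps)
  qed (simp add: f_def f1_def algebra_simps)
qed

lemma f1_nonneg: "0 < \<rho> \<Longrightarrow> 0 \<le> f1 \<rho>" and f1_le: "0 < \<rho> \<Longrightarrow> f1 \<rho> \<le> g0'"
  using R_pos by (auto simp: f1_def intro: g'_nonneg g'_le)

text \<open>\<open>deriv g R\<close> is the smallest slope of \<open>f\<close>. In the final
  constant one factor \<open>g0' / deriv g R\<close> comes from \<Lambda>, the other from comparing
  the upper bound \<open>g0'\<close> of the slopes with this lower bound.\<close>

lemma f_ge:
  assumes "0 < r" shows "deriv g R * r \<le> f r"
proof (cases "r \<le> R")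
  case True
  have "deriv g R * r \<le> deriv g r * r" using True assms by (intro mult_right_mono g'_antimono) auto
  then show ?thesis using g_ge[OF assms] True by (simp add: f_def)
next
  case False
  then show ?thesis using g_ge[OF R_pos] by (simp add: f_def algebra_simps)
qed

lemma f_nonneg: "0 < r \<Longrightarrow> 0 \<le> f r"
  using f_ge[of r] g'_nonneg[OF R_pos] by (meson less_imp_le mult_nonneg_nonneg order_trans)

lemma f_le:
  assumes "0 < r" shows "f r \<le> g0' * r"
proof (cases "r \<le> R")
  case False
  have "deriv g R * (r - R) \<le> g0' * (r - R)" using False R_pos by (intro mult_right_mono g'_le) auto
  then show ?thesis using g_le[OF R_pos] False by (simp add: f_def algebra_simps)
qed (use g_le[OF assms] in \<open>simp add: f_def\<close>)

text \<open>The differential inequality provides \<open>- g g' / 2\<close>. One half of it absorbs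
  the defect \<open>g g' / 4\<close> of convexity; the other half contracts in addition to the term
  with \<alpha>.\<close>

lemma drift_within_R:
  assumes "0 < r" "r \<le> R"
  shows "deriv (deriv g) r - f1 r * ((\<alpha> * r - g r) / 4) \<le> - \<Lambda> * f r"
proof -
  have "deriv (deriv g) r - deriv g r * ((\<alpha> * r - g r) / 4) \<le> - (deriv g r * ((g r + \<alpha> * r) / 4))"
  proof -
    have 1: "deriv g r * ((\<alpha> * r - g r) / 4) = \<alpha> * (r * deriv g r) / 4 - g r * deriv g r / 4"
      by (simp add: right_diff_distrib diff_divide_distrib mult_ac)
    have 2: "deriv g r * ((g r + \<alpha> * r) / 4) = g r * deriv g r / 4 + \<alpha> * (r * deriv g r) / 4"
      by (simp add: distrib_left add_divide_distrib mult_ac)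
    show ?thesis unfolding 1 2 using g_ode[OF assms(1)] by simp
  qed
  also have "\<dots> \<le> - (deriv g R * ((g r + \<alpha> * (g r / g0')) / 4))"
  proof -
    have "g r / g0' \<le> r" using g_le[OF assms(1)] g0'_pos by (simp add: field_simps)
    then have "deriv g R * ((g r + \<alpha> * (g r / g0')) / 4) \<le> deriv g r * ((g r + \<alpha> * r) / 4)"
      using assms \<alpha>_pos g_nonneg[OF assms(1)] g'_nonneg[OF assms(1)] g0'_pos
      by (intro mult_mono g'_antimono divide_right_mono add_left_mono mult_left_mono)
         (auto intro!: add_nonneg_nonneg mult_nonneg_nonneg)
    then show ?thesis by simp
  qed
  also have "\<dots> = - \<Lambda> * g r"
    unfolding \<Lambda>_def using g0'_pos by (simp add: field_simps)
  finally show ?thesis using assms by (simp add: f_def f1_def)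
qed

text \<open>Here \<open>f\<close> is affine and mirroring gains nothing, so the drift must contract
  by itself.\<close>

lemma drift_beyond_R:
  assumes "R \<le> r"
  shows "- f1 r * ((\<alpha> * r - g r) / 4) \<le> - \<Lambda> * f r"
proof -
  \<comment> \<open>This is \<open>N / R\<close>. From \<open>R\<close> on, \<open>f r\<close> and
    \<open>g r\<close> are at most \<open>c * r\<close>, and the definition of \<open>R\<close>
    amounts to \<open>(\<alpha> + g0') * c = g0' * (\<alpha> - c)\<close>, which closes the
    estimate.\<close>
  define c where "c = \<alpha> * g0' / (\<alpha> + 2 * g0')"
  have c: "(\<alpha> + 2 * g0') * c = \<alpha> * g0'" "c > 0" using \<alpha>_pos g0'_pos by (simp_all add: c_def)
  have Nc: "N = c * R"
  proof -
    have "1 / g0' + 2 / \<alpha> = (\<alpha> + 2 * g0') / (\<alpha> * g0')" using \<alpha>_pos g0'_pos by (simp add: field_simps)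
    then have "c * (1 / g0' + 2 / \<alpha>) = 1" using \<alpha>_pos g0'_pos by (simp add: c_def)
    then show ?thesis by (simp add: R_def mult.left_commute[of c])
  qed
  have r: "r > 0" using assms R_pos by simp
  have g'R: "deriv g R \<le> c"
  proof -
    have "deriv g R * R \<le> c * R" using g_ge[OF R_pos] g_le_N[OF R_pos] Nc by simp
    then show ?thesis using R_pos by simp
  qed
  have fr: "f r = g R + deriv g R * (r - R)" using assms by (auto simp: f_def)
  also have "\<dots> \<le> c * R + c * (r - R)"
    using g_le_N[OF R_pos] Nc g'R assms by (intro add_mono mult_right_mono) auto
  also have "\<dots> = c * r" by (simp add: algebra_simps)
  finally have "(\<alpha> + g0') * f r \<le> (\<alpha> + g0') * (c * r)"
    using \<alpha>_pos g0'_pos by (intro mult_left_mono) auto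
  also have "\<dots> = g0' * (\<alpha> * r - c * r)"
  proof -
    have "(\<alpha> + g0') * (c * r) = ((\<alpha> + 2 * g0') * c) * r - g0' * (c * r)" by (simp add: algebra_simps)
    then show ?thesis unfolding c(1) by (simp add: algebra_simps)
  qed
  also have "\<dots> \<le> g0' * (\<alpha> * r - g r)"
  proof -
    have "g r \<le> c * R" using g_le_N[OF r] Nc by simp
    also have "\<dots> \<le> c * r" using c assms by simp
    finally show ?thesis using g0'_pos by (intro mult_left_mono) auto
  qed
  finally have "deriv g R / g0' / 4 * ((\<alpha> + g0') * f r) \<le> deriv g R / g0' / 4 * (g0' * (\<alpha> * r - g r))"
    using g'_nonneg[OF R_pos] g0'_pos by (intro mult_left_mono) auto
  moreover have "f1 r = deriv g R" using assms by (simp add: f1_def min_absorb2)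
  ultimately show ?thesis using g0'_pos by (simp add: \<Lambda>_def mult.assoc)
qed

text \<open>The second derivative of \<open>f\<close> may jump at \<open>R\<close>, so second-order
  terms are given up already from \<open>R - \<eta>\<close> on. At \<open>R\<close> the inequality
  holds without them, and continuity limits the loss nearby to \<epsilon>.\<close>

lemma drift_near_R:
  assumes "\<epsilon> > 0"
  obtains \<eta> where "\<eta> > 0" "\<And>r. R - \<eta> < r \<Longrightarrow> 0 < r \<Longrightarrow> - f1 r * ((\<alpha> * r - g r) / 4) \<le> - \<Lambda> * f r + \<epsilon>"
proof -
  define \<Psi> where "\<Psi> r = - deriv g r * ((\<alpha> * r - g r) / 4) + \<Lambda> * g r" for r
  have "isCont \<Psi> R"
    unfolding \<Psi>_def[abs_def] using R_pos by (intro continuous_intros continuous_g) auto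
  moreover have "\<Psi> R \<le> 0" using drift_beyond_R[of R] by (simp add: \<Psi>_def f_def f1_def)
  ultimately have "\<forall>\<^sub>F r in at R. \<Psi> r < \<epsilon>"
    using assms by (intro order_tendstoD(2)[of _ "\<Psi> R"]) (auto simp: isCont_def)
  then obtain \<eta> where \<eta>: "\<eta> > 0" "\<And>r. r \<noteq> R \<Longrightarrow> dist r R < \<eta> \<Longrightarrow> \<Psi> r < \<epsilon>"
    by (auto simp: eventually_at)
  show thesis
  proof (rule that[OF \<eta>(1)])
    fix r assume r: "R - \<eta> < r" "0 < r"
    show "- f1 r * ((\<alpha> * r - g r) / 4) \<le> - \<Lambda> * f r + \<epsilon>"
    proof (cases "R \<le> r")
      case True then show ?thesis using drift_beyond_R[OF True] assms by simp
    next
      case False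
      then have "\<Psi> r < \<epsilon>" using r by (intro \<eta>) (auto simp: dist_real_def)
      then show ?thesis using False by (simp add: \<Psi>_def f_def f1_def)
    qed
  qed
qed

text \<open>Uniform because \<open>r\<close> stays away from 0, where the second derivative of
  \<open>g\<close> may blow up, and \<open>r + s\<close> does not cross \<open>R\<close>, where that
  of \<open>f\<close> may jump.\<close>

lemma second_order:
  assumes "d > 0" "\<eta> > 0" "\<omega> > 0"
  obtains s0 where "s0 > 0" "\<And>r s. d \<le> r \<Longrightarrow> r \<le> R - \<eta> \<Longrightarrow> \<bar>s\<bar> \<le> s0 \<Longrightarrow>
    f (r + s) \<le> f r + f1 r * s + deriv (deriv g) r * s\<^sup>2 / 2 + \<omega> * s\<^sup>2"
proof -
  \<comment> \<open>Starting at \<open>d / 2\<close> leaves room for a displacement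
    \<open>\<bar>s\<bar> \<le> d / 2\<close>.\<close>
  have "continuous_on {d / 2..R} (deriv (deriv g))"
    using g_in assms(1) by (auto simp: calG_tilde_def calG_def C2_pos_def intro: continuous_on_subset)
  then have "uniformly_continuous_on {d / 2..R} (deriv (deriv g))"
    by (rule compact_uniformly_continuous) simp
  moreover have "2 * \<omega> > 0" using assms by simp
  ultimately obtain \<delta> where \<delta>: "\<delta> > 0" "\<And>x x'. x \<in> {d / 2..R} \<Longrightarrow> x' \<in> {d / 2..R} \<Longrightarrow> dist x' x < \<delta> \<Longrightarrow>
      dist (deriv (deriv g) x') (deriv (deriv g) x) < 2 * \<omega>"
    unfolding uniformly_continuous_on_def by metis
  show thesis
  proof (rule that[of "min (\<delta> / 2) (min (d / 2) \<eta>)"])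
    fix r s assume r: "d \<le> r" "r \<le> R - \<eta>" and s: "\<bar>s\<bar> \<le> min (\<delta> / 2) (min (d / 2) \<eta>)"
    have f: "f (r + s) = g (r + s)" "f r = g r" "f1 r = deriv g r" using r s assms by (auto simp: f_def f1_def)
    show "f (r + s) \<le> f r + f1 r * s + deriv (deriv g) r * s\<^sup>2 / 2 + \<omega> * s\<^sup>2"
    proof (cases "s = 0")
      case False
      define diff where "diff m = (if m = 0 then g else if m = Suc 0 then deriv g else deriv (deriv g))" for m :: nat
      have "\<exists>u. (if r + s < r then r + s < u \<and> u < r else r < u \<and> u < r + s) \<and>
          g (r + s) = (\<Sum>m<2. diff m r / fact m * (r + s - r) ^ m) + diff 2 u / fact 2 * (r + s - r) ^ 2"
      proof (rule Taylor[of 2 diff g "d / 2" R])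
        show "\<forall>m t. m < 2 \<and> d / 2 \<le> t \<and> t \<le> R \<longrightarrow> (diff m has_real_derivative diff (Suc m) t) (at t)"
          using assms(1) by (auto simp: diff_def less_2_cases_iff intro!: DERIV_g DERIV_g')
      qed (use r s False assms in \<open>auto simp: diff_def\<close>)
      then obtain u where u': "if r + s < r then r + s < u \<and> u < r else r < u \<and> u < r + s"
        and eq: "g (r + s) = (\<Sum>m<2. diff m r / fact m * (r + s - r) ^ m) + diff 2 u / fact 2 * (r + s - r) ^ 2"
        by blast
      from u' have u: "\<bar>u - r\<bar> \<le> \<bar>s\<bar>" by (auto split: if_splits)
      have "dist (deriv (deriv g) u) (deriv (deriv g) r) < 2 * \<omega>"
        using u r s assms \<delta>(1) by (intro \<delta>(2)) (auto simp: dist_real_def)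
      then have "deriv (deriv g) u / 2 * s\<^sup>2 \<le> (deriv (deriv g) r / 2 + \<omega>) * s\<^sup>2"
        by (intro mult_right_mono) (auto simp: dist_real_def)
      moreover have "g (r + s) = g r + deriv g r * s + deriv (deriv g) u / 2 * s\<^sup>2"
        unfolding eq by (simp add: numeral_2_eq_2 diff_def)
      ultimately show ?thesis unfolding f by (simp add: algebra_simps)
    qed (simp)
  qed (use \<delta> assms in auto)
qed

text \<open>Nothing is known of \<open>g\<close> at nonpositive arguments; \<open>huber\<close> is
  positive, so an indicator can cut them off.\<close>

lemma borel_measurable_f_huber:
  assumes "d > 0"
  shows "(\<lambda>z :: 'a::euclidean_space. f (huber d z)) \<in> borel_measurable borel"
proof -
  have f: "f = (\<lambda>r. g (min r R) + deriv g R * (max r R - R))"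
    by (auto simp: f_def fun_eq_iff)
  have "continuous_on {0<..} g"
    by (auto intro!: continuous_at_imp_continuous_on continuous_g)
  then have "continuous_on {0<..} f"
    unfolding f using R_pos
    by (intro continuous_intros continuous_on_compose2[of "{0<..}" g _ "\<lambda>r. min r R"]) auto
  then have "(\<lambda>r. indicator {0<..} r *\<^sub>R f r) \<in> borel_measurable borel"
    by (intro borel_measurable_continuous_on_indicator) auto
  then have "(\<lambda>z :: 'a. indicator {0<..} (huber d z) *\<^sub>R f (huber d z)) \<in> borel_measurable borel"
    by (rule measurable_compose[rotated]) measurable
  then show ?thesis using huber_pos[OF assms, where 'a='a] by (simp add: indicator_def)
qed

lemma profile_exists:
  assumes "\<epsilon> > 0" "\<omega> > 0"
  obtains d k K s0 where "profile f f1 k g0' K d \<omega> s0" "s0 > 0"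
    "\<forall>z :: 'a::euclidean_space. (if norm z \<ge> 2 * d then k (norm z) else 0)
        - f1 (huber d z) * (norm z / max d (norm z) * ((\<alpha> * norm z - g (norm z)) / 4))
      \<le> - \<Lambda> * f (huber d z) + \<epsilon>"
proof -
  obtain \<eta> where \<eta>: "\<eta> > 0" "\<And>r. R - \<eta> < r \<Longrightarrow> 0 < r \<Longrightarrow> - f1 r * ((\<alpha> * r - g r) / 4) \<le> - \<Lambda> * f r + \<epsilon>"
    using drift_near_R[OF assms(1)] by blast
  \<comment> \<open>Closer to the diagonal than \<open>2 * d\<close> nothing contracts, but
    everything is small: the drift with the wrong sign is at most \<open>g0' * g0' * d / 2\<close>
    and the missing contraction at most \<open>2 * \<Lambda> * g0' * d\<close>. Their sum is
    \<open>d * c\<close>.\<close>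
  define c where "c = g0' * g0' / 2 + 2 * \<Lambda> * g0'"
  have c: "c > 0" unfolding c_def using g0'_pos \<Lambda>_nonneg by (intro add_pos_nonneg) auto
  define d where "d = \<epsilon> / c"
  have d: "d > 0" "d * c = \<epsilon>" using c assms by (auto simp: d_def)
  obtain s0 where s0: "s0 > 0" "\<And>r s. 2 * d \<le> r \<Longrightarrow> r \<le> R - \<eta> \<Longrightarrow> \<bar>s\<bar> \<le> s0 \<Longrightarrow>
      f (r + s) \<le> f r + f1 r * s + deriv (deriv g) r * s\<^sup>2 / 2 + \<omega> * s\<^sup>2"
    using second_order[of "2 * d" \<eta> \<omega>] d \<eta>(1) assms by auto
  \<comment> \<open>Near and beyond \<open>R\<close>, concavity gives the first-order bound with 0
    in place of the second derivative.\<close>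
  define k where "k r = (if r \<le> R - \<eta> then deriv (deriv g) r else 0)" for r
  have "continuous_on {2 * d..R} (deriv (deriv g))"
    using g_in d by (auto simp: calG_tilde_def calG_def C2_pos_def intro: continuous_on_subset)
  then have "bounded (deriv (deriv g) ` {2 * d..R})"
    by (intro compact_imp_bounded compact_continuous_image) auto
  then obtain K where K: "K > 0" "\<And>r. 2 * d \<le> r \<Longrightarrow> r \<le> R \<Longrightarrow> \<bar>deriv (deriv g) r\<bar> \<le> K"
    by (auto simp: bounded_pos)
  show thesis
  proof (rule that[of k K d "min s0 d"])
    show "profile f f1 k g0' K d \<omega> (min s0 d)"
    proof
      fix r assume r: "2 * d \<le> r"
      show "- K \<le> k r" using K(1) K(2)[OF r] \<eta>(1) by (auto simp: k_def abs_le_iff)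
      show "k r \<le> 0" using r d by (auto simp: k_def intro!: g''_nonpos)
    next
      fix r s assume r: "2 * d \<le> r" and s: "\<bar>s\<bar> \<le> min s0 d"
      show "f (r + s) \<le> f r + f1 r * s + k r * s\<^sup>2 / 2 + \<omega> * s\<^sup>2"
      proof (cases "r \<le> R - \<eta>")
        case True then show ?thesis using s0(2)[OF r True] s by (simp add: k_def)
      next
        case False
        have "f (r + s) \<le> f r + f1 r * (r + s - r)" using r s d by (intro f_tangent) auto
        moreover have "0 \<le> \<omega> * s\<^sup>2" using assms by simp
        ultimately show ?thesis using False by (simp add: k_def)
      qed
    qed (use d assms f_tangent f1_nonneg f1_le f_nonneg in auto)
    show "min s0 d > 0" using s0 d by simp
    show "\<forall>z :: 'a. (if norm z \<ge> 2 * d then k (norm z) else 0)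
        - f1 (huber d z) * (norm z / max d (norm z) * ((\<alpha> * norm z - g (norm z)) / 4))
      \<le> - \<Lambda> * f (huber d z) + \<epsilon>"
    proof
    fix z :: 'a
    define r where "r = norm z"
    show "(if norm z \<ge> 2 * d then k (norm z) else 0)
        - f1 (huber d z) * (norm z / max d (norm z) * ((\<alpha> * norm z - g (norm z)) / 4))
      \<le> - \<Lambda> * f (huber d z) + \<epsilon>"
    proof (cases "r \<ge> 2 * d")
      case True
      then have r: "r > 0" "r \<ge> d" using d by auto
      then have "huber d z = r" "max d r = r" by (auto simp: huber_def r_def)
      moreover have "k r - f1 r * ((\<alpha> * r - g r) / 4) \<le> - \<Lambda> * f r + \<epsilon>"
        using drift_within_R[OF r(1)] \<eta>(2)[of r] r \<eta>(1) assms(1) by (auto simp: k_def)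
      ultimately show ?thesis using True r by (simp add: r_def[symmetric])
    next
      case False
      define h where "h = huber d z"
      have h: "h > 0" "h \<le> 2 * d"
        using huber_pos[OF d(1), of z] huber_le_max[OF d(1), of z] False d by (auto simp: h_def r_def)
      have "\<Lambda> * f h \<le> \<Lambda> * (g0' * (2 * d))"
        using f_le[OF h(1)] h g0'_pos \<Lambda>_nonneg by (intro mult_left_mono order_trans[OF f_le]) auto
      moreover have "- (f1 h * (r / max d r * ((\<alpha> * r - g r) / 4))) \<le> g0' * (g0' * (2 * d) / 4)"
      proof (cases "r > 0")
        case True
        have "- (r / max d r * ((\<alpha> * r - g r) / 4)) \<le> r / max d r * (g r / 4)"
        proof -
          have "0 \<le> r / max d r * (\<alpha> * r / 4)" using True d \<alpha>_pos by auto
          then show ?thesis by (simp add: algebra_simps diff_divide_distrib)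
        qed
        also have "\<dots> \<le> 1 * (g r / 4)"
          using True d g_nonneg[OF True] by (intro mult_right_mono) (auto simp: divide_le_eq_1 less_max_iff_disj)
        also have "\<dots> \<le> g0' * (2 * d) / 4"
          using g_le[OF True] False g0'_pos by (simp add: order_trans[OF g_le[OF True]])
        finally have 1: "- (r / max d r * ((\<alpha> * r - g r) / 4)) \<le> g0' * (2 * d) / 4" .
        have "f1 h * - (r / max d r * ((\<alpha> * r - g r) / 4)) \<le> f1 h * (g0' * (2 * d) / 4)"
          using f1_nonneg[OF h(1)] 1 by (rule mult_left_mono[rotated])
        also have "\<dots> \<le> g0' * (g0' * (2 * d) / 4)"
          using f1_le[OF h(1)] g0'_pos d by (intro mult_right_mono) auto
        finally show ?thesis by simp
      next
        case False
        then have "r = 0" by (simp add: r_def)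
        then show ?thesis using g0'_pos d by simp
      qed
      moreover have "g0' * (g0' * (2 * d) / 4) + \<Lambda> * (g0' * (2 * d)) = \<epsilon>"
        unfolding d(2)[symmetric] c_def by (simp add: algebra_simps)
      ultimately have "- (f1 h * (r / max d r * ((\<alpha> * r - g r) / 4))) \<le> - \<Lambda> * f h + \<epsilon>" by linarith
      then show ?thesis using False unfolding r_def h_def by (simp only: if_False diff_0)
    qed
    qed
  qed
qed

end

section \<open>Integrability of the gradient and of the norm\<close>

lemma nn_integral_lborel_scale:
  fixes h :: "'a::euclidean_space \<Rightarrow> ennreal"
  assumes [measurable]: "h \<in> borel_measurable borel" and s: "s > 0"
  shows "(\<integral>\<^sup>+x. h x \<partial>lborel) = ennreal (s ^ DIM('a)) * (\<integral>\<^sup>+x. h (s *\<^sub>R x) \<partial>lborel)"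
  by (subst lborel_affine[of s "0::'a"])
     (use s in \<open>simp_all add: nn_integral_density nn_integral_distr nn_integral_cmult\<close>)

lemma has_integral_scaled_density:
  fixes V :: "'a::euclidean_space \<Rightarrow> real"
  assumes [measurable]: "V \<in> borel_measurable borel" and s: "s > 0"
    and prob: "prob_space (gibbs V)"
  shows "has_bochner_integral lborel (\<lambda>x. exp (- V (s *\<^sub>R x))) (1 / s ^ DIM('a))"
proof (rule has_bochner_integral_nn_integral)
  have "(\<integral>\<^sup>+x. ennreal (exp (- V x)) \<partial>lborel) = 1"
    using prob_space.emeasure_space_1[OF prob] by (simp add: emeasure_density)
  then have *: "ennreal (s ^ DIM('a)) * (\<integral>\<^sup>+x. ennreal (exp (- V (s *\<^sub>R x))) \<partial>lborel) = 1"
    using nn_integral_lborel_scale[of "\<lambda>x. ennreal (exp (- V x))" s] s by simp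
  have "ennreal (1 / s ^ DIM('a)) = ennreal (1 / s ^ DIM('a)) * (ennreal (s ^ DIM('a)) * (\<integral>\<^sup>+x. ennreal (exp (- V (s *\<^sub>R x))) \<partial>lborel))"
    by (simp add: *)
  also have "\<dots> = (\<integral>\<^sup>+x. ennreal (exp (- V (s *\<^sub>R x))) \<partial>lborel)"
    using s by (simp add: mult.assoc[symmetric] ennreal_mult'[symmetric] del: ennreal_1) simp
  finally show "(\<integral>\<^sup>+x. ennreal (exp (- V (s *\<^sub>R x))) \<partial>lborel) = ennreal (1 / s ^ DIM('a))" ..
qed (use s in auto)

text \<open>Integrating the radial derivative of the density would give \<open>DIM('a)\<close>; Fatou's lemma applied to
  the difference quotients of the dilations gives the inequality without integrating by parts.\<close>
lemma nn_integral_radial: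
  fixes V :: "'a::euclidean_space \<Rightarrow> real"
  assumes V: "C1_grad V G" and prob: "prob_space (gibbs V)"
    and lower: "\<And>x. - c \<le> G x \<bullet> x" and c: "0 \<le> c"
  shows "(\<integral>\<^sup>+x. ennreal (G x \<bullet> x + c) \<partial>gibbs V) \<le> ennreal (real DIM('a) + c)"
proof -
  note [measurable] = C1_grad_borel[OF V] C1_grad_borel_grad[OF V]
  define t where "t n = inverse (real (Suc n))" for n
  have t: "0 < t n" "t n \<le> 1" for n by (auto simp: t_def field_simps)
  \<comment> \<open>The term with \<open>c\<close> makes the difference quotient nonnegative, as
    Fatou's lemma requires.\<close>
  define Q where "Q n x = (exp (- V x) - exp (- V ((1 + t n) *\<^sub>R x))) / t n + c * exp (- V ((1 + t n) *\<^sub>R x))" for n x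
  have [measurable]: "Q n \<in> borel_measurable borel" for n unfolding Q_def by measurable
  have Q_nonneg: "0 \<le> Q n x" for n x
  proof -
    obtain s where s: "0 < s" "s < 1" "V (x + t n *\<^sub>R x) - V x = G (x + s *\<^sub>R (t n *\<^sub>R x)) \<bullet> (t n *\<^sub>R x)"
      by (rule C1_grad_mvt[OF V])
    define w where "w = (1 + s * t n) *\<^sub>R x"
    have st: "0 < s * t n" using s t by simp
    \<comment> \<open>The mean value theorem evaluates the gradient at \<open>w\<close>, a dilation
      of \<open>x\<close> by \<open>1 + s * t n\<close>. Dropping this factor is safe when the
      increment of \<open>V\<close> is negative; otherwise the bound is trivial.\<close>
    have "(1 + s * t n) * (V ((1 + t n) *\<^sub>R x) - V x) = t n * (G w \<bullet> w)"
      using s(3) by (simp add: w_def algebra_simps)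
    also have "\<dots> \<ge> t n * (- c)" using t[of n] lower by (intro mult_left_mono) auto
    finally have *: "- (c * t n) \<le> (1 + s * t n) * (V ((1 + t n) *\<^sub>R x) - V x)" by (simp add: mult.commute)
    have "- (c * t n) \<le> V ((1 + t n) *\<^sub>R x) - V x"
    proof (cases "V ((1 + t n) *\<^sub>R x) - V x \<ge> 0")
      case True then show ?thesis using c t[of n] by (smt (verit) mult_nonneg_nonneg)
    next
      case False
      then have "(1 + s * t n) * (V ((1 + t n) *\<^sub>R x) - V x) \<le> 1 * (V ((1 + t n) *\<^sub>R x) - V x)"
        using st by (intro mult_right_mono_neg) auto
      then show ?thesis using * by simp
    qed
    then have "1 - c * t n \<le> exp (V ((1 + t n) *\<^sub>R x) - V x)"
      using exp_ge_add_one_self[of "V ((1 + t n) *\<^sub>R x) - V x"] by linarith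
    then have "(1 - c * t n) * exp (- V ((1 + t n) *\<^sub>R x)) \<le> exp (V ((1 + t n) *\<^sub>R x) - V x) * exp (- V ((1 + t n) *\<^sub>R x))"
      by (intro mult_right_mono) auto
    also have "\<dots> = exp (- V x)" by (simp add: exp_add[symmetric])
    finally have "0 \<le> (exp (- V x) - exp (- V ((1 + t n) *\<^sub>R x)) + t n * (c * exp (- V ((1 + t n) *\<^sub>R x)))) / t n"
      using t[of n] by (intro divide_nonneg_pos) (simp_all add: algebra_simps)
    then show ?thesis using t[of n] by (simp add: Q_def add_divide_distrib)
  qed
  have Q_int: "(\<integral>\<^sup>+x. ennreal (Q n x) \<partial>lborel) \<le> ennreal (real DIM('a) + c)" for n
  proof -
    have p: "1 + t n > 0" using t[of n] by simp
    have "has_bochner_integral lborel (Q n)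
        ((1 - 1 / (1 + t n) ^ DIM('a)) / t n + c * (1 / (1 + t n) ^ DIM('a)))"
      unfolding Q_def
      using has_integral_scaled_density[OF _ _ prob, of 1] has_integral_scaled_density[OF _ p prob]
      by (intro has_bochner_integral_add has_bochner_integral_mult_right has_bochner_integral_divide_zero
            has_bochner_integral_diff) (use V in simp_all)
    then have "(\<integral>\<^sup>+x. ennreal (Q n x) \<partial>lborel) = ennreal ((1 - 1 / (1 + t n) ^ DIM('a)) / t n + c * (1 / (1 + t n) ^ DIM('a)))"
      using nn_integral_eq_integral[of lborel "Q n"] Q_nonneg
      by (simp add: has_bochner_integral_iff)
    also have "\<dots> \<le> ennreal (real DIM('a) + c)"
    proof (rule ennreal_leI, rule add_mono)
      have "- t n / (1 + t n) = 1 / (1 + t n) - 1" using p by (simp add: field_simps)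
      \<comment> \<open>Bernoulli's inequality at 1 / (1 + t) - 1 shows that the integrated
        difference quotient is at most the dimension.\<close>
      moreover have "1 + real DIM('a) * (- t n / (1 + t n)) \<le> (1 + - t n / (1 + t n)) ^ DIM('a)"
        using t[of n] by (intro Bernoulli_inequality) (simp add: field_simps)
      ultimately have "1 + real DIM('a) * (- t n / (1 + t n)) \<le> 1 / (1 + t n) ^ DIM('a)"
        by (simp add: power_one_over)
      then have "1 - 1 / (1 + t n) ^ DIM('a) \<le> real DIM('a) * (t n / (1 + t n))" by simp
      also have "\<dots> \<le> real DIM('a) * t n"
        using t[of n] by (intro mult_left_mono) (simp_all add: field_simps)
      finally show "(1 - 1 / (1 + t n) ^ DIM('a)) / t n \<le> real DIM('a)"
        using t[of n] by (simp add: field_simps)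
      have "1 / (1 + t n) ^ DIM('a) \<le> 1" using t[of n] by (simp add: one_le_power)
      then show "c * (1 / (1 + t n) ^ DIM('a)) \<le> c" using c by (intro mult_left_le)
    qed
    finally show ?thesis .
  qed
  have Q_lim: "(\<lambda>n. Q n x) \<longlonglongrightarrow> exp (- V x) * (G x \<bullet> x + c)" for x
  proof -
    have t_lim: "t \<longlonglongrightarrow> 0" unfolding t_def by (rule LIMSEQ_inverse_real_of_nat)
    then have t_at: "filterlim t (at 0) sequentially"
      using t by (auto simp: filterlim_at intro!: always_eventually) (metis less_irrefl)
    have "((\<lambda>s. V (x + s *\<^sub>R x)) has_derivative (\<lambda>h. G (x + 0 *\<^sub>R x) \<bullet> (h *\<^sub>R x))) (at 0)"
    proof (rule has_derivative_compose[of "\<lambda>s. x + s *\<^sub>R x" "\<lambda>h. h *\<^sub>R x" 0 UNIV V "\<lambda>h. G (x + 0 *\<^sub>R x) \<bullet> h"])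
      show "((\<lambda>s. x + s *\<^sub>R x) has_derivative (\<lambda>h. h *\<^sub>R x)) (at 0)"
        by (intro has_derivative_eq_rhs[OF has_derivative_add[OF has_derivative_const has_derivative_scaleR_left[OF has_derivative_ident]]]) simp
      show "(V has_derivative (\<lambda>h. G (x + 0 *\<^sub>R x) \<bullet> h)) (at (x + 0 *\<^sub>R x))"
        using V by (simp add: C1_grad_def)
    qed
    then have "((\<lambda>s. V (x + s *\<^sub>R x)) has_real_derivative (G x \<bullet> x)) (at 0)"
      unfolding has_field_derivative_def by (rule has_derivative_eq_rhs) (simp add: fun_eq_iff)
    then have "((\<lambda>s. exp (- V (x + s *\<^sub>R x))) has_real_derivative (- (exp (- V x) * (G x \<bullet> x)))) (at 0)"
      by (auto intro!: derivative_eq_intros)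
    then have "((\<lambda>h. (exp (- V (x + h *\<^sub>R x)) - exp (- V x)) / h) \<longlongrightarrow> - (exp (- V x) * (G x \<bullet> x))) (at 0)"
      by (simp add: DERIV_def)
    from filterlim_compose[OF this t_at]
    have "(\<lambda>n. - ((exp (- V (x + t n *\<^sub>R x)) - exp (- V x)) / t n)) \<longlonglongrightarrow> exp (- V x) * (G x \<bullet> x)"
      using tendsto_minus by fastforce
    moreover have "(\<lambda>n. c * exp (- V ((1 + t n) *\<^sub>R x))) \<longlonglongrightarrow> c * exp (- V ((1 + 0) *\<^sub>R x))"
    proof (intro tendsto_intros t_lim)
      have "isCont V ((1 + 0) *\<^sub>R x)"
        using C1_grad_continuous[OF V, of UNIV] by (simp add: continuous_on_eq_continuous_at)
      then show "(\<lambda>n. V ((1 + t n) *\<^sub>R x)) \<longlonglongrightarrow> V ((1 + 0) *\<^sub>R x)"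
        by (rule isCont_tendsto_compose) (intro tendsto_intros t_lim)
    qed
    ultimately have "(\<lambda>n. - ((exp (- V (x + t n *\<^sub>R x)) - exp (- V x)) / t n) + c * exp (- V ((1 + t n) *\<^sub>R x)))
        \<longlonglongrightarrow> exp (- V x) * (G x \<bullet> x) + c * exp (- V ((1 + 0) *\<^sub>R x))"
      by (rule tendsto_add)
    then show ?thesis
      by (simp add: Q_def[abs_def] algebra_simps minus_divide_left[symmetric] diff_divide_distrib)
  qed
  have "(\<integral>\<^sup>+x. ennreal (G x \<bullet> x + c) \<partial>gibbs V)
      = (\<integral>\<^sup>+x. ennreal (exp (- V x) * (G x \<bullet> x + c)) \<partial>lborel)"
    by (subst nn_integral_density) (auto simp: ennreal_mult')
  also have "\<dots> = (\<integral>\<^sup>+x. liminf (\<lambda>n. ennreal (Q n x)) \<partial>lborel)"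
    by (intro nn_integral_cong lim_imp_Liminf[symmetric] tendsto_ennrealI Q_lim) simp
  also have "\<dots> \<le> liminf (\<lambda>n. \<integral>\<^sup>+x. ennreal (Q n x) \<partial>lborel)"
    by (rule nn_integral_liminf) simp
  also have "\<dots> \<le> liminf (\<lambda>n. ennreal (real DIM('a) + c))"
    by (intro Liminf_mono always_eventually allI Q_int)
  also have "\<dots> = ennreal (real DIM('a) + c)" by (simp add: Liminf_const)
  finally show ?thesis .
qed

text \<open>The assumption bounds the radial part from below and \<open>nn_integral_radial\<close>
  bounds it from above in the mean; up to a constant it then dominates the norm.\<close>

lemma
  fixes V :: "'a::euclidean_space \<Rightarrow> real"
  assumes V: "C1_grad V G" and prob: "prob_space (gibbs V)"
    and lower: "\<And>x. norm x - c \<le> G x \<bullet> x"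
  defines "P \<equiv> gibbs V"
  shows integrable_radial: "integrable P (\<lambda>x. G x \<bullet> x)"
    and integrable_norm: "integrable P (\<lambda>x. norm x)"
proof -
  note [measurable] = C1_grad_borel[OF V] C1_grad_borel_grad[OF V]
  interpret prob_space P using prob by (simp add: P_def)
  have [measurable_cong]: "sets P = sets borel" by (simp add: P_def)
  have lower': "- \<bar>c\<bar> \<le> G x \<bullet> x" for x using lower[of x] norm_ge_zero[of x] by linarith
  have "integrable P (\<lambda>x. G x \<bullet> x + \<bar>c\<bar>)"
  proof (rule integrableI_bounded)
    have "(\<integral>\<^sup>+x. ennreal (norm (G x \<bullet> x + \<bar>c\<bar>)) \<partial>P) = (\<integral>\<^sup>+x. ennreal (G x \<bullet> x + \<bar>c\<bar>) \<partial>P)"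
      using lower' by (intro nn_integral_cong arg_cong[where f=ennreal]) (smt (verit) real_norm_def)
    also have "\<dots> \<le> ennreal (real DIM('a) + \<bar>c\<bar>)"
      unfolding P_def by (rule nn_integral_radial[OF V prob lower']) simp
    finally show "(\<integral>\<^sup>+x. ennreal (norm (G x \<bullet> x + \<bar>c\<bar>)) \<partial>P) < \<infinity>"
      by (rule order_le_less_trans) simp
  qed measurable
  then have "integrable P (\<lambda>x. (G x \<bullet> x + \<bar>c\<bar>) - \<bar>c\<bar>)" by (intro Bochner_Integration.integrable_diff) simp_all
  then show rad: "integrable P (\<lambda>x. G x \<bullet> x)" by simp
  show "integrable P (\<lambda>x. norm x)"
  proof (rule Bochner_Integration.integrable_bound)
    show "integrable P (\<lambda>x. G x \<bullet> x + c)" using rad by simp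
    show "AE x in P. norm (norm x) \<le> norm (G x \<bullet> x + c)"
    proof (rule AE_I2)
      fix x show "norm (norm x) \<le> norm (G x \<bullet> x + c)"
        using lower[of x] by (smt (verit) norm_ge_zero real_norm_def)
    qed
  qed measurable
qed

lemma quadratic_ge_linear:
  fixes a b r :: real
  assumes "a > 0"
  shows "a * r\<^sup>2 - b * r \<ge> r - (b + 1)\<^sup>2 / (4 * a)"
proof -
  have "0 \<le> (2 * a * r - (b + 1))\<^sup>2 / (4 * a)" using assms by simp
  also have "\<dots> = a * r\<^sup>2 - (b + 1) * r + (b + 1)\<^sup>2 / (4 * a)"
    using assms by (simp add: power2_eq_square field_simps)
  finally show ?thesis by (simp add: algebra_simps)
qed

lemma bounded_on_cball:
  fixes u :: "'a::euclidean_space \<Rightarrow> real"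
  assumes "continuous_on UNIV u"
  obtains B where "B > 0" "\<And>x. norm x \<le> r \<Longrightarrow> \<bar>u x\<bar> \<le> B"
proof -
  have "bounded (u ` cball 0 r)"
    using assms by (intro compact_imp_bounded compact_continuous_image) (auto intro: continuous_on_subset)
  then show thesis using that by (auto simp: bounded_pos)
qed

text \<open>This will make the cost of the product coupling finite. Outside a ball, \<open>G\<close>
  is controlled in the radial direction only, and from one side.\<close>

lemma integrable_norm_dissipative:
  fixes V :: "'a::euclidean_space \<Rightarrow> real"
  assumes V: "C1_grad V G" and prob: "prob_space (gibbs V)"
    and \<gamma>: "\<gamma> > 0" and drift: "\<And>x. norm x \<ge> r \<Longrightarrow> - (1/2) * (G x \<bullet> x) \<le> - \<gamma> * (norm x)\<^sup>2"
  shows "integrable (gibbs V) (\<lambda>x. norm x)"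
proof -
  have "continuous_on UNIV (\<lambda>x. norm x - G x \<bullet> x)"
    using V by (intro continuous_intros) (simp add: C1_grad_def)
  then obtain B where B: "B > 0" "\<And>x. norm x \<le> r \<Longrightarrow> \<bar>norm x - G x \<bullet> x\<bar> \<le> B"
    using bounded_on_cball[where r=r] by blast
  have "norm x - max B (1 / (8 * \<gamma>)) \<le> G x \<bullet> x" for x
  proof (cases "norm x \<le> r")
    case True then show ?thesis using B(2)[of x] by linarith
  next
    case False
    then have "2 * \<gamma> * (norm x)\<^sup>2 \<le> G x \<bullet> x" using drift[of x] by simp
    moreover have "norm x - 1 / (8 * \<gamma>) \<le> 2 * \<gamma> * (norm x)\<^sup>2"
      using quadratic_ge_linear[of "2 * \<gamma>" "norm x" 0] \<gamma> by simp
    ultimately show ?thesis by linarith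
  qed
  then show ?thesis by (rule integrable_norm[OF V prob])
qed

section \<open>Consequences of the lower bound on kappa: approximate monotonicity and
  integrability\<close>

context tilde_g
begin

lemma kappa_inner:
  assumes "\<forall>r>0. kappa G r \<ge> ereal (\<alpha> - g r / r)" and "x \<noteq> y"
  shows "(G x - G y) \<bullet> (x - y) \<ge> \<alpha> * (norm (x - y))\<^sup>2 - g (norm (x - y)) * norm (x - y)"
proof -
  define r where "r = norm (x - y)"
  have r: "r > 0" using assms by (simp add: r_def)
  have "ereal (\<alpha> - g r / r) \<le> kappa G r" using assms r by blast
  also have "kappa G r \<le> ereal (((G x - G y) \<bullet> (x - y)) / r\<^sup>2)"
    unfolding kappa_def by (rule INF_lower2[of "(x, y)"]) (auto simp: r_def)
  finally have "(\<alpha> - g r / r) * r\<^sup>2 \<le> (G x - G y) \<bullet> (x - y)"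
    using r by (simp add: pos_le_divide_eq)
  moreover have "(\<alpha> - g r / r) * r\<^sup>2 = \<alpha> * r\<^sup>2 - g r * r"
    using r by (simp add: left_diff_distrib power2_eq_square)
  ultimately show ?thesis by (simp add: r_def)
qed

lemma kappa_inner_N:
  assumes "\<forall>r>0. kappa G r \<ge> ereal (\<alpha> - g r / r)"
  shows "(G x - G y) \<bullet> (x - y) \<ge> \<alpha> * (norm (x - y))\<^sup>2 - N * norm (x - y)"
proof (cases "x = y")
  case False
  then have "g (norm (x - y)) * norm (x - y) \<le> N * norm (x - y)"
    by (intro mult_right_mono g_le_N) auto
  then show ?thesis using kappa_inner[OF assms False] by linarith
qed simp

lemma kappa_integrable:
  fixes V :: "'a::euclidean_space \<Rightarrow> real"
  assumes V: "C1_grad V G" and prob: "prob_space (gibbs V)"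
    and \<kappa>: "\<forall>r>0. kappa G r \<ge> ereal (\<alpha> - g r / r)"
  defines "P \<equiv> gibbs V"
  shows kappa_integrable_norm: "integrable P (\<lambda>x. norm x)"
    and kappa_integrable_grad: "integrable P (\<lambda>x. norm (G x))"
proof -
  note [measurable] = C1_grad_borel[OF V] C1_grad_borel_grad[OF V]
  interpret prob_space P using prob by (simp add: P_def)
  have [measurable_cong]: "sets P = sets borel" by (simp add: P_def)
  define c where "c = (N + norm (G 0) + 1)\<^sup>2 / (4 * \<alpha>)"
  have lower: "norm x - c \<le> G x \<bullet> x" for x
  proof -
    have "\<alpha> * (norm x)\<^sup>2 - N * norm x \<le> (G x - G 0) \<bullet> x" using kappa_inner_N[OF \<kappa>, of x 0] by simp
    moreover have "- (norm (G 0) * norm x) \<le> G 0 \<bullet> x"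
      using Cauchy_Schwarz_ineq2[of "G 0" x] by (simp add: abs_le_iff)
    moreover have "norm x - c \<le> \<alpha> * (norm x)\<^sup>2 - (N + norm (G 0)) * norm x"
      using quadratic_ge_linear[OF \<alpha>_pos, of "norm x" "N + norm (G 0)"] by (simp add: c_def)
    ultimately show ?thesis by (simp add: inner_diff_left algebra_simps)
  qed
  have rad: "integrable P (\<lambda>x. G x \<bullet> x)" and nrm: "integrable P (\<lambda>x. norm x)"
    unfolding P_def by (rule integrable_radial[OF V prob lower], rule integrable_norm[OF V prob lower])
  show "integrable P (\<lambda>x. norm x)" by (rule nrm)
  have "continuous_on UNIV (\<lambda>x. norm (G x))"
    using V by (intro continuous_intros) (simp add: C1_grad_def)
  then obtain M where M: "M > 0" "\<And>x. norm x \<le> 1 \<Longrightarrow> \<bar>norm (G x)\<bar> \<le> M"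
    using bounded_on_cball[where r=1] by blast
  text \<open>Monotonicity up to a bounded error, tested against the unit vector \<open>y\<close> in the direction of
    the gradient, bounds the gradient by its radial part.\<close>
  have bound: "norm (G x) \<le> G x \<bullet> x + (M + N) * (norm x + 1)" for x
  proof -
    \<comment> \<open>For \<open>G x = 0\<close> this is 0, and the identity
      \<open>G x \<bullet> y = norm (G x)\<close> persists.\<close>
    define y where "y = G x /\<^sub>R norm (G x)"
    have y: "norm y \<le> 1" by (simp add: y_def sgn_div_norm[symmetric] norm_sgn)
    have Gy: "G x \<bullet> y = norm (G x)"
    proof -
      have "G x \<bullet> y = (G x \<bullet> G x) / norm (G x)" by (simp add: y_def divide_inverse mult.commute)
      then show ?thesis by (simp add: power2_norm_eq_inner[symmetric] power2_eq_square)
    qed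
    have n: "norm (x - y) \<le> norm x + 1" using norm_triangle_ineq4[of x y] y by linarith
    have "- (N * norm (x - y)) \<le> (G x - G y) \<bullet> (x - y)"
    proof -
      have "0 \<le> \<alpha> * (norm (x - y))\<^sup>2" using \<alpha>_pos by simp
      then show ?thesis using kappa_inner_N[OF \<kappa>, of x y] by linarith
    qed
    moreover have "- (M * norm (x - y)) \<le> G y \<bullet> (x - y)"
    proof -
      have "norm (G y) * norm (x - y) \<le> M * norm (x - y)" using M(2)[OF y] by (intro mult_right_mono) auto
      then show ?thesis using Cauchy_Schwarz_ineq2[of "G y" "x - y"] by linarith
    qed
    ultimately have "- ((M + N) * norm (x - y)) \<le> G x \<bullet> x - norm (G x)"
      by (simp add: inner_diff_left inner_diff_right Gy algebra_simps)
    moreover have "(M + N) * norm (x - y) \<le> (M + N) * (norm x + 1)"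
      using n M(1) N_pos by (intro mult_left_mono) auto
    ultimately show ?thesis by linarith
  qed
  show "integrable P (\<lambda>x. norm (G x))"
  proof (rule Bochner_Integration.integrable_bound)
    show "integrable P (\<lambda>x. G x \<bullet> x + (M + N) * (norm x + 1))" using rad nrm by simp
    show "AE x in P. norm (norm (G x)) \<le> norm (G x \<bullet> x + (M + N) * (norm x + 1))"
    proof (rule AE_I2)
      fix x show "norm (norm (G x)) \<le> norm (G x \<bullet> x + (M + N) * (norm x + 1))"
        using order_trans[OF bound abs_ge_self] by simp
    qed
  qed measurable
qed

end

section \<open>Cutoff functions\<close>

text \<open>The positive part is squared to be differentiable across the sphere, and the squared
  norm keeps the origin smooth; the gradient is of order 1 / r. At \<open>r = 0\<close> division by
  zero gives the constant 1.\<close>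

definition cutoff :: "real \<Rightarrow> 'a::euclidean_space \<Rightarrow> real" where
  "cutoff r x = (max 0 (1 - (norm x)\<^sup>2 / r\<^sup>2))\<^sup>2"

definition cutoff_grad :: "real \<Rightarrow> 'a::euclidean_space \<Rightarrow> 'a" where
  "cutoff_grad r x = (- 4 * max 0 (1 - (norm x)\<^sup>2 / r\<^sup>2) / r\<^sup>2) *\<^sub>R x"

lemma DERIV_pos_part_sq: "((\<lambda>s::real. (max 0 s)\<^sup>2) has_real_derivative 2 * max 0 s) (at s)"
proof (cases s "0 :: real" rule: linorder_cases)
  case less
  have "((\<lambda>s::real. 0) has_real_derivative 2 * max 0 s) (at s)" using less by simp
  then show ?thesis
    by (rule has_field_derivative_transform_within_open[of _ _ _ "{..<0}"]) (use less in auto)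
next
  case equal
  have "((\<lambda>h::real. ((max 0 h)\<^sup>2) / h) \<longlongrightarrow> 0) (at 0)"
  proof (rule Lim_null_comparison)
    show "((\<lambda>h. \<bar>h\<bar>) \<longlongrightarrow> (0::real)) (at 0)" by (rule tendsto_eq_intros refl | simp)+
    show "\<forall>\<^sub>F h in at 0. norm ((max 0 h)\<^sup>2 / h) \<le> \<bar>h\<bar>"
      by (rule always_eventually) (auto simp: max_def power2_eq_square)
  qed
  then show ?thesis using equal by (simp add: DERIV_def)
next
  case greater
  have "((\<lambda>s::real. s\<^sup>2) has_real_derivative 2 * max 0 s) (at s)"
    using greater by (auto intro!: derivative_eq_intros)
  then show ?thesis
    by (rule has_field_derivative_transform_within_open[of _ _ _ "{0<..}"]) (use greater in auto)
qed

lemma C1_grad_cutoff: "C1_grad (cutoff r) (cutoff_grad r :: 'a::euclidean_space \<Rightarrow> 'a)"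
  unfolding C1_grad_def
proof (intro conjI allI)
  fix x :: 'a
  have "((\<lambda>x. x \<bullet> x) has_derivative (\<lambda>h. x \<bullet> h + h \<bullet> x)) (at x)"
    by (rule has_derivative_inner[OF has_derivative_ident has_derivative_ident])
  then have n: "((\<lambda>x. (norm x)\<^sup>2) has_derivative (\<lambda>h. 2 * (x \<bullet> h))) (at x)"
    by (simp add: power2_norm_eq_inner inner_commute)
  have "((\<lambda>x. 1 - (norm x)\<^sup>2 / r\<^sup>2) has_derivative (\<lambda>h. - (2 * (x \<bullet> h) / r\<^sup>2))) (at x)"
    using has_derivative_diff[OF has_derivative_const has_derivative_mult_right[OF n, of "inverse (r\<^sup>2)"], of 1]
    by (simp add: divide_inverse mult.commute)
  from has_derivative_compose[OF this DERIV_pos_part_sq[unfolded has_field_derivative_def]]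
  show "(cutoff r has_derivative (\<lambda>h. cutoff_grad r x \<bullet> h)) (at x)"
    unfolding cutoff_def[abs_def] cutoff_grad_def
    by (rule has_derivative_eq_rhs) (simp add: fun_eq_iff)
next
  show "continuous_on UNIV (cutoff_grad r :: 'a \<Rightarrow> 'a)"
    unfolding cutoff_grad_def[abs_def] divide_inverse by (intro continuous_intros)
qed

lemma cutoff_nonneg: "0 \<le> cutoff r x" and cutoff_le_1: "cutoff r x \<le> 1"
  by (auto simp: cutoff_def abs_square_le_1 max_def)

lemma cutoff_sq_le_1: "(cutoff r x)\<^sup>2 \<le> 1"
  using cutoff_nonneg[of r x] cutoff_le_1[of r x] by (simp add: abs_square_le_1)

lemma cutoff_eq_0:
  assumes "r > 0" "norm x \<ge> r" shows "cutoff r x = 0"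
proof -
  have "r\<^sup>2 \<le> (norm x)\<^sup>2" using assms by (intro power_mono) auto
  then show ?thesis using assms by (simp add: cutoff_def)
qed

lemma norm_cutoff_grad_le:
  assumes "r > 0" shows "norm (cutoff_grad r x) \<le> 4 / r"
proof (cases "norm x \<ge> r")
  case True
  then have "r\<^sup>2 \<le> (norm x)\<^sup>2" using assms by (intro power_mono) auto
  then show ?thesis using assms by (simp add: cutoff_grad_def)
next
  case False
  have "norm (cutoff_grad r x) = 4 * max 0 (1 - (norm x)\<^sup>2 / r\<^sup>2) / r\<^sup>2 * norm x"
    by (simp add: cutoff_grad_def abs_mult)
  also have "\<dots> \<le> 4 * 1 / r\<^sup>2 * r"
    using False assms by (intro mult_mono divide_right_mono mult_left_mono) auto
  also have "\<dots> = 4 / r" by (simp add: power2_eq_square)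
  finally show ?thesis .
qed

lemma cutoff_tendsto: "(\<lambda>n. cutoff (real n) x) \<longlonglongrightarrow> 1"
proof -
  have "(\<lambda>n. (norm x)\<^sup>2 * inverse ((real n)\<^sup>2)) \<longlonglongrightarrow> (norm x)\<^sup>2 * 0"
    by (intro tendsto_intros tendsto_inverse_0_at_top filterlim_pow_at_top filterlim_real_sequentially) simp
  then have "(\<lambda>n. (max 0 (1 - (norm x)\<^sup>2 / (real n)\<^sup>2))\<^sup>2) \<longlonglongrightarrow> (max 0 (1 - 0))\<^sup>2"
    by (intro tendsto_intros) (simp add: divide_inverse)
  then show ?thesis by (simp add: cutoff_def)
qed

lemma integral_cutoff_tendsto:
  fixes u :: "'a::euclidean_space \<Rightarrow> real"
  assumes "integrable P u" "sets P = sets borel"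
  shows "(\<lambda>n. \<integral>x. (1 - (cutoff (real n) x)\<^sup>2) * u x \<partial>P) \<longlonglongrightarrow> 0"
proof -
  have [measurable]: "cutoff r \<in> borel_measurable P" for r
    using assms(2) C1_grad_borel[OF C1_grad_cutoff[of r]] by (simp cong: measurable_cong_sets)
  have [measurable]: "u \<in> borel_measurable P" using assms by auto
  have "(\<lambda>n. \<integral>x. (1 - (cutoff (real n) x)\<^sup>2) * u x \<partial>P) \<longlonglongrightarrow> (\<integral>x. 0 \<partial>P)"
  proof (rule integral_dominated_convergence[where w="\<lambda>x. \<bar>u x\<bar>"])
    show "AE x in P. (\<lambda>n. (1 - (cutoff (real n) x)\<^sup>2) * u x) \<longlonglongrightarrow> 0"
    proof (rule AE_I2)
      fix x
      have "(\<lambda>n. (1 - (cutoff (real n) x)\<^sup>2) * u x) \<longlonglongrightarrow> (1 - 1\<^sup>2) * u x"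
        by (intro tendsto_intros cutoff_tendsto)
      then show "(\<lambda>n. (1 - (cutoff (real n) x)\<^sup>2) * u x) \<longlonglongrightarrow> 0" by simp
    qed
    show "AE x in P. norm ((1 - (cutoff (real n) x)\<^sup>2) * u x) \<le> \<bar>u x\<bar>" for n
      using cutoff_sq_le_1[where 'a='a, of "real n"] by (intro AE_I2) (auto simp: abs_mult intro!: mult_left_le_one_le)
  qed (use assms in \<open>auto intro: integrable_abs\<close>)
  then show ?thesis by simp
qed

lemma integral_excess_tendsto:
  fixes u :: "'a \<Rightarrow> real"
  assumes "integrable P u"
  shows "(\<lambda>n. \<integral>x. max 0 (u x - real n) \<partial>P) \<longlonglongrightarrow> 0"
proof -
  have [measurable]: "u \<in> borel_measurable P" using assms by auto
  have "(\<lambda>n. \<integral>x. max 0 (u x - real n) \<partial>P) \<longlonglongrightarrow> (\<integral>x. 0 \<partial>P)"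
  proof (rule integral_dominated_convergence[where w="\<lambda>x. \<bar>u x\<bar>"])
    show "AE x in P. (\<lambda>n. max 0 (u x - real n)) \<longlonglongrightarrow> 0"
    proof (rule AE_I2)
      fix x
      obtain m :: nat where "u x \<le> real m" using real_arch_simple by blast
      then have "\<forall>\<^sub>F n in sequentially. max 0 (u x - real n) = 0"
        by (intro eventually_sequentiallyI[of m]) auto
      then show "(\<lambda>n. max 0 (u x - real n)) \<longlonglongrightarrow> 0" by (rule tendsto_eventually)
    qed
  qed (use assms in \<open>auto intro: integrable_abs\<close>)
  then show ?thesis by simp
qed

section \<open>Contraction of the transport cost\<close>

lemma tendsto_0_eventually_le:
  fixes X :: "nat \<Rightarrow> real"
  assumes "X \<longlonglongrightarrow> 0" "\<epsilon> > 0"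
  shows "\<forall>\<^sub>F n in sequentially. X n \<le> \<epsilon>"
  using order_tendstoD(2)[OF assms(1), of \<epsilon>] assms(2) by (auto elim: eventually_mono)

text \<open>For products such as \<open>(1 - (\<psi> y)\<^sup>2) * norm (Gp x)\<close>: they mix the
  two points, so the marginals do not determine their integral against an unknown coupling.
  Truncation at level \<open>n\<close> replaces them by a function of \<open>y\<close> plus a
  function of \<open>x\<close>.\<close>

lemma mult_le_add_excess:
  fixes a s n :: real
  assumes "0 \<le> s" "s \<le> 1" "0 \<le> n"
  shows "s * a \<le> n * s + max 0 (a - n)"
proof -
  have "s * (a - n) \<le> 1 * max 0 (a - n)"
    using assms by (cases "a \<ge> n") (auto simp: mult_nonneg_nonpos mult_left_le_one_le max_def)
  then show ?thesis by (simp add: algebra_simps)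
qed

lemma coupling_pair_measure:
  assumes "prob_space M" "prob_space N'" "sets M = sets borel" "sets N' = sets borel"
  shows "coupling M N' (M \<Otimes>\<^sub>M N')"
proof (rule couplingI)
  interpret M: prob_space M by fact
  interpret N: prob_space N' by fact
  interpret pair_sigma_finite M N' ..
  show "sets (M \<Otimes>\<^sub>M N') = sets (borel \<Otimes>\<^sub>M borel)" by (rule sets_pair_measure_cong) fact+
  fix A :: "'a set" assume "A \<in> sets borel"
  then have [measurable]: "A \<in> sets M" "A \<in> sets N'" by (simp_all add: assms)
  show "(\<integral>\<^sup>+z. indicator A (fst z) \<partial>(M \<Otimes>\<^sub>M N')) = (\<integral>\<^sup>+x. indicator A x \<partial>M)"
    by (subst N.nn_integral_fst[symmetric]) (simp_all add: N.emeasure_space_1 del: nn_integral_indicator)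
  show "(\<integral>\<^sup>+z. indicator A (snd z) \<partial>(M \<Otimes>\<^sub>M N')) = (\<integral>\<^sup>+x. indicator A x \<partial>N')"
    by (subst N.nn_integral_fst[symmetric]) (simp_all add: M.emeasure_space_1 del: nn_integral_indicator)
qed fact+

text \<open>A near-minimizer suffices. One finite value is essential, because the infimum gets
  subtracted from both sides.\<close>

lemma INF_contraction:
  fixes J :: "'b \<Rightarrow> ennreal"
  assumes step: "\<And>x. x \<in> X \<Longrightarrow> (INF x\<in>X. J x) \<le> ennreal (1 - a) * J x + ennreal b"
    and fin: "x0 \<in> X" "J x0 < \<infinity>" and a: "0 \<le> a" "a \<le> 1" and b: "0 \<le> b"
  shows "ennreal a * (INF x\<in>X. J x) \<le> ennreal b"
proof -
  define I where "I = (INF x\<in>X. J x)"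
  have "I \<le> J x0" unfolding I_def using fin by (intro INF_lower)
  then have "I < \<infinity>" using fin(2) by (rule order_le_less_trans)
  then obtain i where i: "I = ennreal i" "0 \<le> i" by (cases I) auto
  have "i \<le> (1 - a) * i + b"
  proof (rule field_le_epsilon)
    fix e :: real assume "e > 0"
    then have "I < ennreal (i + e)" using i by (simp add: ennreal_less_iff)
    then obtain x where x: "x \<in> X" "J x < ennreal (i + e)" unfolding I_def by (auto simp: INF_less_iff)
    have "ennreal i \<le> ennreal (1 - a) * J x + ennreal b" using step[OF x(1)] by (simp add: I_def[symmetric] i)
    also have "\<dots> \<le> ennreal (1 - a) * ennreal (i + e) + ennreal b"
      using x by (intro add_right_mono mult_left_mono) auto
    also have "\<dots> = ennreal ((1 - a) * (i + e) + b)"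
    proof -
      have "ennreal (1 - a) * ennreal (i + e) = ennreal ((1 - a) * (i + e))"
        using a by (intro ennreal_mult'[symmetric]) simp
      moreover have "0 \<le> (1 - a) * (i + e)" using a i \<open>e > 0\<close> by simp
      ultimately show ?thesis using b by (simp only: ennreal_plus)
    qed
    finally have "i \<le> (1 - a) * (i + e) + b"
      using a b i \<open>e > 0\<close> by (subst (asm) ennreal_le_iff) auto
    also have "\<dots> \<le> (1 - a) * i + b + e"
      using a \<open>e > 0\<close> by (simp add: algebra_simps)
    finally show "i \<le> (1 - a) * i + b + e" .
  qed
  then have "a * i \<le> b" by (simp add: algebra_simps)
  then show ?thesis
    unfolding I_def[symmetric] i(1) using a by (simp add: ennreal_mult'[symmetric] ennreal_leI)
qed

section \<open>Drift of the coupled pair, choice of the parameters, transport estimate\<close>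

context tilde_g
begin

text \<open>Every error term carries a cutoff deficit, at \<open>x\<close> or at \<open>y\<close>,
  or the small gradient of the cutoff. \<open>Gq\<close> occurs only in its difference from
  \<open>Gp\<close> at the same point.\<close>

lemma drift_estimate:
  fixes x y :: "'a::euclidean_space"
  assumes \<kappa>: "\<forall>r>0. kappa Gp r \<ge> ereal (\<alpha> - g r / r)" and d: "d > 0"
    and \<psi>: "\<And>x. 0 \<le> \<psi> x" "\<And>x. \<psi> x \<le> 1" and D\<psi>: "\<And>x. norm (D\<psi> x) \<le> \<epsilon>"
  defines "z \<equiv> x - y"
  shows "f1 (huber d z) / max d (norm z) * ((half_drift \<psi> D\<psi> Gp x - half_drift \<psi> D\<psi> Gq y) \<bullet> z)
    \<le> - (f1 (huber d z) * (norm z / max d (norm z) * ((\<alpha> * norm z - g (norm z)) / 4)))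
      + g0' / 4 * norm (Gp y - Gq y) + g0' * \<epsilon>
      + g0' / 4 * (((1 - (\<psi> x)\<^sup>2) + (1 - (\<psi> y)\<^sup>2)) * norm (Gp x) + \<alpha> * ((1 - (\<psi> y)\<^sup>2) * (norm x + norm y)))"
proof -
  define F where "F = f1 (huber d z)"
  define c where "c = max d (norm z)"
  \<comment> \<open>A unit vector at distance at least \<open>d\<close>, shorter below.\<close>
  define w where "w = z /\<^sub>R c"
  define s1 where "s1 = (\<psi> x)\<^sup>2"
  define s2 where "s2 = (\<psi> y)\<^sup>2"
  define D where "D = norm z / c * (\<alpha> * norm z - g (norm z))"
  have c: "c > 0" "norm z \<le> c" using d by (auto simp: c_def)
  have F: "0 \<le> F" "F \<le> g0'" unfolding F_def by (auto intro!: f1_nonneg f1_le huber_pos d)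
  have w: "norm w \<le> 1" using c by (simp add: w_def field_simps)
  have wle: "\<bar>v \<bullet> w\<bar> \<le> norm v" for v
    using Cauchy_Schwarz_ineq2[of v w] w by (smt (verit) mult_left_le norm_ge_zero)
  have s: "0 \<le> s1" "s1 \<le> 1" "0 \<le> s2" "s2 \<le> 1"
    using \<psi> by (auto simp: s1_def s2_def abs_square_le_1)
  have mono: "D \<le> (Gp x - Gp y) \<bullet> w"
  proof (cases "x = y")
    case False
    then have "(\<alpha> * (norm z)\<^sup>2 - g (norm z) * norm z) / c \<le> ((Gp x - Gp y) \<bullet> z) / c"
      using kappa_inner[OF \<kappa> False] c by (intro divide_right_mono) (auto simp: z_def)
    then show ?thesis by (simp add: D_def w_def power2_eq_square algebra_simps divide_inverse)
  qed (simp add: D_def z_def w_def)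
  \<comment> \<open>The gain \<open>D\<close> from monotonicity is weighted with the squared cutoff
    at \<open>y\<close>; this bounds what the missing weight \<open>1 - s2\<close> costs.\<close>
  have D_le: "D \<le> \<alpha> * (norm x + norm y)"
  proof (cases "z = 0")
    case False
    have "D \<le> 1 * (\<alpha> * norm z)"
      unfolding D_def
    proof (rule order_trans[OF mult_left_mono])
      show "\<alpha> * norm z - g (norm z) \<le> \<alpha> * norm z" using g_nonneg[of "norm z"] False by simp
      show "norm z / c * (\<alpha> * norm z) \<le> 1 * (\<alpha> * norm z)"
        using c \<alpha>_pos by (intro mult_right_mono) auto
    qed (use c in simp)
    also have "\<dots> \<le> \<alpha> * (norm x + norm y)"
      using \<alpha>_pos by (simp add: z_def norm_triangle_ineq4)
    finally show ?thesis .
  qed (use \<alpha>_pos in \<open>simp add: D_def\<close>)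
  \<comment> \<open>The gradients telescope through \<open>Gp y\<close> with the common weight
    \<open>s2\<close>; the mismatch of the weights falls on \<open>Gp x\<close>, whose norm is
    integrable, and not on \<open>Gq y\<close>.\<close>
  have "(half_drift \<psi> D\<psi> Gp x - half_drift \<psi> D\<psi> Gq y) \<bullet> w
      = (\<psi> x / 2) * (D\<psi> x \<bullet> w) - (\<psi> y / 2) * (D\<psi> y \<bullet> w)
        + (- s2 * ((Gp x - Gp y) \<bullet> w) - s2 * ((Gp y - Gq y) \<bullet> w) + (s2 - s1) * (Gp x \<bullet> w)) / 4"
    by (simp add: half_drift_def s1_def s2_def inner_diff_left algebra_simps diff_divide_distrib add_divide_distrib)
  also have "\<dots> \<le> \<epsilon> / 2 + \<epsilon> / 2 + ((- D + (1 - s2) * (\<alpha> * (norm x + norm y))) + norm (Gp y - Gq y)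
        + ((1 - s1) + (1 - s2)) * norm (Gp x)) / 4"
  proof (rule add_mono[OF _ divide_right_mono])
    have half: "\<psi> u / 2 * \<bar>D\<psi> u \<bullet> w\<bar> \<le> \<epsilon> / 2" for u
    proof -
      have "\<psi> u * \<bar>D\<psi> u \<bullet> w\<bar> \<le> 1 * \<epsilon>"
        using \<psi>[of u] D\<psi>[of u] wle[of "D\<psi> u"] by (intro mult_mono) auto
      then show ?thesis by simp
    qed
    have half': "\<bar>\<psi> u / 2 * (D\<psi> u \<bullet> w)\<bar> \<le> \<epsilon> / 2" for u
      using half[of u] \<psi>(1)[of u] by (simp add: abs_mult)
    show "(\<psi> x / 2) * (D\<psi> x \<bullet> w) - (\<psi> y / 2) * (D\<psi> y \<bullet> w) \<le> \<epsilon> / 2 + \<epsilon> / 2"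
      using half'[of x] half'[of y] by (simp add: abs_le_iff)
    have 1: "- s2 * ((Gp x - Gp y) \<bullet> w) \<le> - D + (1 - s2) * (\<alpha> * (norm x + norm y))"
    proof -
      have "s2 * D \<le> s2 * ((Gp x - Gp y) \<bullet> w)" using mono s by (intro mult_left_mono)
      moreover have "(1 - s2) * D \<le> (1 - s2) * (\<alpha> * (norm x + norm y))" using D_le s by (intro mult_left_mono) auto
      ultimately show ?thesis by (simp add: algebra_simps)
    qed
    have 2: "- s2 * ((Gp y - Gq y) \<bullet> w) \<le> norm (Gp y - Gq y)"
    proof -
      have "s2 * \<bar>(Gp y - Gq y) \<bullet> w\<bar> \<le> 1 * norm (Gp y - Gq y)" using s wle by (intro mult_mono) auto
      moreover have "- s2 * ((Gp y - Gq y) \<bullet> w) \<le> \<bar>s2 * ((Gp y - Gq y) \<bullet> w)\<bar>" by simp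
      ultimately show ?thesis using s by (simp add: abs_mult)
    qed
    have 3: "(s2 - s1) * (Gp x \<bullet> w) \<le> ((1 - s1) + (1 - s2)) * norm (Gp x)"
    proof -
      have "(s2 - s1) * (Gp x \<bullet> w) \<le> \<bar>s2 - s1\<bar> * \<bar>Gp x \<bullet> w\<bar>" by (simp add: abs_mult[symmetric])
      also have "\<dots> \<le> ((1 - s1) + (1 - s2)) * norm (Gp x)" using s wle by (intro mult_mono) auto
      finally show ?thesis .
    qed
    show "- s2 * ((Gp x - Gp y) \<bullet> w) - s2 * ((Gp y - Gq y) \<bullet> w) + (s2 - s1) * (Gp x \<bullet> w)
      \<le> (- D + (1 - s2) * (\<alpha> * (norm x + norm y))) + norm (Gp y - Gq y) + ((1 - s1) + (1 - s2)) * norm (Gp x)"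
      using 1 2 3 by linarith
  qed simp
  finally have "F * ((half_drift \<psi> D\<psi> Gp x - half_drift \<psi> D\<psi> Gq y) \<bullet> w)
      \<le> F * (\<epsilon> / 2 + \<epsilon> / 2 + ((- D + (1 - s2) * (\<alpha> * (norm x + norm y))) + norm (Gp y - Gq y)
        + ((1 - s1) + (1 - s2)) * norm (Gp x)) / 4)"
    using F by (intro mult_left_mono)
  also have "\<dots> = - (F * (D / 4)) + F * (\<epsilon> + (norm (Gp y - Gq y) + ((1 - s1) + (1 - s2)) * norm (Gp x)
      + (1 - s2) * (\<alpha> * (norm x + norm y))) / 4)"
    by (simp add: algebra_simps add_divide_distrib diff_divide_distrib)
  also have "F * (\<epsilon> + (norm (Gp y - Gq y) + ((1 - s1) + (1 - s2)) * norm (Gp x)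
      + (1 - s2) * (\<alpha> * (norm x + norm y))) / 4)
    \<le> g0' * (\<epsilon> + (norm (Gp y - Gq y) + ((1 - s1) + (1 - s2)) * norm (Gp x)
      + (1 - s2) * (\<alpha> * (norm x + norm y))) / 4)"
    using F s \<alpha>_pos order_trans[OF norm_ge_zero D\<psi>] by (intro mult_right_mono add_nonneg_nonneg divide_nonneg_pos mult_nonneg_nonneg) auto
  finally have main: "F * ((half_drift \<psi> D\<psi> Gp x - half_drift \<psi> D\<psi> Gq y) \<bullet> w)
    \<le> - (F * (D / 4)) + g0' * (\<epsilon> + (norm (Gp y - Gq y) + ((1 - s1) + (1 - s2)) * norm (Gp x)
      + (1 - s2) * (\<alpha> * (norm x + norm y))) / 4)" by simp
  have "F * ((half_drift \<psi> D\<psi> Gp x - half_drift \<psi> D\<psi> Gq y) \<bullet> w)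
      = F / c * ((half_drift \<psi> D\<psi> Gp x - half_drift \<psi> D\<psi> Gq y) \<bullet> z)"
    by (simp add: w_def divide_inverse)
  moreover have "F * (D / 4) = F * (norm z / c * ((\<alpha> * norm z - g (norm z)) / 4))"
    by (simp add: D_def)
  moreover have "g0' * (\<epsilon> + (e + X + (1 - s2) * (\<alpha> * n)) / 4)
      = g0' / 4 * e + g0' * \<epsilon> + g0' / 4 * (X + \<alpha> * ((1 - s2) * n))" for e X n
    by (simp add: distrib_left add_divide_distrib mult.left_commute)
  ultimately show ?thesis
    using main unfolding F_def c_def s1_def s2_def by (simp only: add.assoc)
qed

text \<open>The order of the choices matters: \<epsilon> fixes the profile and with it
  \<open>d\<close> and \<open>K\<close>, then come the truncation level \<open>n\<close>, the cutoff
  radius \<open>m\<close> and last the jump size \<open>t\<close>. The \<open>5 * \<epsilon>\<close>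
  consist of the errors of the profile, of the cutoff gradient, and of \<open>\<epsilon>2\<close>,
  \<open>\<omega>\<close> and \<open>\<epsilon>3\<close>. The cutoff errors remain as
  \<open>e1\<close> and \<open>e2\<close>, each a function of a single point, to be integrated
  against the marginals.\<close>

lemma one_step_estimate:
  fixes Up Uq :: "'a::euclidean_space \<Rightarrow> real"
  assumes C1p: "C1_grad Up Gp" and C1q: "C1_grad Uq Gq"
    and intp: "integrable P norm" "integrable P (\<lambda>x. norm (Gp x))" and intq: "integrable Q norm"
    and P: "prob_space P" "sets P = sets borel" and Q: "prob_space Q" "sets Q = sets borel"
    and \<kappa>: "\<forall>r>0. kappa Gp r \<ge> ereal (\<alpha> - g r / r)" and \<epsilon>: "\<epsilon> > 0"
  obtains d t \<tau> :: real and \<psi> :: "'a \<Rightarrow> real" and e1 e2 :: "'a \<Rightarrow> real" where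
    "d > 0" "0 < \<tau>" "\<tau> * \<Lambda> \<le> 1" "\<psi> \<in> borel_measurable borel" "\<forall>x. 0 \<le> \<psi> x"
    "\<forall>x \<xi>. norm \<xi> < 1 \<longrightarrow> accept \<psi> Up t x \<xi> \<le> 1 \<and> accept \<psi> Uq t x \<xi> \<le> 1"
    "integrable P e1" "integrable Q e2" "\<forall>x. 0 \<le> e1 x \<and> 0 \<le> e2 x" "(\<integral>x. e1 x \<partial>P) + (\<integral>x. e2 x \<partial>Q) \<le> \<epsilon>"
    "\<forall>x y. (\<integral>\<^sup>+w. ennreal (f (huber d (fst (coupled_move \<psi> Up Uq t d (x, y) w) - snd (coupled_move \<psi> Up Uq t d (x, y) w)))) \<partial>noise)
      \<le> ennreal ((1 - \<tau> * \<Lambda>) * f (huber d (x - y)) + \<tau> * (g0' / 4 * norm (Gp y - Gq y) + 5 * \<epsilon> + e1 x + e2 y))"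
proof -
  define \<sigma> where "\<sigma> = ball_variance TYPE('a)"
  have \<sigma>: "0 < \<sigma>" "\<sigma> \<le> 1" unfolding \<sigma>_def by (rule ball_variance_pos, rule ball_variance_le_1)
  define \<omega> where "\<omega> = \<epsilon> * \<sigma> / 4"
  have \<omega>: "\<omega> > 0" using \<epsilon> \<sigma> by (simp add: \<omega>_def)
  obtain d k K s0 where prof: "profile f f1 k g0' K d \<omega> s0" and s0: "s0 > 0"
    and drift: "\<forall>z :: 'a. (if norm z \<ge> 2 * d then k (norm z) else 0)
        - f1 (huber d z) * (norm z / max d (norm z) * ((\<alpha> * norm z - g (norm z)) / 4))
      \<le> - \<Lambda> * f (huber d z) + \<epsilon>"
    by (rule profile_exists[OF \<epsilon> \<omega>])
  interpret pr: profile f f1 k g0' K d \<omega> s0 by (rule prof)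
  \<comment> \<open>Price in units of \<tau> of acceptances away from 1/2: the coefficient in
    \<open>nn_integral_f_huber_step\<close>, halved because a deficit \<open>1 - s1\<close> shifts
    the acceptance by half as much.\<close>
  define C1 where "C1 = (2 * K + g0' / (2 * d)) / (2 * \<sigma>)"
  have C1: "C1 \<ge> 0" using pr.K_nonneg pr.d g0'_pos \<sigma> by (simp add: C1_def)
  \<comment> \<open>Sum of the coefficients of the cutoff errors in the gradient, in the positions
    and in the acceptances.\<close>
  define C2 where "C2 = g0' / 4 + g0' * \<alpha> / 4 + C1"
  have C2: "C2 > 0" using C1 g0'_pos \<alpha>_pos by (simp add: C2_def add_pos_nonneg add_pos_pos)
  define \<epsilon>2 where "\<epsilon>2 = \<sigma> * \<epsilon> / (2 * g0')"
  define \<epsilon>3 where "\<epsilon>3 = min (1 / 2) (\<epsilon> / (4 * C1 + 1))"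
  have \<epsilon>2: "\<epsilon>2 > 0" using \<sigma> \<epsilon> g0'_pos by (simp add: \<epsilon>2_def)
  have \<epsilon>3: "\<epsilon>3 > 0" "\<epsilon>3 \<le> 1 / 2"
    using \<epsilon> C1 min.cobounded1[of "1 / 2" "\<epsilon> / (4 * C1 + 1)"] by (simp_all only: \<epsilon>3_def) simp
  have \<epsilon>3': "4 * C1 * \<epsilon>3 \<le> \<epsilon>"
  proof -
    have "(4 * C1 + 1) * \<epsilon>3 \<le> (4 * C1 + 1) * (\<epsilon> / (4 * C1 + 1))" using C1 by (intro mult_left_mono) (auto simp: \<epsilon>3_def)
    also have "\<dots> = \<epsilon>" using C1 by simp
    finally show ?thesis using \<epsilon>3(1) by (simp add: distrib_right)
  qed
  \<comment> \<open>Four integrals are made at most \<open>\<eta>\<close>: three for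
    \<open>e1\<close> and one for \<open>e2\<close>.\<close>
  define \<eta> where "\<eta> = \<epsilon> / (4 * C2)"
  have \<eta>: "\<eta> > 0" "4 * C2 * \<eta> = \<epsilon>" using \<epsilon> C2 by (auto simp: \<eta>_def)
  interpret P: prob_space P by fact
  interpret Q: prob_space Q by fact
  have "\<forall>\<^sub>F n in sequentially. (\<integral>x. max 0 (norm (Gp x) - real n) \<partial>P) \<le> \<eta> \<and> (\<integral>x. max 0 (norm x - real n) \<partial>P) \<le> \<eta>"
    by (intro eventually_conj tendsto_0_eventually_le[OF integral_excess_tendsto] intp \<eta>)
  then obtain n :: nat where n: "(\<integral>x. max 0 (norm (Gp x) - real n) \<partial>P) \<le> \<eta>" "(\<integral>x. max 0 (norm x - real n) \<partial>P) \<le> \<eta>"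
    by (auto simp: eventually_sequentially)
  have iP: "integrable P (\<lambda>x. norm (Gp x) + 1)" and iQ: "integrable Q (\<lambda>y. 2 * real n + norm y + 1)"
    using intp intq by simp_all
  \<comment> \<open>\<open>m\<close> depends on \<open>n\<close>: each of the two truncations leaves
    \<open>real n\<close> times the cutoff deficit at \<open>y\<close>.\<close>
  have "\<forall>\<^sub>F m in sequentially. (\<integral>x. (1 - (cutoff (real m) x)\<^sup>2) * (norm (Gp x) + 1) \<partial>P) \<le> \<eta>
      \<and> (\<integral>y. (1 - (cutoff (real m) y)\<^sup>2) * (2 * real n + norm y + 1) \<partial>Q) \<le> \<eta> \<and> g0' * 4 / real m \<le> \<epsilon> \<and> 1 \<le> m"
    by (intro eventually_conj tendsto_0_eventually_le[OF integral_cutoff_tendsto[OF iP P(2)]]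
        tendsto_0_eventually_le[OF integral_cutoff_tendsto[OF iQ Q(2)]]
        tendsto_0_eventually_le[OF lim_const_over_n] \<eta> \<epsilon> eventually_ge_at_top)
  then obtain m :: nat where m: "(\<integral>x. (1 - (cutoff (real m) x)\<^sup>2) * (norm (Gp x) + 1) \<partial>P) \<le> \<eta>"
      "(\<integral>y. (1 - (cutoff (real m) y)\<^sup>2) * (2 * real n + norm y + 1) \<partial>Q) \<le> \<eta>" "g0' * 4 / real m \<le> \<epsilon>" "1 \<le> m"
    by (auto simp: eventually_sequentially)
  define \<psi> :: "'a \<Rightarrow> real" where "\<psi> = cutoff (real m)"
  define D\<psi> :: "'a \<Rightarrow> 'a" where "D\<psi> = cutoff_grad (real m)"
  have m0: "real m > 0" using m(4) by simp
  have \<psi>: "C1_grad \<psi> D\<psi>" unfolding \<psi>_def D\<psi>_def by (rule C1_grad_cutoff)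
  have \<psi>01: "0 \<le> \<psi> x" "\<psi> x \<le> 1" "(\<psi> x)\<^sup>2 \<le> 1" for x
    by (simp_all add: \<psi>_def cutoff_nonneg cutoff_le_1 cutoff_sq_le_1)
  have supp: "norm x \<ge> real m \<Longrightarrow> \<psi> x = 0" for x using m0 by (simp add: \<psi>_def cutoff_eq_0)
  have D\<psi>: "norm (D\<psi> x) \<le> 4 / real m" for x using m0 by (simp add: D\<psi>_def norm_cutoff_grad_le)
  obtain t1 where t1: "t1 > 0" "\<And>t x \<xi>. 0 < t \<Longrightarrow> t < t1 \<Longrightarrow> norm \<xi> < 1 \<Longrightarrow>
      \<bar>accept \<psi> Up t x \<xi> - (\<psi> x)\<^sup>2 / 2 - t * (\<xi> \<bullet> half_drift \<psi> D\<psi> Gp x)\<bar> \<le> \<epsilon>2 * t"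
    using accept_expansion[OF \<psi> C1p supp \<epsilon>2] by blast
  obtain t2 where t2: "t2 > 0" "\<And>t x \<xi>. 0 < t \<Longrightarrow> t < t2 \<Longrightarrow> norm \<xi> < 1 \<Longrightarrow>
      \<bar>accept \<psi> Uq t x \<xi> - (\<psi> x)\<^sup>2 / 2 - t * (\<xi> \<bullet> half_drift \<psi> D\<psi> Gq x)\<bar> \<le> \<epsilon>2 * t"
    using accept_expansion[OF \<psi> C1q supp \<epsilon>2] by blast
  obtain Ca where Ca: "Ca > 0" "\<And>x. norm (half_drift \<psi> D\<psi> Gp x) \<le> Ca" using half_drift_bounded[OF \<psi> C1p supp] by blast
  obtain Cb where Cb: "Cb > 0" "\<And>x. norm (half_drift \<psi> D\<psi> Gq x) \<le> Cb" using half_drift_bounded[OF \<psi> C1q supp] by blast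
  \<comment> \<open>The bounds serve, in this order, the two expansions, the requirements
    \<open>2 * t \<le> d\<close> and \<open>2 * t \<le> s0\<close> of the coupled step, acceptances
    within \<open>\<epsilon>3 \<le> 1 / 2\<close> of half the squared cutoff and hence at most 1,
    and \<open>\<tau> * \<Lambda> \<le> 1\<close>.\<close>
  define t where "t = Min {t1 / 2, t2 / 2, d / 2, s0 / 2, \<epsilon>3 / (Ca + \<epsilon>2), \<epsilon>3 / (Cb + \<epsilon>2), 1, 1 / (\<Lambda> + 1)}"
  have t0: "t > 0"
    unfolding t_def using t1(1) t2(1) pr.d s0 \<epsilon>3 \<epsilon>2 Ca(1) Cb(1) \<Lambda>_nonneg by (subst Min_gr_iff) auto
  have t_le: "t \<le> t1 / 2" "t \<le> t2 / 2" "t \<le> d / 2" "t \<le> s0 / 2" "t \<le> \<epsilon>3 / (Ca + \<epsilon>2)" "t \<le> \<epsilon>3 / (Cb + \<epsilon>2)" "t \<le> 1" "t \<le> 1 / (\<Lambda> + 1)"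
    unfolding t_def by (rule Min_le; simp)+
  have tt: "t < t1" "t < t2" "2 * t \<le> d" "2 * t \<le> s0" "t * (Ca + \<epsilon>2) \<le> \<epsilon>3" "t * (Cb + \<epsilon>2) \<le> \<epsilon>3" "t * \<Lambda> \<le> 1"
    using t_le t1(1) t2(1) Ca(1) Cb(1) \<epsilon>2 \<Lambda>_nonneg t0 by (auto simp: pos_le_divide_eq distrib_left)
  define \<tau> where "\<tau> = t\<^sup>2 * \<sigma>"
  have \<tau>: "\<tau> > 0" using t0 \<sigma> by (simp add: \<tau>_def)
  have \<tau>\<Lambda>: "\<tau> * \<Lambda> \<le> 1"
  proof -
    have "\<tau> * \<Lambda> = (t * \<sigma>) * (t * \<Lambda>)" by (simp add: \<tau>_def power2_eq_square)
    also have "\<dots> \<le> 1"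
    proof (rule mult_le_one)
      show "t * \<sigma> \<le> 1" using t0 t_le(7) \<sigma> by (intro mult_le_one) auto
    qed (use t0 \<Lambda>_nonneg tt(7) in auto)
    finally show ?thesis .
  qed
  have near: "\<bar>acc - s / 2\<bar> \<le> \<epsilon>3"
    if "\<bar>acc - s / 2 - t * (\<xi> \<bullet> A)\<bar> \<le> \<epsilon>2 * t" "norm A \<le> C" "t * (C + \<epsilon>2) \<le> \<epsilon>3" "norm \<xi> < 1"
    for acc s C and \<xi> A :: 'a
  proof -
    have "t * \<bar>\<xi> \<bullet> A\<bar> \<le> t * C" using abs_inner_le[OF that(4), of A] that(2) t0 by (intro mult_left_mono) auto
    then have "\<bar>t * (\<xi> \<bullet> A)\<bar> \<le> t * C" using t0 by (simp add: abs_mult)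
    moreover have "t * C + \<epsilon>2 * t \<le> \<epsilon>3" using that(3) by (simp add: algebra_simps)
    ultimately show ?thesis using that(1) by linarith
  qed
  have nearp: "\<bar>accept \<psi> Up t x \<xi> - (\<psi> x)\<^sup>2 / 2\<bar> \<le> \<epsilon>3" if "norm \<xi> < 1" for x \<xi>
    by (rule near[OF t1(2)[OF t0 tt(1) that] Ca(2) tt(5) that])
  have nearq: "\<bar>accept \<psi> Uq t x \<xi> - (\<psi> x)\<^sup>2 / 2\<bar> \<le> \<epsilon>3" if "norm \<xi> < 1" for x \<xi>
    by (rule near[OF t2(2)[OF t0 tt(2) that] Cb(2) tt(6) that])
  have acc0: "0 \<le> accept \<psi> V t x \<xi>" for V x \<xi> using \<psi>01(1) by (simp add: accept_def)
  have accp: "accept \<psi> Up t x \<xi> \<le> 1" and accq: "accept \<psi> Uq t x \<xi> \<le> 1" if "norm \<xi> < 1" for x \<xi>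
    using nearp[OF that, of x] nearq[OF that, of x] \<psi>01(3)[of x] \<epsilon>3(2) by linarith+
  have \<psi>_meas [measurable]: "\<psi> \<in> borel_measurable borel" by (rule C1_grad_borel[OF \<psi>])
  note [measurable] = C1_grad_borel[OF C1p] C1_grad_borel[OF C1q]
  define e1 where "e1 x = C2 * ((1 - (\<psi> x)\<^sup>2) * (norm (Gp x) + 1) + max 0 (norm (Gp x) - real n) + max 0 (norm x - real n))" for x
  define e2 where "e2 y = C2 * ((1 - (\<psi> y)\<^sup>2) * (2 * real n + norm y + 1))" for y
  have i_cut: "integrable M (\<lambda>x. (1 - (\<psi> x)\<^sup>2) * u x)" if "integrable M u" "sets M = sets borel" for M and u :: "'a \<Rightarrow> real"
  proof (rule Bochner_Integration.integrable_bound[OF that(1)])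
    have "\<psi> \<in> borel_measurable M" using \<psi>_meas that(2) by (simp cong: measurable_cong_sets)
    then show "(\<lambda>x. (1 - (\<psi> x)\<^sup>2) * u x) \<in> borel_measurable M" using that(1) by measurable
    show "AE x in M. norm ((1 - (\<psi> x)\<^sup>2) * u x) \<le> norm (u x)"
      using \<psi>01(3) by (intro AE_I2) (auto simp: abs_mult intro!: mult_left_le_one_le)
  qed
  have ie: "integrable P (\<lambda>x. (1 - (\<psi> x)\<^sup>2) * (norm (Gp x) + 1))" "integrable P (\<lambda>x. max 0 (norm (Gp x) - real n))"
     "integrable P (\<lambda>x. max 0 (norm x - real n))" "integrable Q (\<lambda>y. (1 - (\<psi> y)\<^sup>2) * (2 * real n + norm y + 1))"
    using intp by (auto intro!: i_cut iP iQ P Q Bochner_Integration.integrable_max)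
  have "(\<integral>x. e1 x \<partial>P) \<le> C2 * (\<eta> + \<eta> + \<eta>)"
    unfolding e1_def using ie n m(1) C2 by (simp add: \<psi>_def)
  moreover have "(\<integral>y. e2 y \<partial>Q) \<le> C2 * \<eta>"
    unfolding e2_def using ie m(2) C2 by (simp add: \<psi>_def)
  ultimately have e_int: "(\<integral>x. e1 x \<partial>P) + (\<integral>x. e2 x \<partial>Q) \<le> \<epsilon>"
    using \<eta>(2) by (simp add: algebra_simps)
  have key: "(\<integral>\<^sup>+w. ennreal (f (huber d (fst (coupled_move \<psi> Up Uq t d (x, y) w) - snd (coupled_move \<psi> Up Uq t d (x, y) w)))) \<partial>noise)
      \<le> ennreal ((1 - \<tau> * \<Lambda>) * f (huber d (x - y)) + \<tau> * (g0' / 4 * norm (Gp y - Gq y) + 5 * \<epsilon> + e1 x + e2 y))" (is "?K \<le> _") for x y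
  proof -
    define z where "z = x - y"
    define A where "A = half_drift \<psi> D\<psi> Gp x"
    define B where "B = half_drift \<psi> D\<psi> Gq y"
    define s1 where "s1 = (\<psi> x)\<^sup>2"
    define s2 where "s2 = (\<psi> y)\<^sup>2"
    define kz where "kz = (if norm z \<ge> 2 * d then k (norm z) else 0)"
    define b1 where "b1 = f1 (huber d z) / max d (norm z) * ((A - B) \<bullet> z)"
    define E where "E = norm (Gp y - Gq y)"
    have s: "0 \<le> s1" "s1 \<le> 1" "0 \<le> s2" "s2 \<le> 1" by (simp_all add: s1_def s2_def \<psi>01)
    have ha: "\<bar>accept \<psi> Up t x \<xi> - 1 / 2\<bar> \<le> (1 - s1) / 2 + \<epsilon>3" if "norm \<xi> < 1" for \<xi>
      using nearp[OF that, of x] s unfolding s1_def[symmetric] abs_le_iff by (auto simp: field_simps)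
    have hb: "\<bar>accept \<psi> Uq t y \<xi> - 1 / 2\<bar> \<le> (1 - s2) / 2 + \<epsilon>3" if "norm \<xi> < 1" for \<xi>
      using nearq[OF that, of y] s unfolding s2_def[symmetric] abs_le_iff by (auto simp: field_simps)
    have diff: "fst (coupled_move \<psi> Up Uq t d (x, y) w) - snd (coupled_move \<psi> Up Uq t d (x, y) w)
        = z + ((if snd w < accept \<psi> Up t x (fst w) then t *\<^sub>R fst w else 0)
          - (if snd w < accept \<psi> Uq t y (fst (coupled_noise d z w)) then t *\<^sub>R fst (coupled_noise d z w) else 0))" for w
      by (simp add: coupled_move_def move_def z_def coupled_noise_def)
    have "?K
      \<le> ennreal (f (huber d z) + t\<^sup>2 * \<sigma> * (b1 + kz)
        + t\<^sup>2 * (2 * \<epsilon>2 * g0' + 4 * \<omega> + (((1 - s1) / 2 + \<epsilon>3) + ((1 - s2) / 2 + \<epsilon>3)) * (2 * K + g0' / (2 * d))))"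
      unfolding diff b1_def kz_def \<sigma>_def
    proof (rule pr.nn_integral_f_huber_step[OF t0 tt(3,4)])
      show "\<bar>accept \<psi> Up t x \<xi> - s1 / 2 - t * (\<xi> \<bullet> A)\<bar> \<le> \<epsilon>2 * t" if "norm \<xi> < 1" for \<xi>
        unfolding A_def s1_def by (rule t1(2)[OF t0 tt(1) that])
      show "\<bar>accept \<psi> Uq t y \<xi> - s2 / 2 - t * (\<xi> \<bullet> B)\<bar> \<le> \<epsilon>2 * t" if "norm \<xi> < 1" for \<xi>
        unfolding B_def s2_def by (rule t2(2)[OF t0 tt(2) that])
    qed (use acc0 accp accq ha hb \<epsilon>2 in auto)
    also have "\<dots> \<le> ennreal ((1 - \<tau> * \<Lambda>) * f (huber d z) + \<tau> * (g0' / 4 * E + 5 * \<epsilon> + e1 x + e2 y))"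
    proof (rule ennreal_leI)
      define T where "T = (1 - s1) * (norm (Gp x) + 1) + max 0 (norm (Gp x) - real n) + max 0 (norm x - real n) + (1 - s2) * (2 * real n + norm y + 1)"
      have eT: "C2 * T = e1 x + e2 y" by (simp only: T_def e1_def e2_def s1_def s2_def distrib_left[of C2] add.assoc)
      have m1: "(1 - s2) * norm (Gp x) \<le> real n * (1 - s2) + max 0 (norm (Gp x) - real n)"
        and m2: "(1 - s2) * norm x \<le> real n * (1 - s2) + max 0 (norm x - real n)"
        using s by (auto intro!: mult_le_add_excess)
      have nn: "0 \<le> (1 - s1) * norm (Gp x)" "0 \<le> (1 - s2) * norm y" "0 \<le> real n * (1 - s2)" using s by simp_all
      have T1: "((1 - s1) + (1 - s2)) * norm (Gp x) \<le> T"
        using m1 nn s by (simp add: T_def algebra_simps)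
      have T2: "(1 - s2) * (norm x + norm y) \<le> T"
        using m2 nn s by (simp add: T_def algebra_simps)
      have T3: "(1 - s1) + (1 - s2) \<le> T"
        using nn s by (simp add: T_def algebra_simps)
      have "g0' / 4 * (((1 - s1) + (1 - s2)) * norm (Gp x) + \<alpha> * ((1 - s2) * (norm x + norm y))) + C1 * ((1 - s1) + (1 - s2))
          \<le> g0' / 4 * (T + \<alpha> * T) + C1 * T"
        using T1 T2 T3 C1 g0'_pos \<alpha>_pos by (intro add_mono mult_left_mono) auto
      also have "\<dots> = C2 * T" by (simp add: C2_def algebra_simps)
      finally have err: "g0' / 4 * (((1 - s1) + (1 - s2)) * norm (Gp x) + \<alpha> * ((1 - s2) * (norm x + norm y))) + C1 * ((1 - s1) + (1 - s2))
          \<le> e1 x + e2 y" by (simp add: eT)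
      have "g0' * (4 / real m) \<le> \<epsilon>" using m(3) by simp
      then have b: "b1 + kz \<le> - \<Lambda> * f (huber d z) + \<epsilon> + g0' / 4 * E + \<epsilon>
          + g0' / 4 * (((1 - s1) + (1 - s2)) * norm (Gp x) + \<alpha> * ((1 - s2) * (norm x + norm y)))"
        using drift_estimate[where \<psi>=\<psi> and D\<psi>=D\<psi> and \<epsilon>="4 / real m" and x=x and y=y and Gq=Gq, OF \<kappa> pr.d \<psi>01(1,2) D\<psi>] spec[OF drift, of z]
        unfolding b1_def kz_def A_def B_def z_def s1_def s2_def E_def by linarith
      have rest: "t\<^sup>2 * (2 * \<epsilon>2 * g0' + 4 * \<omega> + (((1 - s1) / 2 + \<epsilon>3) + ((1 - s2) / 2 + \<epsilon>3)) * (2 * K + g0' / (2 * d)))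
          = \<tau> * (\<epsilon> + \<epsilon> + C1 * ((1 - s1) + (1 - s2)) + 4 * C1 * \<epsilon>3)"
      proof -
        have 1: "2 * \<epsilon>2 * g0' = \<sigma> * \<epsilon>" using g0'_pos by (simp add: \<epsilon>2_def)
        have 2: "4 * \<omega> = \<sigma> * \<epsilon>" by (simp add: \<omega>_def)
        have 3: "2 * K + g0' / (2 * d) = \<sigma> * (2 * C1)" using \<sigma> by (simp add: C1_def)
        show ?thesis unfolding 1 2 3 \<tau>_def by (simp add: algebra_simps add_divide_distrib diff_divide_distrib)
      qed
      have "f (huber d z) + \<tau> * (b1 + kz) + \<tau> * (\<epsilon> + \<epsilon> + C1 * ((1 - s1) + (1 - s2)) + 4 * C1 * \<epsilon>3)
          = f (huber d z) + \<tau> * ((b1 + kz) + (\<epsilon> + \<epsilon> + C1 * ((1 - s1) + (1 - s2)) + 4 * C1 * \<epsilon>3))"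
        by (simp add: distrib_left)
      also have "\<dots> \<le> f (huber d z) + \<tau> * (- \<Lambda> * f (huber d z) + (g0' / 4 * E + 5 * \<epsilon> + e1 x + e2 y))"
        using b err \<epsilon>3' \<tau> by (intro add_left_mono mult_left_mono) linarith+
      also have "\<dots> = (1 - \<tau> * \<Lambda>) * f (huber d z) + \<tau> * (g0' / 4 * E + 5 * \<epsilon> + e1 x + e2 y)"
        by (simp add: algebra_simps)
      finally show "f (huber d z) + t\<^sup>2 * \<sigma> * (b1 + kz)
        + t\<^sup>2 * (2 * \<epsilon>2 * g0' + 4 * \<omega> + (((1 - s1) / 2 + \<epsilon>3) + ((1 - s2) / 2 + \<epsilon>3)) * (2 * K + g0' / (2 * d)))
        \<le> (1 - \<tau> * \<Lambda>) * f (huber d z) + \<tau> * (g0' / 4 * E + 5 * \<epsilon> + e1 x + e2 y)"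
        unfolding rest by (simp only: \<tau>_def)
    qed
    finally show ?thesis by (simp only: z_def E_def)
  qed
  have e0: "0 \<le> e1 x" "0 \<le> e2 x" for x
    using C2 \<psi>01(3)[of x] by (auto simp: e1_def e2_def intro!: mult_nonneg_nonneg add_nonneg_nonneg)
  have "integrable P e1" "integrable Q e2"
    unfolding e1_def[abs_def] e2_def[abs_def] using ie by simp_all
  then show thesis
    using pr.d \<tau> \<tau>\<Lambda> \<psi>_meas \<psi>01(1) accp accq e0 e_int key by (intro that[of d \<tau> \<psi> t e1 e2]) simp_all
qed

text \<open>The sixth \<epsilon> pays for the integrals of \<open>e1\<close> and
  \<open>e2\<close>.\<close>

lemma main_estimate:
  fixes Up Uq :: "'a::euclidean_space \<Rightarrow> real"
  defines "P \<equiv> gibbs Up" and "Q \<equiv> gibbs Uq"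
  assumes C1p: "C1_grad Up Gp" and C1q: "C1_grad Uq Gq" and prob: "prob_space P" "prob_space Q"
    and intq: "integrable Q norm" and intE: "integrable Q (\<lambda>y. norm (Gp y - Gq y))"
    and \<kappa>: "\<forall>r>0. kappa Gp r \<ge> ereal (\<alpha> - g r / r)" and \<epsilon>: "\<epsilon> > 0"
  shows "ennreal (\<Lambda> * deriv g R) * W1 P Q \<le> ennreal (g0' / 4 * (\<integral>y. norm (Gp y - Gq y) \<partial>Q) + 6 * \<epsilon>)"
proof -
  note [measurable] = C1_grad_borel[OF C1p] C1_grad_borel[OF C1q] C1_grad_borel_grad[OF C1p] C1_grad_borel_grad[OF C1q]
  interpret P: prob_space P by fact
  interpret Q: prob_space Q by fact
  have setsP [measurable_cong]: "sets P = sets borel" and setsQ [measurable_cong]: "sets Q = sets borel" by (simp_all add: P_def Q_def)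
  have intp: "integrable P norm" "integrable P (\<lambda>x. norm (Gp x))"
    unfolding P_def by (rule kappa_integrable[OF C1p prob(1)[unfolded P_def] \<kappa>])+
  obtain d t \<tau> :: real and \<psi> :: "'a \<Rightarrow> real" and e1 e2 :: "'a \<Rightarrow> real" where
    d: "d > 0" and \<tau>: "0 < \<tau>" "\<tau> * \<Lambda> \<le> 1" and \<psi>: "\<psi> \<in> borel_measurable borel" "\<forall>x. 0 \<le> \<psi> x"
    and acc: "\<forall>x \<xi>. norm \<xi> < 1 \<longrightarrow> accept \<psi> Up t x \<xi> \<le> 1 \<and> accept \<psi> Uq t x \<xi> \<le> 1"
    and e: "integrable P e1" "integrable Q e2" "\<forall>x. 0 \<le> e1 x \<and> 0 \<le> e2 x" "(\<integral>x. e1 x \<partial>P) + (\<integral>x. e2 x \<partial>Q) \<le> \<epsilon>"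
    and step: "\<forall>x y. (\<integral>\<^sup>+w. ennreal (f (huber d (fst (coupled_move \<psi> Up Uq t d (x, y) w) - snd (coupled_move \<psi> Up Uq t d (x, y) w)))) \<partial>noise)
      \<le> ennreal ((1 - \<tau> * \<Lambda>) * f (huber d (x - y)) + \<tau> * (g0' / 4 * norm (Gp y - Gq y) + 5 * \<epsilon> + e1 x + e2 y))"
    by (rule one_step_estimate[OF C1p C1q intp intq prob(1) setsP prob(2) setsQ \<kappa> \<epsilon>])
  have \<psi>0: "\<And>x. 0 \<le> \<psi> x"
    and accp: "\<And>x \<xi>. norm \<xi> < 1 \<Longrightarrow> accept \<psi> Up t x \<xi> \<le> 1"
    and accq: "\<And>x \<xi>. norm \<xi> < 1 \<Longrightarrow> accept \<psi> Uq t x \<xi> \<le> 1"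
    and e0: "\<And>x. 0 \<le> e1 x" "\<And>x. 0 \<le> e2 x"
    using \<psi>(2) acc e(3) by simp_all
  define c where "c = g0' / 4 * (\<integral>y. norm (Gp y - Gq y) \<partial>Q) + 6 * \<epsilon>"
  have c0: "c \<ge> 0" using \<epsilon> g0'_pos by (simp add: c_def)
  define F where "F z = ennreal (f (huber d (fst z - snd z)))" for z :: "'a \<times> 'a"
  have [measurable]: "(\<lambda>z :: 'a. f (huber d z)) \<in> borel_measurable borel" by (rule borel_measurable_f_huber[OF d])
  have F_meas [measurable]: "F \<in> borel_measurable (borel \<Otimes>\<^sub>M borel)"
    unfolding F_def[abs_def]
    by (rule measurable_compose[OF _ measurable_compose[OF \<open>(\<lambda>z :: 'a. f (huber d z)) \<in> borel_measurable borel\<close> measurable_ennreal]]) measurable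
  have e_meas [measurable]: "e1 \<in> borel_measurable borel" "e2 \<in> borel_measurable borel"
    using borel_measurable_integrable[OF e(1)] borel_measurable_integrable[OF e(2)] setsP setsQ
    by (simp_all cong: measurable_cong_sets)
  define J where "J \<pi> = (\<integral>\<^sup>+z. F z \<partial>\<pi>)" for \<pi>
  define I where "I = (INF \<pi>\<in>{\<pi>. coupling P Q \<pi>}. J \<pi>)"
  have contr: "I \<le> ennreal (1 - \<tau> * \<Lambda>) * J \<pi> + ennreal (\<tau> * c)" if \<pi>: "coupling P Q \<pi>" for \<pi>
  proof -
    have sets\<pi> [measurable_cong]: "sets \<pi> = sets (borel \<Otimes>\<^sub>M borel)" by (rule coupling_sets[OF \<pi>])
    define \<pi>' where "\<pi>' = distr (\<pi> \<Otimes>\<^sub>M noise) (borel \<Otimes>\<^sub>M borel) (\<lambda>p. coupled_move \<psi> Up Uq t d (fst p) (snd p))"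
    \<comment> \<open>Collects the terms that depend on \<open>y\<close> alone: apart from its cost,
      the coupling then enters only through its marginals.\<close>
    define v where "v y = g0' / 4 * norm (Gp y - Gq y) + e2 y" for y
    have v: "v \<in> borel_measurable borel" "\<And>y. 0 \<le> v y" "integrable Q v" "(\<integral>y. v y \<partial>Q) = g0' / 4 * (\<integral>y. norm (Gp y - Gq y) \<partial>Q) + (\<integral>y. e2 y \<partial>Q)"
      unfolding v_def[abs_def] using e e0 intE g0'_pos by simp_all
    have "coupling P Q \<pi>'"
      unfolding \<pi>'_def P_def Q_def
      by (rule coupling_coupled_move[OF \<psi>(1) _ _ \<psi>0 accp accq \<pi>[unfolded P_def Q_def]]) measurable
    then have "I \<le> J \<pi>'" unfolding I_def by (intro INF_lower) simp
    also have "J \<pi>' = (\<integral>\<^sup>+z. (\<integral>\<^sup>+w. F (coupled_move \<psi> Up Uq t d z w) \<partial>noise) \<partial>\<pi>)"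
      unfolding J_def \<pi>'_def
      by (rule nn_integral_coupled_move[OF \<psi>(1) _ _ \<psi>0 accp accq \<pi>[unfolded P_def Q_def]]) measurable
    also have "\<dots> \<le> (\<integral>\<^sup>+z. ennreal (1 - \<tau> * \<Lambda>) * F z + (ennreal \<tau> * ennreal (5 * \<epsilon> + e1 (fst z)) + ennreal \<tau> * ennreal (v (snd z))) \<partial>\<pi>)"
    proof (rule nn_integral_mono)
      fix z :: "'a \<times> 'a"
      obtain x y where z: "z = (x, y)" by (cases z)
      have "(\<integral>\<^sup>+w. F (coupled_move \<psi> Up Uq t d z w) \<partial>noise)
          \<le> ennreal ((1 - \<tau> * \<Lambda>) * f (huber d (x - y)) + (\<tau> * (5 * \<epsilon> + e1 x) + \<tau> * v y))"
        using step[rule_format, of x y] unfolding F_def z v_def by (simp add: algebra_simps)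
      also have "\<dots> = ennreal ((1 - \<tau> * \<Lambda>) * f (huber d (x - y))) + (ennreal (\<tau> * (5 * \<epsilon> + e1 x)) + ennreal (\<tau> * v y))"
        using \<tau> \<epsilon> e0(1)[of x] v(2)[of y] f_nonneg[OF huber_pos[OF d, of "x - y"]] by (simp add: ennreal_plus)
      also have "\<dots> = ennreal (1 - \<tau> * \<Lambda>) * F z + (ennreal \<tau> * ennreal (5 * \<epsilon> + e1 (fst z)) + ennreal \<tau> * ennreal (v (snd z)))"
        using \<tau> by (simp only: F_def z fst_conv snd_conv ennreal_mult' less_imp_le diff_ge_0_iff_ge)
      finally show "(\<integral>\<^sup>+w. F (coupled_move \<psi> Up Uq t d z w) \<partial>noise) \<le> \<dots>" .
    qed
    also have "\<dots> = ennreal (1 - \<tau> * \<Lambda>) * J \<pi> + (ennreal \<tau> * (\<integral>\<^sup>+z. ennreal (5 * \<epsilon> + e1 (fst z)) \<partial>\<pi>) + ennreal \<tau> * (\<integral>\<^sup>+z. ennreal (v (snd z)) \<partial>\<pi>))"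
    proof -
      note [measurable] = v(1)
      have "(\<lambda>z. ennreal (5 * \<epsilon> + e1 (fst z))) \<in> borel_measurable (borel \<Otimes>\<^sub>M (borel :: 'a measure))"
           "(\<lambda>z. ennreal (v (snd z))) \<in> borel_measurable ((borel :: 'a measure) \<Otimes>\<^sub>M borel)"
        by measurable
      with F_meas have "F \<in> borel_measurable \<pi>" "(\<lambda>z. ennreal (5 * \<epsilon> + e1 (fst z))) \<in> borel_measurable \<pi>"
           "(\<lambda>z. ennreal (v (snd z))) \<in> borel_measurable \<pi>"
        by (simp_all only: measurable_cong_sets[OF sets\<pi> refl])
      then show ?thesis unfolding J_def by (simp add: nn_integral_add nn_integral_cmult)
    qed
    also have "(\<integral>\<^sup>+z. ennreal (5 * \<epsilon> + e1 (fst z)) \<partial>\<pi>) = (\<integral>\<^sup>+x. ennreal (5 * \<epsilon> + e1 x) \<partial>P)"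
      by (rule coupling_nn_integral_fst[OF \<pi>]) measurable
    also have "\<dots> = ennreal (5 * \<epsilon> + (\<integral>x. e1 x \<partial>P))"
      using e e0 \<epsilon> by (subst nn_integral_eq_integral) (auto simp: P.prob_space)
    also have "(\<integral>\<^sup>+z. ennreal (v (snd z)) \<partial>\<pi>) = (\<integral>\<^sup>+y. ennreal (v y) \<partial>Q)"
      using v(1) by (intro coupling_nn_integral_snd[OF \<pi>]) measurable
    also have "\<dots> = ennreal (\<integral>y. v y \<partial>Q)"
      using v by (intro nn_integral_eq_integral) auto
    also have "ennreal \<tau> * ennreal (5 * \<epsilon> + (\<integral>x. e1 x \<partial>P)) + ennreal \<tau> * ennreal (\<integral>y. v y \<partial>Q) = ennreal (\<tau> * (5 * \<epsilon> + (\<integral>x. e1 x \<partial>P) + (\<integral>y. v y \<partial>Q)))"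
    proof -
      have "0 \<le> (\<integral>x. e1 x \<partial>P)" "0 \<le> (\<integral>y. v y \<partial>Q)" using e0 v(2) by (simp_all add: Bochner_Integration.integral_nonneg)
      then show ?thesis using \<tau> \<epsilon> by (simp only: distrib_left[of \<tau>] ennreal_mult'[symmetric] less_imp_le) (subst ennreal_plus[symmetric], auto)
    qed
    also have "\<dots> \<le> ennreal (\<tau> * c)"
      using e(4) \<tau> by (intro ennreal_leI mult_left_mono) (auto simp: v(4) c_def)
    finally show ?thesis by (simp add: add_left_mono)
  qed
  \<comment> \<open>The linear growth of \<open>f\<close> and the two first moments give the product
    coupling a finite cost.\<close>
  have fin: "J (P \<Otimes>\<^sub>M Q) < \<infinity>" and prod: "coupling P Q (P \<Otimes>\<^sub>M Q)"
  proof -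
    show prod: "coupling P Q (P \<Otimes>\<^sub>M Q)" by (rule coupling_pair_measure[OF prob setsP setsQ])
    have [measurable_cong]: "sets (P \<Otimes>\<^sub>M Q) = sets (borel \<Otimes>\<^sub>M borel)" by (rule coupling_sets[OF prod])
    have "J (P \<Otimes>\<^sub>M Q) \<le> (\<integral>\<^sup>+z. ennreal (g0' * (d + norm (fst z))) + ennreal (g0' * norm (snd z)) \<partial>(P \<Otimes>\<^sub>M Q))"
      unfolding J_def F_def
    proof (rule nn_integral_mono)
      fix z :: "'a \<times> 'a"
      have "f (huber d (fst z - snd z)) \<le> g0' * huber d (fst z - snd z)" by (rule f_le[OF huber_pos[OF d]])
      also have "\<dots> \<le> g0' * (d + norm (fst z) + norm (snd z))"
      proof (intro mult_left_mono)
        have "huber d (fst z - snd z) \<le> d + norm (fst z - snd z)"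
          by (rule order_trans[OF huber_le_max[OF d]]) (use d in simp)
        then show "huber d (fst z - snd z) \<le> d + norm (fst z) + norm (snd z)"
          using norm_triangle_ineq4[of "fst z" "snd z"] by linarith
      qed (use g0'_pos in simp)
      finally have "ennreal (f (huber d (fst z - snd z))) \<le> ennreal (g0' * (d + norm (fst z)) + g0' * norm (snd z))"
        by (intro ennreal_leI) (simp add: distrib_left)
      then show "ennreal (f (huber d (fst z - snd z))) \<le> ennreal (g0' * (d + norm (fst z))) + ennreal (g0' * norm (snd z))"
        using g0'_pos d by (subst (asm) ennreal_plus) auto
    qed
    also have "\<dots> = (\<integral>\<^sup>+z. ennreal (g0' * (d + norm (fst z))) \<partial>(P \<Otimes>\<^sub>M Q)) + (\<integral>\<^sup>+z. ennreal (g0' * norm (snd z)) \<partial>(P \<Otimes>\<^sub>M Q))"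
      by (rule nn_integral_add; subst measurable_cong_sets[OF coupling_sets[OF prod] refl]) measurable
    also have "(\<integral>\<^sup>+z. ennreal (g0' * (d + norm (fst z))) \<partial>(P \<Otimes>\<^sub>M Q)) = (\<integral>\<^sup>+x. ennreal (g0' * (d + norm x)) \<partial>P)"
      by (rule coupling_nn_integral_fst[OF prod]) measurable
    also have "\<dots> = ennreal (\<integral>x. g0' * (d + norm x) \<partial>P)"
      using intp d g0'_pos by (intro nn_integral_eq_integral) auto
    also have "(\<integral>\<^sup>+z. ennreal (g0' * norm (snd z)) \<partial>(P \<Otimes>\<^sub>M Q)) = (\<integral>\<^sup>+y. ennreal (g0' * norm y) \<partial>Q)"
      by (rule coupling_nn_integral_snd[OF prod]) measurable
    also have "\<dots> = ennreal (\<integral>y. g0' * norm y \<partial>Q)"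
      using intq g0'_pos by (intro nn_integral_eq_integral) auto
    also have "ennreal (\<integral>x. g0' * (d + norm x) \<partial>P) + ennreal (\<integral>y. g0' * norm y \<partial>Q) < \<infinity>" by simp
    finally show "J (P \<Otimes>\<^sub>M Q) < \<infinity>" .
  qed
  have "ennreal (\<tau> * \<Lambda>) * I \<le> ennreal (\<tau> * c)"
    unfolding I_def
    by (rule INF_contraction[where J=J and ?x0.0="P \<Otimes>\<^sub>M Q"])
       (use contr fin prod \<tau> \<Lambda>_nonneg c0 in \<open>auto simp: I_def\<close>)
  \<comment> \<open>\<open>\<tau>\<close> cancels, so \<open>t\<close> is never sent to 0.\<close>
  then have "ennreal \<tau> * (ennreal \<Lambda> * I) \<le> ennreal \<tau> * ennreal c"
    using \<tau> by (simp add: ennreal_mult' mult.assoc)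
  then have \<Lambda>I: "ennreal \<Lambda> * I \<le> ennreal c"
    using \<tau> by (simp add: ennreal_mult_le_mult_iff)
  \<comment> \<open>\<open>huber\<close> lies above the norm, so the smoothing loses nothing here
    and \<open>d\<close> can stay fixed.\<close>
  have "ennreal (deriv g R) * W1 P Q \<le> I"
    unfolding I_def
  proof (rule INF_greatest)
    fix \<pi> assume "\<pi> \<in> {\<pi>. coupling P Q \<pi>}"
    then have \<pi>: "coupling P Q \<pi>" by simp
    have [measurable_cong]: "sets \<pi> = sets (borel \<Otimes>\<^sub>M borel)" by (rule coupling_sets[OF \<pi>])
    have "ennreal (deriv g R) * W1 P Q \<le> ennreal (deriv g R) * (\<integral>\<^sup>+z. ennreal (norm (fst z - snd z)) \<partial>\<pi>)"
      unfolding W1_def by (intro mult_left_mono INF_lower) (simp_all add: \<pi>)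
    also have "\<dots> = (\<integral>\<^sup>+z. ennreal (deriv g R) * ennreal (norm (fst z - snd z)) \<partial>\<pi>)"
      by (rule nn_integral_cmult[symmetric], subst measurable_cong_sets[OF coupling_sets[OF \<pi>] refl]) measurable
    also have "\<dots> \<le> J \<pi>"
      unfolding J_def F_def
    proof (rule nn_integral_mono)
      fix z :: "'a \<times> 'a"
      have "deriv g R * norm (fst z - snd z) \<le> deriv g R * huber d (fst z - snd z)"
        using huber_ge_norm[OF d] g'_nonneg[OF R_pos] by (intro mult_left_mono) auto
      also have "\<dots> \<le> f (huber d (fst z - snd z))" by (rule f_ge[OF huber_pos[OF d]])
      finally show "ennreal (deriv g R) * ennreal (norm (fst z - snd z)) \<le> ennreal (f (huber d (fst z - snd z)))"
        using g'_nonneg[OF R_pos] by (simp add: ennreal_mult'[symmetric] ennreal_leI)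
    qed
    finally show "ennreal (deriv g R) * W1 P Q \<le> J \<pi>" .
  qed
  then have "ennreal \<Lambda> * (ennreal (deriv g R) * W1 P Q) \<le> ennreal \<Lambda> * I" by (intro mult_left_mono) auto
  also note \<Lambda>I
  finally show ?thesis
    using \<Lambda>_nonneg by (simp add: ennreal_mult' mult.assoc c_def)
qed

end

section \<open>Degenerate cases and the final bound\<close>

lemma coupling_diagonal:
  assumes "sets M = sets borel"
  shows "coupling M M (distr M (borel \<Otimes>\<^sub>M borel) (\<lambda>x. (x, x)))"
proof (rule couplingI)
  have [measurable]: "(\<lambda>x. (x, x)) \<in> M \<rightarrow>\<^sub>M borel \<Otimes>\<^sub>M borel"
    by (subst measurable_cong_sets[OF assms refl]) measurable
  fix A :: "'a set" assume [measurable]: "A \<in> sets borel"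
  show "(\<integral>\<^sup>+z. indicator A (fst z) \<partial>distr M (borel \<Otimes>\<^sub>M borel) (\<lambda>x. (x, x))) = (\<integral>\<^sup>+x. indicator A x \<partial>M)"
    by (subst nn_integral_distr) simp_all
  show "(\<integral>\<^sup>+z. indicator A (snd z) \<partial>distr M (borel \<Otimes>\<^sub>M borel) (\<lambda>x. (x, x))) = (\<integral>\<^sup>+x. indicator A x \<partial>M)"
    by (subst nn_integral_distr) simp_all
qed (use assms in simp_all)

lemma W1_self:
  assumes "sets M = sets borel"
  shows "W1 M M = 0"
proof -
  have [measurable]: "(\<lambda>x. (x, x)) \<in> M \<rightarrow>\<^sub>M borel \<Otimes>\<^sub>M borel"
    by (subst measurable_cong_sets[OF assms refl]) measurable
  have "W1 M M \<le> (\<integral>\<^sup>+z. ennreal (norm (fst z - snd z)) \<partial>distr M (borel \<Otimes>\<^sub>M borel) (\<lambda>x. (x, x)))"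
    unfolding W1_def by (rule INF_lower) (simp add: coupling_diagonal[OF assms])
  also have "\<dots> = 0" by (subst nn_integral_distr) simp_all
  finally show ?thesis by simp
qed

text \<open>Two potentials with the same gradient differ by a constant, which the normalization
  fixes.\<close>

lemma C1_grad_eq_imp_eq:
  fixes V V' :: "'a::euclidean_space \<Rightarrow> real"
  assumes V: "C1_grad V G" and V': "C1_grad V' G"
    and prob: "prob_space (gibbs V)"
      "prob_space (gibbs V')"
  shows "V = V'"
proof -
  define c where "c = V 0 - V' 0"
  have eq: "V x = V' x + c" for x
  proof -
    have "C1_grad (\<lambda>x. V x - V' x) (\<lambda>_. 0)"
      using V V' unfolding C1_grad_def
      by (auto intro!: has_derivative_eq_rhs[OF has_derivative_diff])
    then obtain s where "V (0 + x) - V' (0 + x) - (V 0 - V' 0) = 0 \<bullet> x"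
      by (rule C1_grad_mvt[where x=0 and v=x]) blast
    then show ?thesis by (simp add: c_def)
  qed
  have 1: "(\<integral>\<^sup>+x. ennreal (exp (- V x)) \<partial>lborel) = 1" "(\<integral>\<^sup>+x. ennreal (exp (- V' x)) \<partial>lborel) = 1"
    using prob_space.emeasure_space_1[OF prob(1)] prob_space.emeasure_space_1[OF prob(2)]
      C1_grad_borel[OF V] C1_grad_borel[OF V'] by (simp_all add: emeasure_density)
  have "(\<integral>\<^sup>+x. ennreal (exp (- V x)) \<partial>lborel) = (\<integral>\<^sup>+x. ennreal (exp (- c)) * ennreal (exp (- V' x)) \<partial>lborel)"
    by (simp add: eq exp_diff exp_minus exp_add ennreal_mult'[symmetric] field_simps)
  also have "\<dots> = ennreal (exp (- c))"
    using C1_grad_borel[OF V'] by (simp add: nn_integral_cmult 1)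
  finally have "c = 0" using 1 by (simp add: ennreal_eq_1)
  then show ?thesis using eq by auto
qed

context tilde_g
begin

text \<open>If \<open>deriv g R = 0\<close>, division in \<open>ennreal\<close> makes the constant
  infinite and the bound trivial, unless the integral vanishes: \<open>\<infinity> * 0 = 0\<close>.
  In that case the two measures have to be shown equal.\<close>

lemma W1_bound:
  fixes Up Uq :: "'a::euclidean_space \<Rightarrow> real"
  defines "P \<equiv> gibbs Up" and "Q \<equiv> gibbs Uq"
  assumes C1p: "C1_grad Up Gp" and C1q: "C1_grad Uq Gq" and prob: "prob_space P" "prob_space Q"
    and intq: "integrable Q norm" and \<kappa>: "\<forall>r>0. kappa Gp r \<ge> ereal (\<alpha> - g r / r)"
  shows "W1 P Q \<le> (ennreal g0' / ennreal (deriv g R))\<^sup>2 * ennreal (1 / (\<alpha> + g0'))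
    * (\<integral>\<^sup>+x. ennreal (norm (Gp x - Gq x)) \<partial>Q)"
proof -
  note [measurable] = C1_grad_borel_grad[OF C1p] C1_grad_borel_grad[OF C1q]
  have [measurable_cong]: "sets Q = sets borel" by (simp add: Q_def)
  define D where "D = (\<integral>\<^sup>+x. ennreal (norm (Gp x - Gq x)) \<partial>Q)"
  define M where "M = (ennreal g0' / ennreal (deriv g R))\<^sup>2 * ennreal (1 / (\<alpha> + g0'))"
  have \<alpha>g: "1 / (\<alpha> + g0') > 0" using \<alpha>_pos g0'_pos by simp
  have "W1 P Q \<le> M * D"
  proof (cases "D = \<infinity>")
    case True
    have "ennreal g0' / ennreal (deriv g R) \<noteq> 0" using g0'_pos by (simp add: ennreal_divide_eq_0_iff)
    then have "M \<noteq> 0" using \<alpha>g by (simp add: M_def)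
    then show ?thesis using True by (simp add: ennreal_mult_top)
  next
    case False
    have intE: "integrable Q (\<lambda>y. norm (Gp y - Gq y))"
      using False by (intro integrableI_bounded) (simp_all add: D_def less_top)
    define e where "e = (\<integral>y. norm (Gp y - Gq y) \<partial>Q)"
    have De: "D = ennreal e" unfolding D_def e_def by (rule nn_integral_eq_integral[OF intE]) simp
    have e0: "e \<ge> 0" by (simp add: e_def)
    consider "deriv g R > 0" | "deriv g R = 0" "e > 0" | "e = 0" using g'_nonneg[OF R_pos] e0 by linarith
    then show ?thesis
    proof cases
      case 1
      define \<rho> where "\<rho> = \<Lambda> * deriv g R"
      have \<rho>: "\<rho> > 0" using 1 g0'_pos \<alpha>_pos by (simp add: \<rho>_def \<Lambda>_def)
      have "ennreal \<rho> * W1 P Q \<le> ennreal (g0' / 4 * e)"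
      proof (rule ennreal_le_epsilon)
        fix \<epsilon> :: real assume "\<epsilon> > 0"
        then have "ennreal \<rho> * W1 P Q \<le> ennreal (g0' / 4 * e + 6 * (\<epsilon> / 6))"
          unfolding \<rho>_def e_def P_def Q_def
          by (intro main_estimate[OF C1p C1q prob[unfolded P_def Q_def] intq[unfolded Q_def] intE[unfolded Q_def] \<kappa>]) simp
        then show "ennreal \<rho> * W1 P Q \<le> ennreal (g0' / 4 * e) + ennreal \<epsilon>"
          using \<open>\<epsilon> > 0\<close> e0 g0'_pos by (simp add: ennreal_plus[symmetric] del: ennreal_plus)
      qed
      then have "ennreal (1 / \<rho>) * (ennreal \<rho> * W1 P Q) \<le> ennreal (1 / \<rho>) * ennreal (g0' / 4 * e)"
        by (intro mult_left_mono) auto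
      also have "ennreal (1 / \<rho>) * (ennreal \<rho> * W1 P Q) = W1 P Q"
        using \<rho> by (simp add: mult.assoc[symmetric] ennreal_mult'[symmetric])
      also have "ennreal (1 / \<rho>) * ennreal (g0' / 4 * e) = ennreal ((g0' / deriv g R)\<^sup>2 * (1 / (\<alpha> + g0')) * e)"
      proof -
        have "1 / \<rho> * (g0' / 4 * e) = (g0' / deriv g R)\<^sup>2 * (1 / (\<alpha> + g0')) * e"
          by (simp add: \<rho>_def \<Lambda>_def power2_eq_square mult_ac)
        then show ?thesis using \<rho> by (simp only: ennreal_mult'[symmetric] zero_le_divide_1_iff less_imp_le)
      qed
      also have "\<dots> = M * D"
      proof -
        have "ennreal ((g0' / deriv g R)\<^sup>2 * (1 / (\<alpha> + g0')) * e) = ennreal ((g0' / deriv g R)\<^sup>2) * ennreal (1 / (\<alpha> + g0')) * ennreal e"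
          using e0 by (simp only: ennreal_mult'' ennreal_mult' zero_le_power2)
        also have "ennreal ((g0' / deriv g R)\<^sup>2) = (ennreal g0' / ennreal (deriv g R))\<^sup>2"
          using 1 g0'_pos by (simp add: divide_ennreal ennreal_power)
        finally show ?thesis by (simp only: M_def De)
      qed
      finally show ?thesis .
    next
      case 2
      have "M = \<infinity>" using 2 g0'_pos \<alpha>g by (simp add: M_def ennreal_divide_zero ennreal_top_mult power2_eq_square)
      then show ?thesis using 2 by (simp add: De ennreal_top_mult)
    next
      case 3
      have "AE y in Q. norm (Gp y - Gq y) = 0"
        using 3 integral_nonneg_eq_0_iff_AE[OF intE] by (simp add: e_def)
      then have ae: "AE y in lborel. Gp y - Gq y = 0"
        unfolding Q_def using C1_grad_borel[OF C1q] by (subst (asm) AE_density) auto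
      have "Gp y - Gq y = 0" for y
      proof (rule ccontr)
        have cont: "continuous_on UNIV (\<lambda>y. Gp y - Gq y)"
          using C1p C1q by (intro continuous_intros) (auto simp: C1_grad_def)
        assume ne: "Gp y - Gq y \<noteq> 0"
        \<comment> \<open>An open null set is empty, so continuous gradients that agree almost
          everywhere agree everywhere.\<close>
        define S where "S = (\<lambda>y. Gp y - Gq y) -` (- {0})"
        have S: "open S" "y \<in> S"
          unfolding S_def using ne cont by (auto intro!: open_vimage)
        then have "emeasure lborel S = 0"
          using ae by (subst (asm) AE_iff_measurable[where N=S]) (auto simp: S_def)
        then have "negligible S"
          using S by (simp add: negligible_iff_null_sets null_sets_completion_iff null_setsI)
        then show False using S open_not_negligible by blast
      qed
      then have "Gp = Gq" by auto
      then have "Up = Uq"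
        using C1_grad_eq_imp_eq[OF C1p] C1q prob by (simp add: P_def Q_def)
      then have "W1 P Q = 0" unfolding P_def Q_def by (simp add: W1_self)
      then show ?thesis by simp
    qed
  qed
  then show ?thesis by (simp only: M_def D_def)
qed

end

text \<open>The logarithm of dp/dq is \<open>Uq - Up\<close>, so the integrand is also the norm of
  its gradient, and the two forms of the bound coincide.\<close>

theorem theorem20:
  fixes Up Uq :: "'a::euclidean_space \<Rightarrow> real"
    and Gp Gq :: "'a \<Rightarrow> 'a"
    and \<gamma>q Rq \<alpha>p g0' :: real
    and g :: "real \<Rightarrow> real"
  assumes C1p: "C1_grad Up Gp" and C1q: "C1_grad Uq Gq"
    and probp: "prob_space (density lborel (\<lambda>x. ennreal (exp (- Up x))))"
    and probq: "prob_space (density lborel (\<lambda>x. ennreal (exp (- Uq x))))"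
    and \<gamma>q_pos: "\<gamma>q > 0" and Rq_nonneg: "Rq \<ge> 0"
    and drift_q: "\<forall>x. norm x \<ge> Rq \<longrightarrow> - (1/2) * inner (Gq x) x \<le> - \<gamma>q * (norm x)\<^sup>2"
    and \<alpha>p_pos: "\<alpha>p > 0"
    and g_in: "calG_tilde g"
    and kappa_p: "\<forall>r>0. kappa Gp r \<ge> ereal (\<alpha>p - g r / r)"
    and g'0: "(deriv g \<longlongrightarrow> g0') (at_right 0)" and g'0_pos: "g0' > 0"
  shows "W1 (density lborel (\<lambda>x. ennreal (exp (- Up x))))
            (density lborel (\<lambda>x. ennreal (exp (- Uq x))))
         \<le> (ennreal g0' / ennreal (deriv g (sup_norm_pos g * (1 / g0' + 2 / \<alpha>p))))\<^sup>2
            * ennreal (1 / (\<alpha>p + g0'))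
            * (\<integral>\<^sup>+ x. ennreal (norm (Gp x - Gq x))
                 \<partial>(density lborel (\<lambda>x. ennreal (exp (- Uq x)))))"
proof -
  interpret tg: tilde_g g g0' \<alpha>p
    by unfold_locales (fact g_in g'0 g'0_pos \<alpha>p_pos)+
  have "integrable (density lborel (\<lambda>x. ennreal (exp (- Uq x)))) norm"
    using integrable_norm_dissipative[OF C1q probq \<gamma>q_pos, of Rq] drift_q by simp
  from tg.W1_bound[OF C1p C1q probp probq this kappa_p]
  show ?thesis by (simp only: tg.R_def tg.N_def)
qed

end
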